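(* Let $\mathcal{M}$ be a pointed model category. Suppose there exist a natural number $n\ge 2$ and a weak classifying object of type $n$ for $\mathcal{M}$. Then the homotopy category $\mathrm{ho}(\mathcal{M})$ is not concrete, i.e. there is no faithful functor $\mathrm{ho}(\mathcal{M})\to\mathbf{Set}$.
   Context: A category $\mathbf{C}$ is concrete if it admits a faithful functor $U\colon\mathbf{C}\to\mathbf{Set}$. For a model category $\mathcal{M}$ with class of weak equivalences $\mathrm{wk}$, $\mathrm{ho}(\mathcal{M})=\mathcal{M}[\mathrm{wk}^{-1}]$ denotes its homotopy category. For $\mathcal{M}$ pointed, the suspension functor $\Sigma\colon\mathrm{ho}(\mathcal{M})\to\mathrm{ho}(\mathcal{M})$ sends $X$ to the homotopy pushout of $0\leftarrow X\to 0$, and the loop functor $\Omega\colon\mathrm{ho}(\mathcal{M})\to\mathrm{ho}(\mathcal{M})$ sends $Y$ to the homotopy pullback of $0\to Y\leftarrow 0$; they form an adjunction $\Sigma\dashv\Omega$. For an object $A$ (the coefficient object), the $n$-th homotopy group of $X$ with coefficients in $A$ is $\pi_n^A(X):=\mathrm{ho}(\mathcal{M})(A,\Omega^nX)$; it is a group for $n\ge1$ and abelian for $n\ge2$. The coefficient object $A$ is fixed and suppressed from the notation, giving functors $\pi_n\colon\mathrm{ho}(\mathcal{M})\to\mathbf{Grp}$ for $n\ge 1$. Let $\mathcal{K}$ be a category and $\varpi\colon\mathrm{ho}(\mathcal{M})\to\mathcal{K}$ a functor. A weak classifying object for $\mathcal{M}$ relative to $\varpi$ is a functor $k\colon\mathcal{K}\to\mathrm{ho}(\mathcal{M})$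 such that (i) the composition $\varpi\circ k$ is a full functor; and (ii) there is a natural transformation $\epsilon\colon\varpi\circ k\Rightarrow 1$ which is an objectwise epimorphism (then $k$ is called a right weak classifying object), or there is a natural transformation $\eta\colon 1\Rightarrow\varpi\circ k$ which is an objectwise monomorphism (then $k$ is called a left weak classifying object). A weak classifying object of type $n$ for $\mathcal{M}$ is a weak classifying object, right or left, relative to $\pi_n=\pi_n^A\colon\mathrm{ho}(\mathcal{M})\to\mathbf{Grp}$ for some coefficient object $A$. When $n\ge2$, its domain may be restricted to abelian groups, i.e. one may take $\mathcal{K}=\mathbf{Ab}$ and $\pi_n\colon\mathrm{ho}(\mathcal{M})\to\mathbf{Ab}$. *)

theory Defs
  imports "HOL-Algebra.Group" "HOL-Library.Equipollence"
begin

section \<open>Small sets\<close>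

text \<open>
  The type \<open>'u\<close> plays the role of the universe of sets: a set of any type is small if it is
  strictly smaller than \<open>'u\<close>, and the cardinality of \<open>'u\<close> is required to be inaccessible, so
  that the small subsets of \<open>'u\<close> form a model of the category of sets, with \<open>'u\<close> itself having
  the size of a proper class.
\<close>

definition small :: "'u itself \<Rightarrow> 'x set \<Rightarrow> bool" where
  "small U A \<longleftrightarrow> A \<prec> (UNIV :: 'u set)"

definition universe :: "'u itself \<Rightarrow> bool" where
  "universe U \<longleftrightarrow>
     small U (UNIV :: nat set) \<and>
     (\<forall>A :: 'u set. small U A \<longrightarrow> small U (Pow A)) \<and>
     (\<forall>(I :: 'u set) (X :: 'u \<Rightarrow> 'u set).
        small U I \<and> (\<forall>i\<in>I. small U (X i)) \<longrightarrow> small U (\<Union>i\<in>I. X i))"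


section \<open>Categories and functors\<close>

record ('o, 'a) category =
  Obj :: "'o set"
  Arr :: "'a set"
  Src :: "'a \<Rightarrow> 'o"
  Tgt :: "'a \<Rightarrow> 'o"
  Ident :: "'o \<Rightarrow> 'a"
  Comp :: "'a \<Rightarrow> 'a \<Rightarrow> 'a" (infixr "\<cdot>\<index>" 70)

definition Hom :: "('o, 'a, 'z) category_scheme \<Rightarrow> 'o \<Rightarrow> 'o \<Rightarrow> 'a set" where
  "Hom C x y = {f \<in> Arr C. Src C f = x \<and> Tgt C f = y}"

locale category =
  fixes C :: "('o, 'a, 'z) category_scheme" (structure)
  assumes src_obj: "f \<in> Arr C \<Longrightarrow> Src C f \<in> Obj C"
    and tgt_obj: "f \<in> Arr C \<Longrightarrow> Tgt C f \<in> Obj C"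
    and ident_hom: "x \<in> Obj C \<Longrightarrow> Ident C x \<in> Hom C x x"
    and comp_hom: "f \<in> Hom C x y \<Longrightarrow> g \<in> Hom C y z \<Longrightarrow> g \<cdot> f \<in> Hom C x z"
    and ident_left: "f \<in> Hom C x y \<Longrightarrow> Ident C y \<cdot> f = f"
    and ident_right: "f \<in> Hom C x y \<Longrightarrow> f \<cdot> Ident C x = f"
    and comp_assoc: "f \<in> Hom C w x \<Longrightarrow> g \<in> Hom C x y \<Longrightarrow> h \<in> Hom C y z \<Longrightarrow>
                     (h \<cdot> g) \<cdot> f = h \<cdot> (g \<cdot> f)"

definition locally_small :: "'u itself \<Rightarrow> ('o, 'a, 'z) category_scheme \<Rightarrow> bool" where
  "locally_small U C \<longleftrightarrow> (\<forall>x\<in>Obj C. \<forall>y\<in>Obj C. small U (Hom C x y))"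

definition op_cat :: "('o, 'a, 'z) category_scheme \<Rightarrow> ('o, 'a) category" where
  "op_cat C = \<lparr>Obj = Obj C, Arr = Arr C, Src = Tgt C, Tgt = Src C, Ident = Ident C,
               Comp = (\<lambda>g f. f \<cdot>\<^bsub>C\<^esub> g)\<rparr>"

definition is_iso :: "('o, 'a, 'z) category_scheme \<Rightarrow> 'a \<Rightarrow> bool" where
  "is_iso C f \<longleftrightarrow> f \<in> Arr C \<and> (\<exists>g \<in> Hom C (Tgt C f) (Src C f).
     g \<cdot>\<^bsub>C\<^esub> f = Ident C (Src C f) \<and> f \<cdot>\<^bsub>C\<^esub> g = Ident C (Tgt C f))"

definition is_epi :: "('o, 'a, 'z) category_scheme \<Rightarrow> 'a \<Rightarrow> bool" where
  "is_epi C f \<longleftrightarrow> f \<in> Arr C \<and> (\<forall>z. \<forall>g \<in> Hom C (Tgt C f) z. \<forall>h \<in> Hom C (Tgt C f) z.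
     g \<cdot>\<^bsub>C\<^esub> f = h \<cdot>\<^bsub>C\<^esub> f \<longrightarrow> g = h)"

definition is_mono :: "('o, 'a, 'z) category_scheme \<Rightarrow> 'a \<Rightarrow> bool" where
  "is_mono C f \<longleftrightarrow> f \<in> Arr C \<and> (\<forall>w. \<forall>g \<in> Hom C w (Src C f). \<forall>h \<in> Hom C w (Src C f).
     f \<cdot>\<^bsub>C\<^esub> g = f \<cdot>\<^bsub>C\<^esub> h \<longrightarrow> g = h)"

record ('o1, 'a1, 'o2, 'a2) cat_functor =
  onObj :: "'o1 \<Rightarrow> 'o2"
  onArr :: "'a1 \<Rightarrow> 'a2"

definition is_functor :: "('o1, 'a1, 'z1) category_scheme \<Rightarrow> ('o2, 'a2, 'z2) category_scheme \<Rightarrow>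
    ('o1, 'a1, 'o2, 'a2) cat_functor \<Rightarrow> bool" where
  "is_functor C D F \<longleftrightarrow>
     (\<forall>x \<in> Obj C. onObj F x \<in> Obj D) \<and>
     (\<forall>x y. \<forall>f \<in> Hom C x y. onArr F f \<in> Hom D (onObj F x) (onObj F y)) \<and>
     (\<forall>x \<in> Obj C. onArr F (Ident C x) = Ident D (onObj F x)) \<and>
     (\<forall>x y z. \<forall>f \<in> Hom C x y. \<forall>g \<in> Hom C y z.
        onArr F (g \<cdot>\<^bsub>C\<^esub> f) = onArr F g \<cdot>\<^bsub>D\<^esub> onArr F f)"

definition functor_id :: "('o, 'a, 'o, 'a) cat_functor" where
  "functor_id = \<lparr>onObj = id, onArr = id\<rparr>"

definition functor_comp :: "('o2, 'a2, 'o3, 'a3) cat_functor \<Rightarrow> ('o1, 'a1, 'o2, 'a2) cat_functor \<Rightarrow>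
    ('o1, 'a1, 'o3, 'a3) cat_functor" where
  "functor_comp G F = \<lparr>onObj = onObj G \<circ> onObj F, onArr = onArr G \<circ> onArr F\<rparr>"

definition is_full :: "('o1, 'a1, 'z1) category_scheme \<Rightarrow> ('o2, 'a2, 'z2) category_scheme \<Rightarrow>
    ('o1, 'a1, 'o2, 'a2) cat_functor \<Rightarrow> bool" where
  "is_full C D F \<longleftrightarrow> (\<forall>x \<in> Obj C. \<forall>y \<in> Obj C. \<forall>g \<in> Hom D (onObj F x) (onObj F y).
     \<exists>f \<in> Hom C x y. onArr F f = g)"

definition is_faithful :: "('o1, 'a1, 'z1) category_scheme \<Rightarrow> ('o2, 'a2, 'z2) category_scheme \<Rightarrow>
    ('o1, 'a1, 'o2, 'a2) cat_functor \<Rightarrow> bool" where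
  "is_faithful C D F \<longleftrightarrow> (\<forall>x \<in> Obj C. \<forall>y \<in> Obj C. inj_on (onArr F) (Hom C x y))"

definition is_nat_trans :: "('o1, 'a1, 'z1) category_scheme \<Rightarrow> ('o2, 'a2, 'z2) category_scheme \<Rightarrow>
    ('o1, 'a1, 'o2, 'a2) cat_functor \<Rightarrow> ('o1, 'a1, 'o2, 'a2) cat_functor \<Rightarrow> ('o1 \<Rightarrow> 'a2) \<Rightarrow> bool" where
  "is_nat_trans C D F G t \<longleftrightarrow>
     (\<forall>x \<in> Obj C. t x \<in> Hom D (onObj F x) (onObj G x)) \<and>
     (\<forall>x y. \<forall>f \<in> Hom C x y. t y \<cdot>\<^bsub>D\<^esub> onArr F f = onArr G f \<cdot>\<^bsub>D\<^esub> t x)"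


section \<open>Limits and zero objects\<close>

definition is_cone :: "('i, 'j, 'z1) category_scheme \<Rightarrow> ('o, 'a, 'z2) category_scheme \<Rightarrow>
    ('i, 'j, 'o, 'a) cat_functor \<Rightarrow> 'o \<Rightarrow> ('i \<Rightarrow> 'a) \<Rightarrow> bool" where
  "is_cone J C F x c \<longleftrightarrow> x \<in> Obj C \<and> (\<forall>i \<in> Obj J. c i \<in> Hom C x (onObj F i)) \<and>
     (\<forall>f \<in> Arr J. onArr F f \<cdot>\<^bsub>C\<^esub> c (Src J f) = c (Tgt J f))"

definition is_limit :: "('i, 'j, 'z1) category_scheme \<Rightarrow> ('o, 'a, 'z2) category_scheme \<Rightarrow>
    ('i, 'j, 'o, 'a) cat_functor \<Rightarrow> 'o \<Rightarrow> ('i \<Rightarrow> 'a) \<Rightarrow> bool" where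
  "is_limit J C F l c \<longleftrightarrow> is_cone J C F l c \<and>
     (\<forall>x d. is_cone J C F x d \<longrightarrow> (\<exists>!u. u \<in> Hom C x l \<and> (\<forall>i \<in> Obj J. c i \<cdot>\<^bsub>C\<^esub> u = d i)))"

definition has_finite_limits :: "('o, 'a, 'z) category_scheme \<Rightarrow> bool" where
  "has_finite_limits C \<longleftrightarrow> (\<forall>(J :: (nat, nat) category) F.
     category J \<and> finite (Obj J) \<and> finite (Arr J) \<and> is_functor J C F \<longrightarrow> (\<exists>l c. is_limit J C F l c))"

definition has_finite_colimits :: "('o, 'a, 'z) category_scheme \<Rightarrow> bool" where
  "has_finite_colimits C \<longleftrightarrow> has_finite_limits (op_cat C)"

definition is_pullback :: "('o, 'a, 'z) category_scheme \<Rightarrow> 'a \<Rightarrow> 'a \<Rightarrow> 'a \<Rightarrow> 'a \<Rightarrow> bool" where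
  "is_pullback C f g p q \<longleftrightarrow>
     f \<in> Arr C \<and> g \<in> Arr C \<and> Tgt C f = Tgt C g \<and> Src C p = Src C q \<and>
     p \<in> Hom C (Src C p) (Src C f) \<and> q \<in> Hom C (Src C q) (Src C g) \<and> f \<cdot>\<^bsub>C\<^esub> p = g \<cdot>\<^bsub>C\<^esub> q \<and>
     (\<forall>x. \<forall>u \<in> Hom C x (Src C f). \<forall>v \<in> Hom C x (Src C g). f \<cdot>\<^bsub>C\<^esub> u = g \<cdot>\<^bsub>C\<^esub> v \<longrightarrow>
        (\<exists>!h. h \<in> Hom C x (Src C p) \<and> p \<cdot>\<^bsub>C\<^esub> h = u \<and> q \<cdot>\<^bsub>C\<^esub> h = v))"

definition is_terminal :: "('o, 'a, 'z) category_scheme \<Rightarrow> 'o \<Rightarrow> bool" where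
  "is_terminal C t \<longleftrightarrow> t \<in> Obj C \<and> (\<forall>x \<in> Obj C. \<exists>!f. f \<in> Hom C x t)"

definition is_initial :: "('o, 'a, 'z) category_scheme \<Rightarrow> 'o \<Rightarrow> bool" where
  "is_initial C i \<longleftrightarrow> i \<in> Obj C \<and> (\<forall>x \<in> Obj C. \<exists>!f. f \<in> Hom C i x)"

definition is_zero :: "('o, 'a, 'z) category_scheme \<Rightarrow> 'o \<Rightarrow> bool" where
  "is_zero C z \<longleftrightarrow> is_initial C z \<and> is_terminal C z"

definition zero_arr :: "('o, 'a, 'z) category_scheme \<Rightarrow> 'o \<Rightarrow> 'o \<Rightarrow> 'a" where
  "zero_arr C x y = (THE f. \<exists>z. is_zero C z \<and> (\<exists>g \<in> Hom C x z. \<exists>h \<in> Hom C z y. f = h \<cdot>\<^bsub>C\<^esub> g))"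


section \<open>Sets and groups\<close>

text \<open>
  An arrow of \<open>Set\<close> or \<open>Grp\<close> is a triple of domain, underlying function and codomain, where the
  function is \<open>undefined\<close> outside the domain.
\<close>

definition Set_cat :: "('u set, 'u set \<times> ('u \<Rightarrow> 'u) \<times> 'u set) category" where
  "Set_cat = \<lparr>
     Obj = {A. small TYPE('u) A},
     Arr = {(A, f, B). small TYPE('u) A \<and> small TYPE('u) B \<and> f \<in> A \<rightarrow>\<^sub>E B},
     Src = (\<lambda>(A, f, B). A),
     Tgt = (\<lambda>(A, f, B). B),
     Ident = (\<lambda>A. (A, \<lambda>x\<in>A. x, A)),
     Comp = (\<lambda>(B, g, D) (A, f, B'). (A, compose A g f, D))\<rparr>"

definition concrete :: "'u itself \<Rightarrow> ('o, 'a, 'z) category_scheme \<Rightarrow> bool" where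
  "concrete U C \<longleftrightarrow>
     (\<exists>F. is_functor C (Set_cat :: ('u set, 'u set \<times> ('u \<Rightarrow> 'u) \<times> 'u set) category) F \<and>
          is_faithful C (Set_cat :: ('u set, 'u set \<times> ('u \<Rightarrow> 'u) \<times> 'u set) category) F)"

type_synonym 'u group_category = "('u monoid, 'u monoid \<times> ('u \<Rightarrow> 'u) \<times> 'u monoid) category"

definition group_cat_on :: "'u monoid set \<Rightarrow> 'u group_category" where
  "group_cat_on Gs = \<lparr>
     Obj = Gs,
     Arr = {(G, f, H). G \<in> Gs \<and> H \<in> Gs \<and> f \<in> hom G H \<and> f \<in> extensional (carrier G)},
     Src = (\<lambda>(G, f, H). G),
     Tgt = (\<lambda>(G, f, H). H),
     Ident = (\<lambda>G. (G, \<lambda>x\<in>carrier G. x, G)),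
     Comp = (\<lambda>(H, g, K) (G, f, H'). (G, compose (carrier G) g f, K))\<rparr>"

definition Grp_cat :: "'u group_category" where
  "Grp_cat = group_cat_on {G. group G \<and> small TYPE('u) (carrier G)}"

definition Ab_cat :: "'u group_category" where
  "Ab_cat = group_cat_on {G. comm_group G \<and> small TYPE('u) (carrier G)}"

text \<open>
  The homotopy groups below live on a type of arrows. To regard them as objects of \<open>Grp\<close> they are
  transported along a chosen bijection between the carrier and a subset of \<open>'u\<close>, which exists
  as soon as the carrier is small; any other choice gives a naturally isomorphic functor.
\<close>

definition code :: "'x set \<Rightarrow> 'x \<Rightarrow> 'u" where
  "code S = (SOME e. inj_on e S)"

definition decode :: "'x set \<Rightarrow> 'u \<Rightarrow> 'x" where
  "decode S = inv_into S (code S)"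

definition group_copy :: "'x monoid \<Rightarrow> 'u monoid" where
  "group_copy G = \<lparr>
     carrier = code (carrier G) ` carrier G,
     mult = (\<lambda>x y. code (carrier G) (decode (carrier G) x \<otimes>\<^bsub>G\<^esub> decode (carrier G) y)),
     one = code (carrier G) \<one>\<^bsub>G\<^esub>\<rparr>"


section \<open>Localization\<close>

text \<open>
  The category of fractions \<open>C[W\<^sup>-\<^sup>1]\<close>: its arrows are zigzags of arrows of \<open>C\<close> whose backward steps
  lie in \<open>W\<close>, modulo the congruence making \<open>Fwd\<close> a functor and \<open>Bwd w\<close> inverse to \<open>Fwd w\<close>. Zigzags
  are listed in the order in which they are traversed.
\<close>

datatype 'a step = Fwd 'a | Bwd 'a

inductive zigzag :: "('o, 'a, 'z) category_scheme \<Rightarrow> 'a set \<Rightarrow> 'o \<Rightarrow> 'a step list \<Rightarrow> 'o \<Rightarrow> bool"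
  for C W where
  zz_nil: "x \<in> Obj C \<Longrightarrow> zigzag C W x [] x"
| zz_fwd: "f \<in> Hom C x y \<Longrightarrow> zigzag C W y s z \<Longrightarrow> zigzag C W x (Fwd f # s) z"
| zz_bwd: "w \<in> W \<Longrightarrow> w \<in> Hom C y x \<Longrightarrow> zigzag C W y s z \<Longrightarrow> zigzag C W x (Bwd w # s) z"

inductive zz_rel :: "('o, 'a, 'z) category_scheme \<Rightarrow> 'a set \<Rightarrow> 'a step list \<Rightarrow> 'a step list \<Rightarrow> bool"
  for C W where
  zzr_id: "x \<in> Obj C \<Longrightarrow> zz_rel C W [Fwd (Ident C x)] []"
| zzr_comp: "f \<in> Hom C x y \<Longrightarrow> g \<in> Hom C y z \<Longrightarrow> zz_rel C W [Fwd f, Fwd g] [Fwd (g \<cdot>\<^bsub>C\<^esub> f)]"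
| zzr_fb: "w \<in> W \<Longrightarrow> zz_rel C W [Fwd w, Bwd w] []"
| zzr_bf: "w \<in> W \<Longrightarrow> zz_rel C W [Bwd w, Fwd w] []"

inductive zz_eq :: "('o, 'a, 'z) category_scheme \<Rightarrow> 'a set \<Rightarrow> 'o \<Rightarrow> 'o \<Rightarrow>
    'a step list \<Rightarrow> 'a step list \<Rightarrow> bool"
  for C W x y where
  zze_refl: "zigzag C W x s y \<Longrightarrow> zz_eq C W x y s s"
| zze_sym: "zz_eq C W x y s t \<Longrightarrow> zz_eq C W x y t s"
| zze_trans: "zz_eq C W x y s t \<Longrightarrow> zz_eq C W x y t u \<Longrightarrow> zz_eq C W x y s u"
| zze_rel: "zz_rel C W r r' \<Longrightarrow> zigzag C W x (s @ r @ t) y \<Longrightarrow> zigzag C W x (s @ r' @ t) y \<Longrightarrow>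
            zz_eq C W x y (s @ r @ t) (s @ r' @ t)"

type_synonym ('o, 'a) fraction = "'o \<times> 'a step list set \<times> 'o"

definition fraction :: "('o, 'a, 'z) category_scheme \<Rightarrow> 'a set \<Rightarrow> 'o \<Rightarrow> 'a step list \<Rightarrow> 'o \<Rightarrow>
    ('o, 'a) fraction" where
  "fraction C W x s y = (x, {t. zz_eq C W x y s t}, y)"

definition localization :: "('o, 'a, 'z) category_scheme \<Rightarrow> 'a set \<Rightarrow>
    ('o, ('o, 'a) fraction) category" where
  "localization C W = \<lparr>
     Obj = Obj C,
     Arr = {fraction C W x s y | x s y. zigzag C W x s y},
     Src = (\<lambda>(x, S, y). x),
     Tgt = (\<lambda>(x, S, y). y),
     Ident = (\<lambda>x. fraction C W x [] x),
     Comp = (\<lambda>(y', T, z) (x, S, y). (x, {u. \<exists>s\<in>S. \<exists>t\<in>T. zz_eq C W x z (s @ t) u}, z))\<rparr>"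

definition loc_arr :: "('o, 'a, 'z) category_scheme \<Rightarrow> 'a set \<Rightarrow> 'a \<Rightarrow> ('o, 'a) fraction" where
  "loc_arr C W f = fraction C W (Src C f) [Fwd f] (Tgt C f)"


section \<open>Model categories\<close>

record ('o, 'a) model = "('o, 'a) category" +
  Weq :: "'a set"
  Cof :: "'a set"
  Fib :: "'a set"

definition is_retract :: "('o, 'a, 'z) category_scheme \<Rightarrow> 'a \<Rightarrow> 'a \<Rightarrow> bool" where
  "is_retract C f g \<longleftrightarrow> f \<in> Arr C \<and> g \<in> Arr C \<and>
     (\<exists>i \<in> Hom C (Src C f) (Src C g). \<exists>r \<in> Hom C (Src C g) (Src C f).
      \<exists>i' \<in> Hom C (Tgt C f) (Tgt C g). \<exists>r' \<in> Hom C (Tgt C g) (Tgt C f).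
        r \<cdot>\<^bsub>C\<^esub> i = Ident C (Src C f) \<and> r' \<cdot>\<^bsub>C\<^esub> i' = Ident C (Tgt C f) \<and>
        g \<cdot>\<^bsub>C\<^esub> i = i' \<cdot>\<^bsub>C\<^esub> f \<and> f \<cdot>\<^bsub>C\<^esub> r = r' \<cdot>\<^bsub>C\<^esub> g)"

definition has_lift :: "('o, 'a, 'z) category_scheme \<Rightarrow> 'a \<Rightarrow> 'a \<Rightarrow> bool" where
  "has_lift C i p \<longleftrightarrow>
     (\<forall>u \<in> Hom C (Src C i) (Src C p). \<forall>v \<in> Hom C (Tgt C i) (Tgt C p). p \<cdot>\<^bsub>C\<^esub> u = v \<cdot>\<^bsub>C\<^esub> i \<longrightarrow>
        (\<exists>h \<in> Hom C (Tgt C i) (Src C p). h \<cdot>\<^bsub>C\<^esub> i = u \<and> p \<cdot>\<^bsub>C\<^esub> h = v))"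

text \<open>
  Quillen's axioms for a closed model category: only finite limits and colimits are required, and
  the factorizations need not be functorial.
\<close>

locale model_category = category M for M :: "('o, 'a, 'z) model_scheme" (structure) +
  assumes weq_arr: "Weq M \<subseteq> Arr M" and cof_arr: "Cof M \<subseteq> Arr M" and fib_arr: "Fib M \<subseteq> Arr M"
    and finite_limits: "has_finite_limits M"
    and finite_colimits: "has_finite_colimits M"
    and weq_comp: "f \<in> Hom M x y \<Longrightarrow> g \<in> Hom M y z \<Longrightarrow> f \<in> Weq M \<Longrightarrow> g \<in> Weq M \<Longrightarrow> g \<cdot> f \<in> Weq M"
    and weq_left: "f \<in> Hom M x y \<Longrightarrow> g \<in> Hom M y z \<Longrightarrow> f \<in> Weq M \<Longrightarrow> g \<cdot> f \<in> Weq M \<Longrightarrow> g \<in> Weq M"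
    and weq_right: "f \<in> Hom M x y \<Longrightarrow> g \<in> Hom M y z \<Longrightarrow> g \<in> Weq M \<Longrightarrow> g \<cdot> f \<in> Weq M \<Longrightarrow> f \<in> Weq M"
    and weq_retract: "is_retract M f g \<Longrightarrow> g \<in> Weq M \<Longrightarrow> f \<in> Weq M"
    and cof_retract: "is_retract M f g \<Longrightarrow> g \<in> Cof M \<Longrightarrow> f \<in> Cof M"
    and fib_retract: "is_retract M f g \<Longrightarrow> g \<in> Fib M \<Longrightarrow> f \<in> Fib M"
    and lift_cof: "i \<in> Cof M \<Longrightarrow> p \<in> Fib M \<Longrightarrow> p \<in> Weq M \<Longrightarrow> has_lift M i p"
    and lift_fib: "i \<in> Cof M \<Longrightarrow> i \<in> Weq M \<Longrightarrow> p \<in> Fib M \<Longrightarrow> has_lift M i p"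
    and factor_cof: "f \<in> Hom M x y \<Longrightarrow>
          \<exists>z. \<exists>i \<in> Hom M x z. \<exists>p \<in> Hom M z y. f = p \<cdot> i \<and> i \<in> Cof M \<and> p \<in> Fib M \<inter> Weq M"
    and factor_fib: "f \<in> Hom M x y \<Longrightarrow>
          \<exists>z. \<exists>i \<in> Hom M x z. \<exists>p \<in> Hom M z y. f = p \<cdot> i \<and> i \<in> Cof M \<inter> Weq M \<and> p \<in> Fib M"

locale pointed_model_category = model_category +
  assumes pointed: "\<exists>z. is_zero M z"

definition ho :: "('o, 'a, 'z) model_scheme \<Rightarrow> ('o, ('o, 'a) fraction) category" where
  "ho M = localization M (Weq M)"

definition ho_arr :: "('o, 'a, 'z) model_scheme \<Rightarrow> 'a \<Rightarrow> ('o, 'a) fraction" where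
  "ho_arr M f = loc_arr M (Weq M) f"


section \<open>Homotopy pullbacks and the loop functor\<close>

definition is_fibrant :: "('o, 'a, 'z) model_scheme \<Rightarrow> 'o \<Rightarrow> bool" where
  "is_fibrant M x \<longleftrightarrow> x \<in> Obj M \<and> (\<forall>t. \<forall>f \<in> Hom M x t. is_terminal M t \<longrightarrow> f \<in> Fib M)"

text \<open>
  The cospan of \<open>f: X \<rightarrow> Y\<close> and \<open>g: X' \<rightarrow> Y\<close> is replaced by a weakly equivalent cospan of fibrations
  \<open>p\<close> and \<open>q\<close> with fibrant common target, \<open>j\<close> being the weak equivalence at \<open>Y\<close>; the source of
  \<open>r\<close> and \<open>r'\<close> is the pullback of the replacement, i.e. a homotopy pullback of \<open>f\<close> and \<open>g\<close>.
\<close>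

definition is_homotopy_pullback :: "('o, 'a, 'z) model_scheme \<Rightarrow> 'a \<Rightarrow> 'a \<Rightarrow>
    'a \<Rightarrow> 'a \<Rightarrow> 'a \<Rightarrow> 'a \<Rightarrow> 'a \<Rightarrow> bool" where
  "is_homotopy_pullback M f g j p q r r' \<longleftrightarrow>
     f \<in> Arr M \<and> g \<in> Arr M \<and> Tgt M f = Tgt M g \<and>
     p \<in> Fib M \<and> q \<in> Fib M \<and> Tgt M p = Tgt M q \<and> is_fibrant M (Tgt M p) \<and>
     j \<in> Weq M \<and> j \<in> Hom M (Tgt M f) (Tgt M p) \<and>
     (\<exists>a \<in> Weq M. a \<in> Hom M (Src M f) (Src M p) \<and> p \<cdot>\<^bsub>M\<^esub> a = j \<cdot>\<^bsub>M\<^esub> f) \<and>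
     (\<exists>b \<in> Weq M. b \<in> Hom M (Src M g) (Src M q) \<and> q \<cdot>\<^bsub>M\<^esub> b = j \<cdot>\<^bsub>M\<^esub> g) \<and>
     is_pullback M p q r r'"

definition is_loop_object :: "('o, 'a, 'z) model_scheme \<Rightarrow> 'o \<Rightarrow>
    'a \<Rightarrow> 'a \<Rightarrow> 'a \<Rightarrow> 'a \<Rightarrow> 'a \<Rightarrow> bool" where
  "is_loop_object M Y j p q r r' \<longleftrightarrow>
     (\<exists>z z'. is_zero M z \<and> is_zero M z' \<and>
        (\<exists>f \<in> Hom M z Y. \<exists>g \<in> Hom M z' Y. is_homotopy_pullback M f g j p q r r'))"

text \<open>
  A loop functor is a functor \<open>\<Omega>\<close> on \<open>ho M\<close> together with isomorphisms \<open>\<theta>\<close> from \<open>\<Omega> Y\<close> to every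
  homotopy pullback of \<open>0 \<rightarrow> Y \<leftarrow> 0\<close>, natural with respect to all maps of replaced cospans. Every
  pointed model category has one, and the pair \<open>(\<Omega>, \<theta>)\<close> is unique up to a unique isomorphism,
  since every arrow of \<open>M\<close> extends to a map of suitable replacements.
\<close>

type_synonym ('o, 'a) ho_endo = "('o, ('o, 'a) fraction, 'o, ('o, 'a) fraction) cat_functor"

definition is_loop_functor :: "('o, 'a, 'z) model_scheme \<Rightarrow> ('o, 'a) ho_endo \<Rightarrow>
    ('a \<Rightarrow> 'a \<Rightarrow> 'a \<Rightarrow> 'a \<Rightarrow> 'a \<Rightarrow> ('o, 'a) fraction) \<Rightarrow> bool" where
  "is_loop_functor M \<Omega> \<theta> \<longleftrightarrow>
     is_functor (ho M) (ho M) \<Omega> \<and>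
     (\<forall>Y j p q r r'. is_loop_object M Y j p q r r' \<longrightarrow>
        \<theta> j p q r r' \<in> Hom (ho M) (onObj \<Omega> Y) (Src M r) \<and> is_iso (ho M) (\<theta> j p q r r')) \<and>
     (\<forall>Y j p q r r' Y' k s t m m'.
        is_loop_object M Y j p q r r' \<and> is_loop_object M Y' k s t m m' \<longrightarrow>
        (\<forall>f \<in> Hom M Y Y'. \<forall>g \<in> Hom M (Tgt M j) (Tgt M k).
         \<forall>u \<in> Hom M (Src M p) (Src M s). \<forall>v \<in> Hom M (Src M q) (Src M t).
         \<forall>l \<in> Hom M (Src M r) (Src M m).
           g \<cdot>\<^bsub>M\<^esub> j = k \<cdot>\<^bsub>M\<^esub> f \<and> s \<cdot>\<^bsub>M\<^esub> u = g \<cdot>\<^bsub>M\<^esub> p \<and> t \<cdot>\<^bsub>M\<^esub> v = g \<cdot>\<^bsub>M\<^esub> q \<and>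
           m \<cdot>\<^bsub>M\<^esub> l = u \<cdot>\<^bsub>M\<^esub> r \<and> m' \<cdot>\<^bsub>M\<^esub> l = v \<cdot>\<^bsub>M\<^esub> r' \<longrightarrow>
           \<theta> k s t m m' \<cdot>\<^bsub>ho M\<^esub> onArr \<Omega> (ho_arr M f) = ho_arr M l \<cdot>\<^bsub>ho M\<^esub> \<theta> j p q r r'))"

text \<open>
  Composition of loops. Present \<open>\<Omega> Y\<close> as \<open>P \<times> P\<close> over a fibrant replacement of \<open>Y\<close>, for a fibration
  \<open>p\<close> with weakly contractible source \<open>P\<close> (a path object based at \<open>0\<close>). The triple fibre product
  \<open>P \<times> P \<times> P\<close>, with projections \<open>q01\<close>, \<open>q12\<close>, \<open>q02\<close> to \<open>P \<times> P\<close>, is weakly equivalent to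
  \<open>\<Omega> Y \<times> \<Omega> Y\<close> via \<open>(q01, q12)\<close>, and \<open>q02\<close> is then the composition.
\<close>

definition loop_mult :: "('o, 'a, 'z) model_scheme \<Rightarrow> ('o, 'a) ho_endo \<Rightarrow>
    ('a \<Rightarrow> 'a \<Rightarrow> 'a \<Rightarrow> 'a \<Rightarrow> 'a \<Rightarrow> ('o, 'a) fraction) \<Rightarrow> 'o \<Rightarrow> 'o \<Rightarrow>
    ('o, 'a) fraction \<Rightarrow> ('o, 'a) fraction \<Rightarrow> ('o, 'a) fraction" where
  "loop_mult M \<Omega> \<theta> A Y a b = (THE c. c \<in> Hom (ho M) A (onObj \<Omega> Y) \<and>
     (\<exists>j p r0 r1 q01 q12 q02 t.
        is_loop_object M Y j p p r0 r1 \<and>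
        is_pullback M r1 r0 q01 q12 \<and> q02 \<in> Hom M (Src M q01) (Src M r0) \<and>
        r0 \<cdot>\<^bsub>M\<^esub> q02 = r0 \<cdot>\<^bsub>M\<^esub> q01 \<and> r1 \<cdot>\<^bsub>M\<^esub> q02 = r1 \<cdot>\<^bsub>M\<^esub> q12 \<and>
        t \<in> Hom (ho M) A (Src M q01) \<and>
        \<theta> j p p r0 r1 \<cdot>\<^bsub>ho M\<^esub> a = ho_arr M q01 \<cdot>\<^bsub>ho M\<^esub> t \<and>
        \<theta> j p p r0 r1 \<cdot>\<^bsub>ho M\<^esub> b = ho_arr M q12 \<cdot>\<^bsub>ho M\<^esub> t \<and>
        \<theta> j p p r0 r1 \<cdot>\<^bsub>ho M\<^esub> c = ho_arr M q02 \<cdot>\<^bsub>ho M\<^esub> t))"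

definition loop_group :: "('o, 'a, 'z) model_scheme \<Rightarrow> ('o, 'a) ho_endo \<Rightarrow>
    ('a \<Rightarrow> 'a \<Rightarrow> 'a \<Rightarrow> 'a \<Rightarrow> 'a \<Rightarrow> ('o, 'a) fraction) \<Rightarrow> 'o \<Rightarrow> 'o \<Rightarrow> ('o, 'a) fraction monoid" where
  "loop_group M \<Omega> \<theta> A Y = \<lparr>
     carrier = Hom (ho M) A (onObj \<Omega> Y),
     mult = loop_mult M \<Omega> \<theta> A Y,
     one = zero_arr (ho M) A (onObj \<Omega> Y)\<rparr>"


section \<open>Homotopy groups and weak classifying objects\<close>

text \<open>The group \<open>ho(M)(A, \<Omega>\<^sup>n X)\<close> for \<open>n \<ge> 1\<close>, where \<open>\<Omega>\<^sup>n X = \<Omega> (\<Omega>\<^sup>n\<^sup>-\<^sup>1 X)\<close>.\<close>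

definition homotopy_group :: "('o, 'a, 'z) model_scheme \<Rightarrow> ('o, 'a) ho_endo \<Rightarrow>
    ('a \<Rightarrow> 'a \<Rightarrow> 'a \<Rightarrow> 'a \<Rightarrow> 'a \<Rightarrow> ('o, 'a) fraction) \<Rightarrow> 'o \<Rightarrow> nat \<Rightarrow> 'o \<Rightarrow>
    ('o, 'a) fraction monoid" where
  "homotopy_group M \<Omega> \<theta> A n X = loop_group M \<Omega> \<theta> A ((onObj \<Omega> ^^ (n - 1)) X)"

definition pi_functor :: "('o, 'a, 'z) model_scheme \<Rightarrow> ('o, 'a) ho_endo \<Rightarrow>
    ('a \<Rightarrow> 'a \<Rightarrow> 'a \<Rightarrow> 'a \<Rightarrow> 'a \<Rightarrow> ('o, 'a) fraction) \<Rightarrow> 'o \<Rightarrow> nat \<Rightarrow>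
    ('o, ('o, 'a) fraction, 'u monoid, 'u monoid \<times> ('u \<Rightarrow> 'u) \<times> 'u monoid) cat_functor" where
  "pi_functor M \<Omega> \<theta> A n = \<lparr>
     onObj = (\<lambda>X. group_copy (homotopy_group M \<Omega> \<theta> A n X)),
     onArr = (\<lambda>f.
       let G = homotopy_group M \<Omega> \<theta> A n (Src (ho M) f);
           H = homotopy_group M \<Omega> \<theta> A n (Tgt (ho M) f)
       in (group_copy G,
           \<lambda>x \<in> carrier (group_copy G).
             code (carrier H) ((onArr \<Omega> ^^ n) f \<cdot>\<^bsub>ho M\<^esub> decode (carrier G) x),
           group_copy H))\<rparr>"

definition right_weak_classifying :: "('o, 'a, 'z1) category_scheme \<Rightarrow> ('o2, 'a2, 'z2) category_scheme \<Rightarrow>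
    ('o, 'a, 'o2, 'a2) cat_functor \<Rightarrow> ('o2, 'a2, 'o, 'a) cat_functor \<Rightarrow> bool" where
  "right_weak_classifying H K \<pi> k \<longleftrightarrow>
     is_functor H K \<pi> \<and> is_functor K H k \<and> is_full K K (functor_comp \<pi> k) \<and>
     (\<exists>\<epsilon>. is_nat_trans K K (functor_comp \<pi> k) functor_id \<epsilon> \<and> (\<forall>x \<in> Obj K. is_epi K (\<epsilon> x)))"

definition left_weak_classifying :: "('o, 'a, 'z1) category_scheme \<Rightarrow> ('o2, 'a2, 'z2) category_scheme \<Rightarrow>
    ('o, 'a, 'o2, 'a2) cat_functor \<Rightarrow> ('o2, 'a2, 'o, 'a) cat_functor \<Rightarrow> bool" where
  "left_weak_classifying H K \<pi> k \<longleftrightarrow>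
     is_functor H K \<pi> \<and> is_functor K H k \<and> is_full K K (functor_comp \<pi> k) \<and>
     (\<exists>\<eta>. is_nat_trans K K functor_id (functor_comp \<pi> k) \<eta> \<and> (\<forall>x \<in> Obj K. is_mono K (\<eta> x)))"

definition weak_classifying :: "('o, 'a, 'z1) category_scheme \<Rightarrow> ('o2, 'a2, 'z2) category_scheme \<Rightarrow>
    ('o, 'a, 'o2, 'a2) cat_functor \<Rightarrow> ('o2, 'a2, 'o, 'a) cat_functor \<Rightarrow> bool" where
  "weak_classifying H K \<pi> k \<longleftrightarrow> right_weak_classifying H K \<pi> k \<or> left_weak_classifying H K \<pi> k"

definition weak_classifying_of_type :: "('o, 'a, 'z) model_scheme \<Rightarrow> ('o, 'a) ho_endo \<Rightarrow>
    ('a \<Rightarrow> 'a \<Rightarrow> 'a \<Rightarrow> 'a \<Rightarrow> 'a \<Rightarrow> ('o, 'a) fraction) \<Rightarrow> nat \<Rightarrow>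
    ('u monoid, 'u monoid \<times> ('u \<Rightarrow> 'u) \<times> 'u monoid, 'o, ('o, 'a) fraction) cat_functor \<Rightarrow> bool" where
  "weak_classifying_of_type M \<Omega> \<theta> n k \<longleftrightarrow> 1 \<le> n \<and>
     (\<exists>A \<in> Obj M.
        weak_classifying (ho M) Grp_cat (pi_functor M \<Omega> \<theta> A n) k \<or>
        (2 \<le> n \<and> weak_classifying (ho M) Ab_cat (pi_functor M \<Omega> \<theta> A n) k))"

end

theory Submission
  imports Defs Complex_Main "HOL-Library.Groups_Big_Fun"
begin

text \<open>
  Freyd's argument. If \<open>F\<close> is a faithful functor from \<open>ho(M)\<close> to sets, then an arrow \<open>e\<close> out of \<open>A\<close>
  determines the kernel of \<open>F(e)\<close> on the small set \<open>F(A)\<close>, and arrows with the same kernel equalize the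
  same pairs of arrows into \<open>A\<close>; up to this relation there is only a small set of arrows out of \<open>A\<close>.
  Applied to \<open>k(C) \<rightarrow> k(G\<^sub>i)\<close>, for a class of abelian groups \<open>G\<^sub>i\<close> under \<open>C\<close> indexed by the ordinals,
  this yields \<open>i \<noteq> j\<close> such that the homotopy fibre of either arrow is killed by the other one. Comparing fibre
  sequences, one obtains maps \<open>\<Omega> k(G\<^sub>i) \<rightarrow> \<Omega> k(G\<^sub>j)\<close> under \<open>\<Omega> k(C)\<close> in both directions. As \<open>n \<ge> 2\<close>, the functor
  \<open>\<pi>\<^sub>n\<^sub>-\<^sub>1\<close> turns them into group homomorphisms, which fullness and \<open>\<epsilon>\<close> or \<open>\<eta>\<close> bring down to maps between
  \<open>G\<^sub>i\<close> and \<open>G\<^sub>j\<close> under \<open>C\<close>. But homomorphisms do not decrease transfinite \<open>2\<close>-heights, and \<open>C \<rightarrow> G\<^sub>i\<close>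
  hits an element of height exactly \<open>i\<close>.
\<close>

section \<open>Pullbacks\<close>

text \<open>An arrow that equalizes the same pairs as another one need not factor through it, since
  \<open>ho M\<close> lacks the colimits that would give a factorization. What survives is a
  factorization after one application of \<Omega>. This is where \<open>n\<close> at least 2 enters:
  the factor \<open>u\<close> between loop objects is not a loop map, so a second \<Omega> must be
  left over to make it respect multiplication. The technical obstacle is that \<open>ho M\<close>
  consists of zigzags modulo a congruence. An equality there becomes usable only as a homotopy, and
  an arrow only once it is represented in \<open>M\<close>; \<open>ho_arr_eqD\<close> and
  \<open>ho_arr_full\<close> provide this for cofibrant sources and fibrant targets. Moreover
  \<Omega> is known only through the comparison maps \<theta>, which are natural for strictly
  commuting maps of presentations; hence the factorization is built from a triangle that commutes in
  \<open>M\<close>. The role of a proper class is played by a family indexed by all of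
  \<open>'u\<close>.\<close>

lemma HomD:
  assumes "f \<in> Hom C x y"
  shows "f \<in> Arr C" "Src C f = x" "Tgt C f = y"
  using assms by (simp_all add: Hom_def)

lemma arr_hom: "f \<in> Arr C \<Longrightarrow> f \<in> Hom C (Src C f) (Tgt C f)"
  by (simp add: Hom_def)

context category
begin

lemma hom_obj: "f \<in> Hom C x y \<Longrightarrow> x \<in> Obj C" "f \<in> Hom C x y \<Longrightarrow> y \<in> Obj C"
  by (auto simp: Hom_def src_obj tgt_obj)

lemma arr_comp [simp]:
  assumes "f \<in> Arr C" "g \<in> Arr C" "Tgt C f = Src C g"
  shows "g \<cdot> f \<in> Arr C" "Src C (g \<cdot> f) = Src C f" "Tgt C (g \<cdot> f) = Tgt C g"
  using comp_hom[of f "Src C f" "Tgt C f" g "Tgt C g"] assms by (auto simp: Hom_def)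

lemma ident_arr [simp]:
  assumes "x \<in> Obj C"
  shows "Ident C x \<in> Arr C" "Src C (Ident C x) = x" "Tgt C (Ident C x) = x"
  using ident_hom[OF assms] by (auto simp: Hom_def)

lemma ident_comp [simp]:
  assumes "f \<in> Arr C"
  shows "Tgt C f = y \<Longrightarrow> Ident C y \<cdot> f = f" "Src C f = x \<Longrightarrow> f \<cdot> Ident C x = f"
  using ident_left[of f "Src C f" "Tgt C f"] ident_right[of f "Src C f" "Tgt C f"] assms
  by (auto simp: Hom_def)

text \<open>Whiskering rather than cancellation: a commuting square is composed with one more arrow
  on the right, with the brackets already moved. Most diagram chases below consist of instances of
  this and of \<open>comp_cancel1\<close>.\<close>

lemma comp_cancel:
  assumes "p \<cdot> a = q \<cdot> b" "a \<in> Hom C x y" "p \<in> Hom C y w" "b \<in> Hom C x y'" "q \<in> Hom C y' w"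
    "f \<in> Hom C v x"
  shows "p \<cdot> (a \<cdot> f) = q \<cdot> (b \<cdot> f)"
  using assms(1) comp_assoc[OF assms(6,2,3)] comp_assoc[OF _ assms(4,5), of f v] assms(6)
    assms(2,4) by (simp add: Hom_def)

lemma comp_cancel1:
  assumes "p \<cdot> a = q" "a \<in> Hom C x y" "p \<in> Hom C y w" "f \<in> Hom C v x"
  shows "p \<cdot> (a \<cdot> f) = q \<cdot> f"
  using assms(1) comp_assoc[OF assms(4,2,3)] by simp

end

lemma op_cat_simps [simp]:
  "Obj (op_cat C) = Obj C" "Arr (op_cat C) = Arr C" "Src (op_cat C) = Tgt C" "Tgt (op_cat C) = Src C"
  "Ident (op_cat C) = Ident C" "g \<cdot>\<^bsub>op_cat C\<^esub> f = f \<cdot>\<^bsub>C\<^esub> g" "Hom (op_cat C) x y = Hom C y x"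
  by (auto simp: op_cat_def Hom_def)

text \<open>Pushouts are treated throughout as pullbacks in \<open>op_cat\<close>, so that
  statements about lifting and universal squares are proved once and dualized.\<close>

lemma category_op_cat:
  assumes "category C"
  shows "category (op_cat C)"
proof -
  interpret category C by fact
  show ?thesis
    by unfold_locales
      (simp_all add: src_obj tgt_obj ident_hom ident_left ident_right comp_hom, metis comp_assoc)
qed

text \<open>Objects and arrows are numbers because \<open>has_finite_limits\<close> quantifies over
  diagrams of that type. The arrows 0, 1, 2 are the identities, while 3 and 4 are the legs into 2.
  Of two composable arrows at least one is an identity, so composition only selects the
  other.\<close>

definition cospan_shape :: "(nat, nat) category" where
  "cospan_shape = \<lparr>Obj = {0, 1, 2}, Arr = {0, 1, 2, 3, 4},
     Src = (\<lambda>f. if f = 3 then 0 else if f = 4 then 1 else f),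
     Tgt = (\<lambda>f. if f = 3 \<or> f = 4 then 2 else f),
     Ident = id, Comp = (\<lambda>g f. if f < 3 then g else f)\<rparr>"

lemma category_cospan_shape: "category cospan_shape"
  by unfold_locales (auto simp: cospan_shape_def Hom_def split: if_splits)

lemma (in category) pullback_exists:
  assumes fin: "has_finite_limits C" and f: "f \<in> Hom C x w" and g: "g \<in> Hom C y w"
  shows "\<exists>p q. is_pullback C f g p q"
proof -
  define F :: "(nat, nat, 'o, 'a) cat_functor" where
    "F = \<lparr>onObj = (\<lambda>i. if i = 0 then x else if i = 1 then y else w),
          onArr = (\<lambda>i. if i = 0 then Ident C x else if i = 1 then Ident C y else
                       if i = 2 then Ident C w else if i = 3 then f else g)\<rparr>"
  note obj = hom_obj[OF f] hom_obj[OF g]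
  have "is_functor cospan_shape C F"
    unfolding is_functor_def
  proof (intro conjI allI ballI)
    fix i assume "i \<in> Obj cospan_shape"
    then show "onObj F i \<in> Obj C" "onArr F (Ident cospan_shape i) = Ident C (onObj F i)"
      using obj by (auto simp: F_def cospan_shape_def)
  next
    fix i j a assume "a \<in> Hom cospan_shape i j"
    then show "onArr F a \<in> Hom C (onObj F i) (onObj F j)"
      using f g obj by (auto simp: F_def cospan_shape_def Hom_def)
  next
    fix i j k a b assume "a \<in> Hom cospan_shape i j" "b \<in> Hom cospan_shape j k"
    then consider "a = j" "j \<in> {0, 1, 2}" | "b = j" "a \<in> {3, 4}" "j = 2"
      by (auto simp: cospan_shape_def Hom_def)
    then show "onArr F (b \<cdot>\<^bsub>cospan_shape\<^esub> a) = onArr F b \<cdot> onArr F a"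
    proof cases
      case 1
      then have "b \<in> {0, 1, 2, 3, 4}" "j = (if b = 3 then 0 else if b = 4 then 1 else b)"
        using \<open>b \<in> _\<close> by (auto simp: cospan_shape_def Hom_def)
      then consider "b = 0" "j = 0" | "b = 1" "j = 1" | "b = 2" "j = 2" | "b = 3" "j = 0" | "b = 4" "j = 1"
        by auto
      then show ?thesis
        using 1 f g obj by cases (simp_all add: F_def cospan_shape_def Hom_def)
    next
      case 2
      then show ?thesis
        using f g obj by (auto simp: F_def cospan_shape_def Hom_def)
    qed
  qed
  moreover have "finite (Obj cospan_shape)" "finite (Arr cospan_shape)"
    by (simp_all add: cospan_shape_def)
  ultimately obtain l c where lim: "is_limit cospan_shape C F l c"
    using fin category_cospan_shape unfolding has_finite_limits_def by blast
  have c: "c 0 \<in> Hom C l x" "c 1 \<in> Hom C l y" "f \<cdot> c 0 = c 2" "g \<cdot> c 1 = c 2" "c 2 \<in> Hom C l w"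
    using conjunct1[OF lim[unfolded is_limit_def]]
    by (simp_all add: is_cone_def F_def cospan_shape_def)
  have u: "\<exists>!h. h \<in> Hom C v l \<and> c 0 \<cdot> h = a \<and> c 1 \<cdot> h = b"
    if a: "a \<in> Hom C v x" and b: "b \<in> Hom C v y" and e: "f \<cdot> a = g \<cdot> b" for v a b
  proof -
    define d where "d = (\<lambda>i::nat. if i = 0 then a else if i = 1 then b else f \<cdot> a)"
    have "is_cone cospan_shape C F v d"
      using a b e f g hom_obj[OF a] comp_hom[OF a f]
      by (simp add: is_cone_def F_def cospan_shape_def d_def Hom_def)
    then have ex: "\<exists>!h. h \<in> Hom C v l \<and> (\<forall>i\<in>Obj cospan_shape. c i \<cdot> h = d i)"
      using lim unfolding is_limit_def by blast
    \<comment> \<open>The third leg of a cone over a cospan is determined by the other two, so it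
      imposes no condition of its own.\<close>
    have "(\<forall>i\<in>Obj cospan_shape. c i \<cdot> h = d i) \<longleftrightarrow> c 0 \<cdot> h = a \<and> c 1 \<cdot> h = b"
      if "h \<in> Hom C v l" for h
    proof -
      have "c 0 \<cdot> h = a \<Longrightarrow> c 2 \<cdot> h = f \<cdot> a"
        using comp_cancel1[OF c(3) c(1) f that] by simp
      then show ?thesis by (auto simp: cospan_shape_def d_def)
    qed
    then show ?thesis using ex by (smt (verit))
  qed
  have "is_pullback C f g (c 0) (c 1)"
    unfolding is_pullback_def using HomD[OF c(1)] HomD[OF c(2)] HomD[OF f] HomD[OF g] c u
    by simp
  then show ?thesis by blast
qed

lemma is_pullbackD:
  assumes "is_pullback C f g p q"
  shows "f \<cdot>\<^bsub>C\<^esub> p = g \<cdot>\<^bsub>C\<^esub> q" "f \<in> Arr C" "g \<in> Arr C" "p \<in> Arr C" "q \<in> Arr C"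
    "Tgt C f = Tgt C g" "Src C p = Src C q" "Tgt C p = Src C f" "Tgt C q = Src C g"
  using assms by (auto simp: is_pullback_def Hom_def)

lemma (in category) pullbackE:
  assumes "has_finite_limits C" "f \<in> Hom C x w" "g \<in> Hom C y w"
  obtains l p q where "is_pullback C f g p q" "p \<in> Hom C l x" "q \<in> Hom C l y"
proof -
  obtain p q where pb: "is_pullback C f g p q"
    using pullback_exists[OF assms] by blast
  note is_pullbackD[OF pb]
  then show thesis
    using that[OF pb, of "Src C p"] assms(2,3) by (simp add: Hom_def)
qed

lemma is_pullback_lift:
  assumes "is_pullback C f g p q" "u \<in> Hom C v (Src C f)" "w \<in> Hom C v (Src C g)" "f \<cdot>\<^bsub>C\<^esub> u = g \<cdot>\<^bsub>C\<^esub> w"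
  obtains h where "h \<in> Hom C v (Src C p)" "p \<cdot>\<^bsub>C\<^esub> h = u" "q \<cdot>\<^bsub>C\<^esub> h = w"
  using assms unfolding is_pullback_def by (metis HomD)

lemma (in category) is_pullback_unique:
  assumes pb: "is_pullback C f g p q"
    and h: "h \<in> Hom C v (Src C p)" "h' \<in> Hom C v (Src C p)"
    and e: "p \<cdot> h = p \<cdot> h'" "q \<cdot> h = q \<cdot> h'"
  shows "h = h'"
proof -
  note D = is_pullbackD[OF pb]
  have "f \<cdot> (p \<cdot> h) = g \<cdot> (q \<cdot> h)"
    by (rule comp_cancel[OF D(1)]) (use D h in \<open>auto simp: Hom_def\<close>)
  moreover have "p \<cdot> h \<in> Hom C v (Src C f)" "q \<cdot> h \<in> Hom C v (Src C g)"
    using D h by (auto simp: Hom_def)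
  ultimately have "\<exists>!k. k \<in> Hom C v (Src C p) \<and> p \<cdot> k = p \<cdot> h \<and> q \<cdot> k = q \<cdot> h"
    using pb unfolding is_pullback_def by blast
  then show ?thesis using h e by metis
qed

section \<open>Model categories and lifting\<close>

lemma has_liftE:
  assumes "has_lift C i p" "i \<in> Hom C a b" "p \<in> Hom C x y" "u \<in> Hom C a x" "v \<in> Hom C b y"
    "p \<cdot>\<^bsub>C\<^esub> u = v \<cdot>\<^bsub>C\<^esub> i"
  obtains h where "h \<in> Hom C b x" "h \<cdot>\<^bsub>C\<^esub> i = u" "p \<cdot>\<^bsub>C\<^esub> h = v"
  using assms unfolding has_lift_def by (metis HomD(2,3))

lemma has_lift_op_cat: "has_lift (op_cat C) p i \<longleftrightarrow> has_lift C i p"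
  unfolding has_lift_def by (auto; metis)

lemma is_pullback_sym: "is_pullback C f g p q \<Longrightarrow> is_pullback C g f q p"
  unfolding is_pullback_def by (metis (no_types, lifting))

lemma is_retractI:
  assumes "f \<in> Hom C x y" "g \<in> Hom C a b" "i \<in> Hom C x a" "r \<in> Hom C a x" "i' \<in> Hom C y b"
    "r' \<in> Hom C b y" "r \<cdot>\<^bsub>C\<^esub> i = Ident C x" "r' \<cdot>\<^bsub>C\<^esub> i' = Ident C y"
    "g \<cdot>\<^bsub>C\<^esub> i = i' \<cdot>\<^bsub>C\<^esub> f" "f \<cdot>\<^bsub>C\<^esub> r = r' \<cdot>\<^bsub>C\<^esub> g"
  shows "is_retract C f g"
  using assms HomD[OF assms(1)] HomD[OF assms(2)] unfolding is_retract_def by blast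

section \<open>The retract argument and permanence of lifting properties\<close>

context category
begin

text \<open>A lift in the square with the identity of \<open>x\<close> on top and \<open>p\<close>
  at the bottom splits \<open>i\<close>, and this splitting is the retraction of \<open>p\<close>
  onto \<open>f\<close>.\<close>

lemma retract_of_right_factor:
  assumes "f \<in> Hom C x y" "i \<in> Hom C x z" "p \<in> Hom C z y" "f = p \<cdot> i" "has_lift C i f"
  shows "is_retract C f p"
proof -
  obtain h where h: "h \<in> Hom C z x" "h \<cdot> i = Ident C x" "f \<cdot> h = p"
    using has_liftE[OF assms(5,2,1) ident_hom assms(3)] assms(1,3,4) hom_obj[OF assms(1)]
    by (metis HomD ident_comp(2))
  have y: "Ident C y \<in> Hom C y y" using ident_hom hom_obj[OF assms(1)] by blast
  show ?thesis
    by (rule is_retractI[OF assms(1,3,2) h(1) y y])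
      (use h HomD[OF assms(1)] HomD[OF assms(3)] HomD[OF y] assms(4) in auto)
qed

lemma retract_of_left_factor:
  assumes "f \<in> Hom C x y" "i \<in> Hom C x z" "p \<in> Hom C z y" "f = p \<cdot> i" "has_lift C f p"
  shows "is_retract C f i"
proof -
  obtain h where h: "h \<in> Hom C y z" "h \<cdot> f = i" "p \<cdot> h = Ident C y"
    using has_liftE[OF assms(5,1,3,2) ident_hom] assms(1,3,4) hom_obj[OF assms(1)]
    by (metis HomD ident_comp(1))
  have x: "Ident C x \<in> Hom C x x" using ident_hom hom_obj[OF assms(1)] by blast
  show ?thesis
    by (rule is_retractI[OF assms(1,2) x x h(1) assms(3)])
      (use h HomD[OF assms(1)] HomD[OF assms(2)] HomD[OF x] assms(4) in auto)
qed

lemma has_lift_comp: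
  assumes i: "i \<in> Hom C a b" and p: "p \<in> Hom C x y" and q: "q \<in> Hom C y w"
    and "has_lift C i p" "has_lift C i q"
  shows "has_lift C i (q \<cdot> p)"
  unfolding has_lift_def
proof (intro ballI impI)
  fix u v assume "u \<in> Hom C (Src C i) (Src C (q \<cdot> p))" "v \<in> Hom C (Tgt C i) (Tgt C (q \<cdot> p))"
    and e: "(q \<cdot> p) \<cdot> u = v \<cdot> i"
  then have u: "u \<in> Hom C a x" and v: "v \<in> Hom C b w"
    using HomD[OF i] HomD[OF p] HomD[OF q] by simp_all
  obtain h where h: "h \<in> Hom C b y" "h \<cdot> i = p \<cdot> u" "q \<cdot> h = v"
    using has_liftE[OF assms(5) i q comp_hom[OF u p] v] e comp_assoc[OF u p q] by metis
  obtain k where k: "k \<in> Hom C b x" "k \<cdot> i = u" "p \<cdot> k = h"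
    using has_liftE[OF assms(4) i p u h(1)] h(2) by metis
  show "\<exists>h\<in>Hom C (Tgt C i) (Src C (q \<cdot> p)). h \<cdot> i = u \<and> (q \<cdot> p) \<cdot> h = v"
    using k h comp_assoc[OF k(1) p q] HomD[OF i] HomD[OF p] HomD[OF q] by auto
qed

text \<open>The lift is found against \<open>f\<close> and then pulled back. That the upper triangle
  commutes follows from the uniqueness part of the universal property, checked on both
  projections.\<close>

lemma has_lift_pullback:
  assumes pb: "is_pullback C f g p q" and i: "i \<in> Hom C a b" and l: "has_lift C i f"
  shows "has_lift C i q"
  unfolding has_lift_def
proof (intro ballI impI)
  note D = is_pullbackD[OF pb]
  fix u v assume u: "u \<in> Hom C (Src C i) (Src C q)" and v: "v \<in> Hom C (Tgt C i) (Tgt C q)"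
    and e: "q \<cdot> u = v \<cdot> i"
  have f: "f \<in> Hom C (Src C f) (Tgt C f)" and g: "g \<in> Hom C (Src C g) (Tgt C f)"
    and p: "p \<in> Hom C (Src C q) (Src C f)" and q: "q \<in> Hom C (Src C q) (Src C g)"
    using D by (auto simp: Hom_def)
  have u': "u \<in> Hom C a (Src C q)" and v': "v \<in> Hom C b (Src C g)"
    using u v i D by (auto simp: Hom_def)
  have "f \<cdot> (p \<cdot> u) = g \<cdot> (v \<cdot> i)"
    unfolding e[symmetric] by (rule comp_cancel[OF D(1) p f q g u])
  then have "f \<cdot> (p \<cdot> u) = (g \<cdot> v) \<cdot> i"
    using comp_assoc[OF i v' g] by simp
  then obtain h where h: "h \<in> Hom C b (Src C f)" "h \<cdot> i = p \<cdot> u" "f \<cdot> h = g \<cdot> v"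
    using has_liftE[OF l i f comp_hom[OF u' p] comp_hom[OF v' g]] by metis
  obtain k where k: "k \<in> Hom C b (Src C p)" "p \<cdot> k = h" "q \<cdot> k = v"
    using is_pullback_lift[OF pb h(1) v' h(3)] .
  have k': "k \<in> Hom C b (Src C q)" using k(1) D by simp
  have "k \<cdot> i = u"
  proof (rule is_pullback_unique[OF pb])
    show "k \<cdot> i \<in> Hom C a (Src C p)" "u \<in> Hom C a (Src C p)"
      using comp_hom[OF i k(1)] u' D by simp_all
    show "p \<cdot> (k \<cdot> i) = p \<cdot> u" using comp_cancel1[OF k(2) k' p i] h(2) by simp
    show "q \<cdot> (k \<cdot> i) = q \<cdot> u" using comp_cancel1[OF k(3) k' q i] e by simp
  qed
  then show "\<exists>h\<in>Hom C (Tgt C i) (Src C q). h \<cdot> i = u \<and> q \<cdot> h = v"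
    using k k' HomD[OF i] by auto
qed

end

section \<open>Fibrations and cofibrations characterized by lifting\<close>

context model_category
begin

lemma fib_hom: "p \<in> Fib M \<Longrightarrow> p \<in> Hom M (Src M p) (Tgt M p)"
  and cof_hom: "i \<in> Cof M \<Longrightarrow> i \<in> Hom M (Src M i) (Tgt M i)"
  using cof_arr fib_arr by (auto simp: Hom_def)

lemma factor_tcof_fib:
  assumes "f \<in> Hom M x y"
  obtains z i p where "i \<in> Hom M x z" "p \<in> Hom M z y" "f = p \<cdot> i" "i \<in> Cof M" "i \<in> Weq M" "p \<in> Fib M"
  using factor_fib[OF assms] by blast

lemma factor_cof_tfib:
  assumes "f \<in> Hom M x y"
  obtains z i p where "i \<in> Hom M x z" "p \<in> Hom M z y" "f = p \<cdot> i" "i \<in> Cof M" "p \<in> Fib M" "p \<in> Weq M"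
  using factor_cof[OF assms] by blast

text \<open>Factoring \<open>p\<close> into a trivial cofibration followed by a fibration, the
  assumed lifting makes \<open>p\<close> a retract of that fibration. The three companions below
  follow the same pattern with the other factorization or on the other side. Identities, composites,
  base changes and cobase changes are then handled by solving lifting problems.\<close>

lemma fibI:
  assumes "p \<in> Arr M" "\<And>i. i \<in> Cof M \<Longrightarrow> i \<in> Weq M \<Longrightarrow> has_lift M i p"
  shows "p \<in> Fib M"
proof -
  obtain z i q where f: "i \<in> Hom M (Src M p) z" "q \<in> Hom M z (Tgt M p)" "p = q \<cdot> i"
    "i \<in> Cof M" "i \<in> Weq M" "q \<in> Fib M"
    using factor_tcof_fib[OF arr_hom[OF assms(1)]] .
  then show ?thesis
    using retract_of_right_factor[OF arr_hom[OF assms(1)] f(1,2,3)] assms(2) fib_retract by blast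
qed

lemma tfibI:
  assumes "p \<in> Arr M" "\<And>i. i \<in> Cof M \<Longrightarrow> has_lift M i p"
  shows "p \<in> Fib M" "p \<in> Weq M"
proof -
  obtain z i q where f: "i \<in> Hom M (Src M p) z" "q \<in> Hom M z (Tgt M p)" "p = q \<cdot> i"
    "i \<in> Cof M" "q \<in> Fib M" "q \<in> Weq M"
    using factor_cof_tfib[OF arr_hom[OF assms(1)]] .
  then have "is_retract M p q"
    using retract_of_right_factor[OF arr_hom[OF assms(1)] f(1,2,3)] assms(2) by blast
  then show "p \<in> Fib M" "p \<in> Weq M"
    using f fib_retract weq_retract by blast+
qed

lemma cofI:
  assumes "i \<in> Arr M" "\<And>p. p \<in> Fib M \<Longrightarrow> p \<in> Weq M \<Longrightarrow> has_lift M i p"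
  shows "i \<in> Cof M"
proof -
  obtain z j q where f: "j \<in> Hom M (Src M i) z" "q \<in> Hom M z (Tgt M i)" "i = q \<cdot> j"
    "j \<in> Cof M" "q \<in> Fib M" "q \<in> Weq M"
    using factor_cof_tfib[OF arr_hom[OF assms(1)]] .
  then show ?thesis
    using retract_of_left_factor[OF arr_hom[OF assms(1)] f(1,2,3)] assms(2) cof_retract by blast
qed

lemma tcofI:
  assumes "i \<in> Arr M" "\<And>p. p \<in> Fib M \<Longrightarrow> has_lift M i p"
  shows "i \<in> Cof M" "i \<in> Weq M"
proof -
  obtain z j q where f: "j \<in> Hom M (Src M i) z" "q \<in> Hom M z (Tgt M i)" "i = q \<cdot> j"
    "j \<in> Cof M" "j \<in> Weq M" "q \<in> Fib M"
    using factor_tcof_fib[OF arr_hom[OF assms(1)]] .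
  then have "is_retract M i j"
    using retract_of_left_factor[OF arr_hom[OF assms(1)] f(1,2,3)] assms(2) by blast
  then show "i \<in> Cof M" "i \<in> Weq M"
    using f cof_retract weq_retract by blast+
qed

lemma ident_model:
  assumes "x \<in> Obj M"
  shows "Ident M x \<in> Fib M" "Ident M x \<in> Cof M" "Ident M x \<in> Weq M"
proof -
  have l: "has_lift M i (Ident M x)" for i
    unfolding has_lift_def
  proof (intro ballI impI)
    fix u v assume a: "u \<in> Hom M (Src M i) (Src M (Ident M x))" "v \<in> Hom M (Tgt M i) (Tgt M (Ident M x))"
      "Ident M x \<cdot> u = v \<cdot> i"
    then show "\<exists>h\<in>Hom M (Tgt M i) (Src M (Ident M x)). h \<cdot> i = u \<and> Ident M x \<cdot> h = v"
      using assms by (intro bexI[of _ v]) (auto simp: Hom_def)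
  qed
  show "Ident M x \<in> Fib M" "Ident M x \<in> Weq M"
    using tfibI[OF _ l] assms by auto
  have "has_lift M (Ident M x) p" for p
    unfolding has_lift_def
  proof (intro ballI impI)
    fix u v assume a: "u \<in> Hom M (Src M (Ident M x)) (Src M p)" "v \<in> Hom M (Tgt M (Ident M x)) (Tgt M p)"
      "p \<cdot> u = v \<cdot> Ident M x"
    then show "\<exists>h\<in>Hom M (Tgt M (Ident M x)) (Src M p). h \<cdot> Ident M x = u \<and> p \<cdot> h = v"
      using assms by (intro bexI[of _ u]) (auto simp: Hom_def)
  qed
  then show "Ident M x \<in> Cof M"
    using cofI assms by auto
qed

lemma fib_comp:
  assumes "p \<in> Hom M x y" "q \<in> Hom M y z" "p \<in> Fib M" "q \<in> Fib M"
  shows "q \<cdot> p \<in> Fib M"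
proof (rule fibI)
  show "has_lift M i (q \<cdot> p)" if "i \<in> Cof M" "i \<in> Weq M" for i
    using has_lift_comp[OF cof_hom[OF that(1)] assms(1,2)] lift_fib that assms(3,4) by blast
qed (use assms in \<open>auto simp: Hom_def\<close>)

lemma cof_comp:
  assumes "i \<in> Hom M x y" "j \<in> Hom M y z" "i \<in> Cof M" "j \<in> Cof M"
  shows "j \<cdot> i \<in> Cof M"
proof (rule cofI)
  interpret op: category "op_cat M" by (rule category_op_cat) (rule category_axioms)
  fix p assume "p \<in> Fib M" "p \<in> Weq M"
  then show "has_lift M (j \<cdot> i) p"
    using op.has_lift_comp[of p "Tgt M p" "Src M p" j z y i x] assms fib_hom[of p] lift_cof
    by (simp add: has_lift_op_cat)
qed (use assms in \<open>auto simp: Hom_def\<close>)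

lemma fib_pullback:
  assumes "is_pullback M f g p q" "f \<in> Fib M"
  shows "q \<in> Fib M"
  using fibI[OF is_pullbackD(5)[OF assms(1)] has_lift_pullback[OF assms(1) cof_hom]] lift_fib assms(2)
  by blast

lemma tfib_pullback:
  assumes "is_pullback M f g p q" "f \<in> Fib M" "f \<in> Weq M"
  shows "q \<in> Fib M" "q \<in> Weq M"
  using tfibI[OF is_pullbackD(5)[OF assms(1)] has_lift_pullback[OF assms(1) cof_hom]] lift_cof assms(2,3)
  by blast+

lemma tcof_pushout:
  assumes "is_pullback (op_cat M) f g p q" "f \<in> Cof M" "f \<in> Weq M"
  shows "q \<in> Cof M" "q \<in> Weq M"
proof -
  interpret op: category "op_cat M" by (rule category_op_cat) (rule category_axioms)
  have "has_lift M q r" if "r \<in> Fib M" for r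
    using op.has_lift_pullback[OF assms(1), of r "Tgt M r" "Src M r"] lift_fib[OF assms(2,3) that]
        fib_hom[OF that]
    by (simp add: has_lift_op_cat)
  then show "q \<in> Cof M" "q \<in> Weq M"
    using tcofI[of q] is_pullbackD(5)[OF assms(1)] by auto
qed

lemma pushoutE:
  assumes "f \<in> Hom M w x" "g \<in> Hom M w y"
  obtains l p q where "is_pullback (op_cat M) f g p q" "p \<in> Hom M x l" "q \<in> Hom M y l"
proof -
  interpret op: category "op_cat M" by (rule category_op_cat) (rule category_axioms)
  show thesis
    using op.pullbackE[of f x w g y] finite_colimits assms that
    unfolding has_finite_colimits_def by auto
qed

lemma section_weq:
  assumes "i \<in> Hom M x y" "s \<in> Hom M y x" "s \<cdot> i = Ident M x"
  shows "s \<in> Weq M \<longleftrightarrow> i \<in> Weq M"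
  using weq_left[OF assms(1,2)] weq_right[OF assms(1,2)] assms ident_model(3)[of x] hom_obj[OF assms(1)]
  by auto

text \<open>Lifting of arrows through trivial fibrations stands for the condition that the arrow
  from the initial object be a cofibration; \<open>cofibrantI\<close> derives it from the
  latter.\<close>

definition cofibrant :: "'o \<Rightarrow> bool" where
  "cofibrant x \<longleftrightarrow> x \<in> Obj M \<and> (\<forall>p \<in> Fib M \<inter> Weq M. \<forall>v \<in> Hom M x (Tgt M p). \<exists>h \<in> Hom M x (Src M p). p \<cdot> h = v)"

lemma cofibrantE:
  assumes "cofibrant x" "p \<in> Fib M" "p \<in> Weq M" "p \<in> Hom M e b" "v \<in> Hom M x b"
  obtains h where "h \<in> Hom M x e" "p \<cdot> h = v"
  using assms HomD[OF assms(4)] unfolding cofibrant_def by blast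

end

context pointed_model_category
begin

definition z0 :: 'a where "z0 = (SOME z. is_zero M z)"

lemma zero_z0: "is_zero M z0"
  unfolding z0_def using pointed by (rule someI_ex)

lemma z0_obj: "z0 \<in> Obj M"
  using zero_z0 by (simp add: is_zero_def is_initial_def)

lemma from_zero: "is_zero M z \<Longrightarrow> x \<in> Obj M \<Longrightarrow> \<exists>f. f \<in> Hom M z x"
  and from_zero_unique: "is_zero M z \<Longrightarrow> f \<in> Hom M z x \<Longrightarrow> g \<in> Hom M z x \<Longrightarrow> f = g"
  using hom_obj unfolding is_zero_def is_initial_def by (blast, metis)

lemma to_terminal: "is_terminal M z \<Longrightarrow> x \<in> Obj M \<Longrightarrow> \<exists>f. f \<in> Hom M x z"
  and to_terminal_unique: "is_terminal M z \<Longrightarrow> f \<in> Hom M x z \<Longrightarrow> g \<in> Hom M x z \<Longrightarrow> f = g"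
  using hom_obj unfolding is_terminal_def by (blast, metis)

lemma to_z0: "x \<in> Obj M \<Longrightarrow> \<exists>f. f \<in> Hom M x z0"
  and to_z0_unique: "f \<in> Hom M x z0 \<Longrightarrow> g \<in> Hom M x z0 \<Longrightarrow> f = g"
  using to_terminal to_terminal_unique zero_z0 unfolding is_zero_def by blast+

text \<open>Over a terminal object the lower triangle of a lifting problem commutes automatically,
  so what remains is extension along trivial cofibrations. In this form no particular terminal
  object is mentioned.\<close>

lemma fibrant_iff:
  "is_fibrant M x \<longleftrightarrow> x \<in> Obj M \<and> (\<forall>i \<in> Cof M \<inter> Weq M. \<forall>u \<in> Hom M (Src M i) x. \<exists>h \<in> Hom M (Tgt M i) x. h \<cdot> i = u)"
    (is "_ \<longleftrightarrow> ?R")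
proof
  assume x: "is_fibrant M x"
  obtain f where f: "f \<in> Hom M x z0" using to_z0 x unfolding is_fibrant_def by blast
  then have "f \<in> Fib M" using x zero_z0 unfolding is_fibrant_def is_zero_def by blast
  moreover have "\<exists>h \<in> Hom M (Tgt M i) x. h \<cdot> i = u"
    if i: "i \<in> Cof M" "i \<in> Weq M" and u: "u \<in> Hom M (Src M i) x" for i u
  proof -
    obtain v where v: "v \<in> Hom M (Tgt M i) z0" using to_z0 hom_obj[OF cof_hom[OF i(1)]] by blast
    have "f \<cdot> u = v \<cdot> i"
      using to_z0_unique comp_hom[OF u f] comp_hom[OF cof_hom[OF i(1)] v] by blast
    then show ?thesis
      using has_liftE[OF lift_fib[OF i \<open>f \<in> Fib M\<close>] cof_hom[OF i(1)] f u v] by blast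
  qed
  ultimately show ?R using x unfolding is_fibrant_def by blast
next
  assume R: ?R
  show "is_fibrant M x"
    unfolding is_fibrant_def
  proof (intro conjI allI ballI impI)
    fix t f assume f: "f \<in> Hom M x t" and t: "is_terminal M t"
    show "f \<in> Fib M"
    proof (rule fibI)
      fix i assume i: "i \<in> Cof M" "i \<in> Weq M"
      show "has_lift M i f"
        unfolding has_lift_def
      proof (intro ballI impI)
        fix u v assume a: "u \<in> Hom M (Src M i) (Src M f)" "v \<in> Hom M (Tgt M i) (Tgt M f)"
        then obtain h where h: "h \<in> Hom M (Tgt M i) x" "h \<cdot> i = u"
          using R i HomD[OF f] by auto
        then show "\<exists>h\<in>Hom M (Tgt M i) (Src M f). h \<cdot> i = u \<and> f \<cdot> h = v"
          using to_terminal_unique[OF t comp_hom[OF h(1) f]] a HomD[OF f] by auto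
      qed
    qed (use f in \<open>simp add: Hom_def\<close>)
  qed (use R in blast)
qed

lemma fibrantE:
  assumes "is_fibrant M x" "i \<in> Cof M" "i \<in> Weq M" "i \<in> Hom M a b" "u \<in> Hom M a x"
  obtains h where "h \<in> Hom M b x" "h \<cdot> i = u"
  using assms HomD[OF assms(4)] unfolding fibrant_iff by blast

lemma fibrant_obj: "is_fibrant M x \<Longrightarrow> x \<in> Obj M"
  by (simp add: is_fibrant_def)

lemma fib_fibrant:
  assumes "p \<in> Fib M" "p \<in> Hom M e b" "is_fibrant M b"
  shows "is_fibrant M e"
  unfolding fibrant_iff
proof (intro conjI ballI)
  show "e \<in> Obj M" using hom_obj assms by blast
  fix i u assume "i \<in> Cof M \<inter> Weq M" and u: "u \<in> Hom M (Src M i) e"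
  then have i: "i \<in> Cof M" "i \<in> Weq M" by auto
  obtain v where v: "v \<in> Hom M (Tgt M i) b" "v \<cdot> i = p \<cdot> u"
    using fibrantE[OF assms(3) i cof_hom[OF i(1)] comp_hom[OF u assms(2)]] .
  show "\<exists>h\<in>Hom M (Tgt M i) e. h \<cdot> i = u"
    using has_liftE[OF lift_fib[OF i assms(1)] cof_hom[OF i(1)] assms(2) u v(1) v(2)[symmetric]] by blast
qed

lemma to_z0_fib: "is_fibrant M x \<Longrightarrow> f \<in> Hom M x z0 \<Longrightarrow> f \<in> Fib M"
  using zero_z0 unfolding is_fibrant_def is_zero_def by blast

lemma z0_fibrant: "is_fibrant M z0"
  unfolding fibrant_iff
proof (intro conjI ballI z0_obj)
  fix i u assume i: "i \<in> Cof M \<inter> Weq M" and u: "u \<in> Hom M (Src M i) z0"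
  then obtain v where v: "v \<in> Hom M (Tgt M i) z0" using to_z0 hom_obj[OF cof_hom[of i]] by blast
  moreover have "i \<in> Hom M (Src M i) (Tgt M i)" using i cof_hom by blast
  ultimately show "\<exists>h\<in>Hom M (Tgt M i) z0. h \<cdot> i = u" using to_z0_unique[OF u] comp_hom by metis
qed

lemma cofibrantI:
  assumes "is_zero M z" "i \<in> Hom M z x" "i \<in> Cof M"
  shows "cofibrant x"
  unfolding cofibrant_def
proof (intro conjI ballI)
  show "x \<in> Obj M" using hom_obj assms by blast
  fix p v assume "p \<in> Fib M \<inter> Weq M" and v: "v \<in> Hom M x (Tgt M p)"
  then have p: "p \<in> Fib M" "p \<in> Weq M" by auto
  obtain u where u: "u \<in> Hom M z (Src M p)" using from_zero[OF assms(1)] hom_obj[OF fib_hom[OF p(1)]] by blast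
  have "p \<cdot> u = v \<cdot> i"
    using from_zero_unique[OF assms(1) comp_hom[OF u fib_hom[OF p(1)]] comp_hom[OF assms(2) v]] .
  then show "\<exists>h\<in>Hom M x (Src M p). p \<cdot> h = v"
    using has_liftE[OF lift_cof[OF assms(3) p] assms(2) fib_hom[OF p(1)] u v] by blast
qed

lemma cofibrant_replacement:
  assumes "x \<in> Obj M"
  obtains q p where "p \<in> Hom M q x" "p \<in> Fib M" "p \<in> Weq M" "cofibrant q"
proof -
  obtain f where "f \<in> Hom M z0 x" using from_zero[OF zero_z0 assms] by blast
  then show thesis
    using factor_cof_tfib that cofibrantI[OF zero_z0] by metis
qed

lemma fibrant_replacement:
  assumes "x \<in> Obj M"
  obtains r i where "i \<in> Hom M x r" "i \<in> Cof M" "i \<in> Weq M" "is_fibrant M r"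
proof -
  obtain f where "f \<in> Hom M x z0" using to_z0[OF assms] by blast
  then show thesis
    using factor_tcof_fib that fib_fibrant[OF _ _ z0_fibrant] by metis
qed

end

section \<open>Left homotopy\<close>

context model_category
begin

lemma pushout_lift:
  assumes "is_pullback (op_cat M) f g p q" "f \<in> Hom M w x" "g \<in> Hom M w y" "p \<in> Hom M x l"
    "u \<in> Hom M x z" "v \<in> Hom M y z" "u \<cdot> f = v \<cdot> g"
  obtains h where "h \<in> Hom M l z" "h \<cdot> p = u" "h \<cdot> q = v"
  using is_pullback_lift[OF assms(1), of u z v] assms(2-7) by (auto simp: Hom_def)

lemma pushout_unique:
  assumes "is_pullback (op_cat M) f g p q" "p \<in> Hom M x l" "h \<in> Hom M l z" "h' \<in> Hom M l z"
    "h \<cdot> p = h' \<cdot> p" "h \<cdot> q = h' \<cdot> q"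
  shows "h = h'"
proof -
  interpret op: category "op_cat M" by (rule category_op_cat) (rule category_axioms)
  show ?thesis
    using op.is_pullback_unique[OF assms(1), of h z h'] assms(2-6) by (simp add: Hom_def)
qed

definition cylinder :: "'o \<Rightarrow> 'o \<Rightarrow> 'a \<Rightarrow> 'a \<Rightarrow> 'a \<Rightarrow> bool" where
  "cylinder x c i j s \<longleftrightarrow> i \<in> Hom M x c \<and> j \<in> Hom M x c \<and> s \<in> Hom M c x \<and> s \<in> Weq M \<and>
     s \<cdot> i = Ident M x \<and> s \<cdot> j = Ident M x"

definition homotopic :: "'o \<Rightarrow> 'o \<Rightarrow> 'a \<Rightarrow> 'a \<Rightarrow> bool" where
  "homotopic x y f g \<longleftrightarrow> (\<exists>c i j s. cylinder x c i j s \<and> (\<exists>H \<in> Hom M c y. H \<cdot> i = f \<and> H \<cdot> j = g))"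

text \<open>The last conjunct says that \<open>(i, j)\<close> is a cofibration from the coproduct of two copies of \<open>x\<close>.\<close>

definition good_cylinder :: "'o \<Rightarrow> 'o \<Rightarrow> 'a \<Rightarrow> 'a \<Rightarrow> 'a \<Rightarrow> bool" where
  "good_cylinder x c i j s \<longleftrightarrow> cylinder x c i j s \<and> i \<in> Cof M \<and> j \<in> Cof M \<and>
     (\<forall>q \<in> Fib M \<inter> Weq M. \<forall>u \<in> Hom M x (Src M q). \<forall>v \<in> Hom M x (Src M q). \<forall>H \<in> Hom M c (Tgt M q).
        q \<cdot> u = H \<cdot> i \<and> q \<cdot> v = H \<cdot> j \<longrightarrow> (\<exists>K \<in> Hom M c (Src M q). q \<cdot> K = H \<and> K \<cdot> i = u \<and> K \<cdot> j = v))"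

lemma cylinderD:
  assumes "cylinder x c i j s"
  shows "i \<in> Hom M x c" "j \<in> Hom M x c" "s \<in> Hom M c x" "s \<in> Weq M"
    "s \<cdot> i = Ident M x" "s \<cdot> j = Ident M x" "i \<in> Weq M" "j \<in> Weq M"
  using assms section_weq[of i x c s] section_weq[of j x c s] unfolding cylinder_def by auto

lemma good_cylinder_lift:
  assumes "good_cylinder x c i j s" "q \<in> Fib M" "q \<in> Weq M" "q \<in> Hom M e b"
    "u \<in> Hom M x e" "v \<in> Hom M x e" "H \<in> Hom M c b" "q \<cdot> u = H \<cdot> i" "q \<cdot> v = H \<cdot> j"
  obtains K where "K \<in> Hom M c e" "q \<cdot> K = H" "K \<cdot> i = u" "K \<cdot> j = v"
proof -
  have "q \<in> Fib M \<inter> Weq M" "u \<in> Hom M x (Src M q)" "v \<in> Hom M x (Src M q)" "H \<in> Hom M c (Tgt M q)"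
    using assms HomD[OF assms(4)] by auto
  then have "\<exists>K \<in> Hom M c (Src M q). q \<cdot> K = H \<and> K \<cdot> i = u \<and> K \<cdot> j = v"
    using assms(1,8,9) unfolding good_cylinder_def by blast
  then show thesis using that HomD[OF assms(4)] by auto
qed

lemma homotopic_refl:
  assumes "f \<in> Hom M x y"
  shows "homotopic x y f f"
proof -
  have x: "x \<in> Obj M" using assms hom_obj by blast
  have "cylinder x x (Ident M x) (Ident M x) (Ident M x)"
    unfolding cylinder_def using x ident_hom ident_model by simp
  then show ?thesis
    unfolding homotopic_def using assms ident_right by metis
qed

lemma homotopic_sym: "homotopic x y f g \<Longrightarrow> homotopic x y g f"
  unfolding homotopic_def cylinder_def by blast

lemma homotopic_comp:
  assumes "homotopic x y f g" "h \<in> Hom M y z"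
  shows "homotopic x z (h \<cdot> f) (h \<cdot> g)"
proof -
  obtain c i j s H where c: "cylinder x c i j s" and H: "H \<in> Hom M c y" "H \<cdot> i = f" "H \<cdot> j = g"
    using assms unfolding homotopic_def by blast
  have "(h \<cdot> H) \<cdot> i = h \<cdot> f" "(h \<cdot> H) \<cdot> j = h \<cdot> g"
    using comp_assoc[OF cylinderD(1)[OF c] H(1) assms(2)] comp_assoc[OF cylinderD(2)[OF c] H(1) assms(2)] H
    by auto
  then show ?thesis
    unfolding homotopic_def using c comp_hom[OF H(1) assms(2)] by blast
qed

lemma homotopicI:
  assumes "good_cylinder x c i j s" "H \<in> Hom M c y"
  shows "homotopic x y (H \<cdot> i) (H \<cdot> j)"
  using assms unfolding homotopic_def good_cylinder_def by blast

end

context pointed_model_category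
begin

text \<open>A pushout over \<open>z0\<close>: two arrows always agree on a zero object, so no
  compatibility condition remains.\<close>

lemma coproductE:
  assumes "x \<in> Obj M"
  obtains l a b where "a \<in> Hom M x l" "b \<in> Hom M x l"
    "\<And>y u v. u \<in> Hom M x y \<Longrightarrow> v \<in> Hom M x y \<Longrightarrow> \<exists>h \<in> Hom M l y. h \<cdot> a = u \<and> h \<cdot> b = v"
    "\<And>y h h'. h \<in> Hom M l y \<Longrightarrow> h' \<in> Hom M l y \<Longrightarrow> h \<cdot> a = h' \<cdot> a \<Longrightarrow> h \<cdot> b = h' \<cdot> b \<Longrightarrow> h = h'"
proof -
  obtain f where f: "f \<in> Hom M z0 x" using from_zero[OF zero_z0 assms] by blast
  obtain l a b where pb: "is_pullback (op_cat M) f f a b" and ab: "a \<in> Hom M x l" "b \<in> Hom M x l"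
    using pushoutE[OF f f] .
  have "\<exists>h \<in> Hom M l y. h \<cdot> a = u \<and> h \<cdot> b = v" if "u \<in> Hom M x y" "v \<in> Hom M x y" for y u v
    using pushout_lift[OF pb f f ab(1) that] from_zero_unique[OF zero_z0 comp_hom[OF f] comp_hom[OF f]] that
    by metis
  then show thesis
    using that[OF ab] pushout_unique[OF pb ab(1)] by blast
qed

text \<open>The fold map of the coproduct of two copies of \<open>x\<close> is factored into a
  cofibration followed by a trivial fibration. Cofibrancy of \<open>x\<close> enters in showing that
  the inclusions into the coproduct are cofibrations.\<close>

lemma good_cylinder_exists:
  assumes A: "cofibrant x"
  obtains c i j s where "good_cylinder x c i j s"
proof -
  have x: "x \<in> Obj M" using A by (simp add: cofibrant_def)
  obtain a l b where ab: "a \<in> Hom M x l" "b \<in> Hom M x l"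
    and ex: "\<And>y u v. u \<in> Hom M x y \<Longrightarrow> v \<in> Hom M x y \<Longrightarrow> \<exists>h \<in> Hom M l y. h \<cdot> a = u \<and> h \<cdot> b = v"
    and un: "\<And>y h h'. h \<in> Hom M l y \<Longrightarrow> h' \<in> Hom M l y \<Longrightarrow> h \<cdot> a = h' \<cdot> a \<Longrightarrow> h \<cdot> b = h' \<cdot> b \<Longrightarrow> h = h'"
    by (rule coproductE[OF x]) (rule that)
  obtain d where d: "d \<in> Hom M l x" "d \<cdot> a = Ident M x" "d \<cdot> b = Ident M x"
    using ex[OF ident_hom[OF x] ident_hom[OF x]] by blast
  obtain c k s where k: "k \<in> Hom M l c" "s \<in> Hom M c x" "d = s \<cdot> k" "k \<in> Cof M" "s \<in> Fib M" "s \<in> Weq M"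
    using factor_cof_tfib[OF d(1)] .
  have inj_cof: "a' \<in> Cof M" if a': "a' \<in> {a, b}" for a'
  proof (rule cofI)
    show "a' \<in> Arr M" using a' ab by (auto simp: Hom_def)
    fix p assume p: "p \<in> Fib M" "p \<in> Weq M"
    note ph = fib_hom[OF p(1)]
    have a'h: "a' \<in> Hom M x l" using a' ab by auto
    obtain b' where b': "b' \<in> Hom M x l" and eq: "{a', b'} = {a, b}" using a' ab by blast
    show "has_lift M a' p"
      unfolding has_lift_def HomD[OF a'h]
    proof (intro ballI impI)
      fix u v assume u: "u \<in> Hom M x (Src M p)" and v: "v \<in> Hom M l (Tgt M p)" and e: "p \<cdot> u = v \<cdot> a'"
      \<comment> \<open>The lifting problem prescribes the lift on one summand only; cofibrancy
        supplies a value on the other.\<close>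
      obtain w where w: "w \<in> Hom M x (Src M p)" "p \<cdot> w = v \<cdot> b'"
        using cofibrantE[OF A p ph comp_hom[OF b' v]] .
      obtain h where h: "h \<in> Hom M l (Src M p)" "h \<cdot> a' = u" "h \<cdot> b' = w"
        using ex[OF u w(1)] ex[OF w(1) u] eq by (metis doubleton_eq_iff)
      have "(p \<cdot> h) \<cdot> a' = v \<cdot> a'" "(p \<cdot> h) \<cdot> b' = v \<cdot> b'"
        using comp_assoc[OF a'h h(1) ph] comp_assoc[OF b' h(1) ph] h e w by auto
      then have "p \<cdot> h = v"
        using un[OF comp_hom[OF h(1) ph] v] eq by (metis doubleton_eq_iff)
      then show "\<exists>h\<in>Hom M l (Src M p). h \<cdot> a' = u \<and> p \<cdot> h = v" using h by blast
    qed
  qed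
  have cyl: "cylinder x c (k \<cdot> a) (k \<cdot> b) s"
    unfolding cylinder_def
    using comp_hom ab k d comp_assoc[OF ab(1) k(1,2)] comp_assoc[OF ab(2) k(1,2)] by auto
  have "good_cylinder x c (k \<cdot> a) (k \<cdot> b) s"
    unfolding good_cylinder_def
  proof (intro conjI ballI impI cyl)
    show "k \<cdot> a \<in> Cof M" "k \<cdot> b \<in> Cof M"
      using cof_comp ab k inj_cof by blast+
    fix q u v H assume q: "q \<in> Fib M \<inter> Weq M" and u: "u \<in> Hom M x (Src M q)" and v: "v \<in> Hom M x (Src M q)"
      and H: "H \<in> Hom M c (Tgt M q)" and e: "q \<cdot> u = H \<cdot> (k \<cdot> a) \<and> q \<cdot> v = H \<cdot> (k \<cdot> b)"
    have qh: "q \<in> Hom M (Src M q) (Tgt M q)" using q fib_hom by blast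
    obtain h where h: "h \<in> Hom M l (Src M q)" "h \<cdot> a = u" "h \<cdot> b = v"
      using ex[OF u v] by blast
    have "q \<cdot> h = H \<cdot> k"
    proof (rule un[OF comp_hom[OF h(1) qh] comp_hom[OF k(1) H]])
      show "(q \<cdot> h) \<cdot> a = (H \<cdot> k) \<cdot> a" "(q \<cdot> h) \<cdot> b = (H \<cdot> k) \<cdot> b"
        using comp_assoc[OF ab(1) h(1) qh] comp_assoc[OF ab(2) h(1) qh]
          comp_assoc[OF ab(1) k(1) H] comp_assoc[OF ab(2) k(1) H] h e by simp_all
    qed
    then obtain K where K: "K \<in> Hom M c (Src M q)" "K \<cdot> k = h" "q \<cdot> K = H"
      using has_liftE[OF lift_cof[OF k(4)] k(1) qh h(1) H] q by blast
    then show "\<exists>K\<in>Hom M c (Src M q). q \<cdot> K = H \<and> K \<cdot> (k \<cdot> a) = u \<and> K \<cdot> (k \<cdot> b) = v"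
      using comp_assoc[OF ab(1) k(1) K(1)] comp_assoc[OF ab(2) k(1) K(1)] h by auto
  qed
  then show thesis by (rule that)
qed

text \<open>The given cylinder is enlarged until its projection becomes a trivial fibration
  \<open>p\<close>. The homotopy extends over the enlargement because \<open>y\<close> is fibrant,
  and the good cylinder maps into it by lifting against \<open>p\<close>.\<close>

lemma homotopic_good:
  assumes hm: "homotopic x y f g" and gc: "good_cylinder x c i j s" and y: "is_fibrant M y"
  obtains H where "H \<in> Hom M c y" "H \<cdot> i = f" "H \<cdot> j = g"
proof -
  obtain c' i' j' s' H where c': "cylinder x c' i' j' s'" and H: "H \<in> Hom M c' y" "H \<cdot> i' = f" "H \<cdot> j' = g"
    using hm unfolding homotopic_def by blast
  note C = cylinderD[OF c']
  have "cylinder x c i j s" using gc by (simp add: good_cylinder_def)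
  note D = cylinderD[OF this]
  obtain d k p where k: "k \<in> Hom M c' d" "p \<in> Hom M d x" "s' = p \<cdot> k" "k \<in> Cof M" "k \<in> Weq M" "p \<in> Fib M"
    using factor_tcof_fib[OF C(3)] .
  have p: "p \<in> Weq M" using weq_left[OF k(1,2,5)] k(3) C(4) by simp
  obtain H' where H': "H' \<in> Hom M d y" "H' \<cdot> k = H"
    using fibrantE[OF y k(4,5,1) H(1)] .
  obtain K where K: "K \<in> Hom M c d" "p \<cdot> K = s" "K \<cdot> i = k \<cdot> i'" "K \<cdot> j = k \<cdot> j'"
    using good_cylinder_lift[OF gc k(6) p k(2) comp_hom[OF C(1) k(1)] comp_hom[OF C(2) k(1)] D(3)]
      comp_assoc[OF C(1) k(1,2)] comp_assoc[OF C(2) k(1,2)] C D k(3) by metis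
  show thesis
  proof (rule that[OF comp_hom[OF K(1) H'(1)]])
    show "(H' \<cdot> K) \<cdot> i = f"
      using comp_assoc[OF D(1) K(1) H'(1)] comp_assoc[OF C(1) k(1) H'(1)] K H' H by simp
    show "(H' \<cdot> K) \<cdot> j = g"
      using comp_assoc[OF D(2) K(1) H'(1)] comp_assoc[OF C(2) k(1) H'(1)] K H' H by simp
  qed
qed

text \<open>Two copies of one good cylinder are glued, the end \<open>j\<close> of the first to the
  end \<open>i\<close> of the second. The result is again a cylinder, since a cobase change of the
  trivial cofibration \<open>i\<close> is a weak equivalence.\<close>

lemma homotopic_trans:
  assumes A: "cofibrant x" and y: "is_fibrant M y" and fg: "homotopic x y f g" and gh: "homotopic x y g h"
  shows "homotopic x y f h"
proof -
  obtain c i j s where gc: "good_cylinder x c i j s" using good_cylinder_exists[OF A] .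
  then have cyl: "cylinder x c i j s" and i: "i \<in> Cof M" by (simp_all add: good_cylinder_def)
  note D = cylinderD[OF cyl]
  obtain H where H: "H \<in> Hom M c y" "H \<cdot> i = f" "H \<cdot> j = g" using homotopic_good[OF fg gc y] .
  obtain K where K: "K \<in> Hom M c y" "K \<cdot> i = g" "K \<cdot> j = h" using homotopic_good[OF gh gc y] .
  obtain d b a where po: "is_pullback (op_cat M) i j b a" and b: "b \<in> Hom M c d" and a: "a \<in> Hom M c d"
    using pushoutE[OF D(1,2)] .
  have ba: "b \<cdot> i = a \<cdot> j" using is_pullbackD(1)[OF po] by simp
  have aw: "a \<in> Weq M" using tcof_pushout(2)[OF po i D(7)] .
  obtain t where t: "t \<in> Hom M d x" "t \<cdot> b = s" "t \<cdot> a = s"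
    using pushout_lift[OF po D(1,2) b D(3) D(3)] D by metis
  obtain L where L: "L \<in> Hom M d y" "L \<cdot> b = K" "L \<cdot> a = H"
    using pushout_lift[OF po D(1,2) b K(1) H(1)] K H by metis
  have "cylinder x d (a \<cdot> i) (b \<cdot> j) t"
    unfolding cylinder_def
    using comp_hom[OF D(1) a] comp_hom[OF D(2) b] t weq_left[OF a t(1) aw] D
      comp_assoc[OF D(1) a t(1)] comp_assoc[OF D(2) b t(1)] by simp
  moreover have "L \<cdot> (a \<cdot> i) = f" "L \<cdot> (b \<cdot> j) = h"
    using comp_assoc[OF D(1) a L(1)] comp_assoc[OF D(2) b L(1)] L H K by simp_all
  ultimately show ?thesis unfolding homotopic_def using L(1) by blast
qed

text \<open>
  Lifting the homotopy along a factorization \<open>k\<close> after \<open>i\<close> of \<open>w\<close>, and then retracting \<open>i\<close> over \<open>p\<close>.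
\<close>

lemma whitehead_inj_over:
  assumes gc: "good_cylinder x c i j s" and r: "r \<in> Hom M e p" "r \<in> Fib M"
    and w: "w \<in> Hom M e e'" "w \<in> Weq M" and v: "v \<in> Hom M e' p" "v \<cdot> w = r"
    and f: "f \<in> Hom M x e" and g: "g \<in> Hom M x e"
    and H: "H \<in> Hom M c e'" "H \<cdot> i = w \<cdot> f" "H \<cdot> j = w \<cdot> g"
  obtains K where "K \<in> Hom M c e" "K \<cdot> i = f" "K \<cdot> j = g" "r \<cdot> K = v \<cdot> H"
proof -
  have "cylinder x c i j s" using gc by (simp add: good_cylinder_def)
  note D = cylinderD[OF this]
  obtain t l k where k: "l \<in> Hom M e t" "k \<in> Hom M t e'" "w = k \<cdot> l" "l \<in> Cof M" "l \<in> Weq M" "k \<in> Fib M"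
    using factor_tcof_fib[OF w(1)] .
  have kw: "k \<in> Weq M" using weq_left[OF k(1,2,5)] k(3) w(2) by simp
  obtain K where K: "K \<in> Hom M c t" "k \<cdot> K = H" "K \<cdot> i = l \<cdot> f" "K \<cdot> j = l \<cdot> g"
    using good_cylinder_lift[OF gc k(6) kw k(2) comp_hom[OF f k(1)] comp_hom[OF g k(1)] H(1)]
      comp_assoc[OF f k(1,2)] comp_assoc[OF g k(1,2)] H k(3) by metis
  have e: "e \<in> Obj M" using r hom_obj by blast
  have "r \<cdot> Ident M e = (v \<cdot> k) \<cdot> l"
    using comp_assoc[OF k(1,2) v(1)] v(2) k(3) ident_right[OF r(1)] by simp
  then obtain q where q: "q \<in> Hom M t e" "q \<cdot> l = Ident M e" "r \<cdot> q = v \<cdot> k"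
    using has_liftE[OF lift_fib[OF k(4,5) r(2)] k(1) r(1) ident_hom[OF e] comp_hom[OF k(2) v(1)]] by blast
  show thesis
  proof (rule that[OF comp_hom[OF K(1) q(1)]])
    show "(q \<cdot> K) \<cdot> i = f"
      using comp_assoc[OF D(1) K(1) q(1)] comp_assoc[OF f k(1) q(1)] K q ident_left[OF f] by simp
    show "(q \<cdot> K) \<cdot> j = g"
      using comp_assoc[OF D(2) K(1) q(1)] comp_assoc[OF g k(1) q(1)] K q ident_left[OF g] by simp
    show "r \<cdot> (q \<cdot> K) = v \<cdot> H"
      using comp_assoc[OF K(1) q(1) r(1)] comp_assoc[OF K(1) k(2) v(1)] q K by simp
  qed
qed

text \<open>The relative statement with \<open>z0\<close> as base, where compatibility with the
  projections is automatic.\<close>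

lemma whitehead_inj:
  assumes A: "cofibrant x" and fib: "is_fibrant M e" "is_fibrant M e'" and w: "w \<in> Hom M e e'" "w \<in> Weq M"
    and f: "f \<in> Hom M x e" and g: "g \<in> Hom M x e" and hm: "homotopic x e' (w \<cdot> f) (w \<cdot> g)"
  shows "homotopic x e f g"
proof -
  obtain c i j s where gc: "good_cylinder x c i j s" using good_cylinder_exists[OF A] .
  obtain H where H: "H \<in> Hom M c e'" "H \<cdot> i = w \<cdot> f" "H \<cdot> j = w \<cdot> g"
    using homotopic_good[OF hm gc fib(2)] .
  obtain r where r: "r \<in> Hom M e z0" using to_z0[OF fibrant_obj[OF fib(1)]] by blast
  obtain v where v: "v \<in> Hom M e' z0" using to_z0[OF fibrant_obj[OF fib(2)]] by blast
  have "v \<cdot> w = r" using to_z0_unique[OF comp_hom[OF w(1) v] r] .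
  then show ?thesis
    using whitehead_inj_over[OF gc r to_z0_fib[OF fib(1) r] w v _ f g H] homotopicI[OF gc] by metis
qed

lemma whitehead_surj:
  assumes A: "cofibrant x" and fib: "is_fibrant M e" "is_fibrant M e'" and w: "w \<in> Hom M e e'" "w \<in> Weq M"
    and h: "h \<in> Hom M x e'"
  obtains f where "f \<in> Hom M x e" "homotopic x e' (w \<cdot> f) h"
proof -
  obtain t l k where k: "l \<in> Hom M e t" "k \<in> Hom M t e'" "w = k \<cdot> l" "l \<in> Cof M" "l \<in> Weq M" "k \<in> Fib M"
    using factor_tcof_fib[OF w(1)] .
  have kw: "k \<in> Weq M" using weq_left[OF k(1,2,5)] k(3) w(2) by simp
  have t: "is_fibrant M t" using fib_fibrant[OF k(6,2) fib(2)] .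
  obtain h' where h': "h' \<in> Hom M x t" "k \<cdot> h' = h" using cofibrantE[OF A k(6) kw k(2) h] .
  obtain q where q: "q \<in> Hom M t e" "q \<cdot> l = Ident M e"
    using fibrantE[OF fib(1) k(4,5,1) ident_hom[OF fibrant_obj[OF fib(1)]]] .
  have qw: "q \<in> Weq M" using section_weq[OF k(1) q] k(5) by simp
  let ?f = "q \<cdot> h'"
  have f: "?f \<in> Hom M x e" using comp_hom[OF h'(1) q(1)] .
  \<comment> \<open>\<open>l\<close> followed by its retraction \<open>q\<close> is an identity, so
    \<open>q\<close> does not distinguish \<open>l \<cdot> ?f\<close> from \<open>h'\<close>. As
    \<open>q\<close> is a weak equivalence, the two are homotopic.\<close>
  have "q \<cdot> (l \<cdot> ?f) = ?f" using comp_assoc[OF f k(1) q(1)] q(2) ident_left[OF f] by simp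
  then have "homotopic x t (l \<cdot> ?f) h'"
    using whitehead_inj[OF A t fib(1) q(1) qw comp_hom[OF f k(1)] h'(1)] homotopic_refl[OF f] by simp
  then have "homotopic x e' (w \<cdot> ?f) h"
    using homotopic_comp[OF _ k(2)] h'(2) comp_assoc[OF f k(1,2)] k(3) by metis
  then show thesis using that f by blast
qed

lemma productE:
  assumes "x \<in> Obj M" "y \<in> Obj M"
  obtains f g p q where "f \<in> Hom M x z0" "g \<in> Hom M y z0" "is_pullback M f g p q"
    "p \<in> Hom M (Src M p) x" "q \<in> Hom M (Src M p) y"
    "\<And>v a b. a \<in> Hom M v x \<Longrightarrow> b \<in> Hom M v y \<Longrightarrow> \<exists>h \<in> Hom M v (Src M p). p \<cdot> h = a \<and> q \<cdot> h = b"
    "\<And>v h h'. h \<in> Hom M v (Src M p) \<Longrightarrow> h' \<in> Hom M v (Src M p) \<Longrightarrow> p \<cdot> h = p \<cdot> h' \<Longrightarrow> q \<cdot> h = q \<cdot> h' \<Longrightarrow> h = h'"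
proof -
  obtain f where f: "f \<in> Hom M x z0" using to_z0[OF assms(1)] by blast
  obtain g where g: "g \<in> Hom M y z0" using to_z0[OF assms(2)] by blast
  obtain l p q where pb: "is_pullback M f g p q" and pq: "p \<in> Hom M l x" "q \<in> Hom M l y"
    using pullbackE[OF finite_limits f g] .
  have "\<exists>h \<in> Hom M v (Src M p). p \<cdot> h = a \<and> q \<cdot> h = b" if "a \<in> Hom M v x" "b \<in> Hom M v y" for v a b
    using is_pullback_lift[OF pb, of a v b] to_z0_unique[OF comp_hom[OF that(1) f] comp_hom[OF that(2) g]]
      that HomD[OF f] HomD[OF g] by metis
  then show thesis
    using that[OF f g pb] pq is_pullback_unique[OF pb] HomD[OF pq(1)] by simp
qed

text \<open>A path object of \<open>z\<close>, obtained by factoring the diagonal, turns the pair of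
  \<open>a\<close> and \<open>b\<close> into a right homotopy \<open>K\<close>. Up to left homotopy,
  \<open>K \<cdot> h\<close> comes from an arrow \<open>u\<close> into \<open>z\<close> itself, and
  projecting to both ends shows that \<open>u\<close> is homotopic to \<open>a \<cdot> h\<close> and
  to \<open>b \<cdot> h\<close>. The purpose is uniqueness up to homotopy of extensions along
  \<open>frep\<close>.\<close>

lemma eq_on_tcof:
  assumes A: "cofibrant x" and z: "is_fibrant M z" and i: "i \<in> Hom M y y'" "i \<in> Cof M" "i \<in> Weq M"
    and a: "a \<in> Hom M y' z" and b: "b \<in> Hom M y' z" and e: "a \<cdot> i = b \<cdot> i" and h: "h \<in> Hom M x y'"
  shows "homotopic x z (a \<cdot> h) (b \<cdot> h)"
proof -
  have zo: "z \<in> Obj M" using fibrant_obj[OF z] .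
  obtain f g p q where f: "f \<in> Hom M z z0" "g \<in> Hom M z z0" and pb: "is_pullback M f g p q"
    and p: "p \<in> Hom M (Src M p) z" and q: "q \<in> Hom M (Src M p) z"
    and ex: "\<And>v a b. a \<in> Hom M v z \<Longrightarrow> b \<in> Hom M v z \<Longrightarrow> \<exists>h \<in> Hom M v (Src M p). p \<cdot> h = a \<and> q \<cdot> h = b"
    and un: "\<And>v h h'. h \<in> Hom M v (Src M p) \<Longrightarrow> h' \<in> Hom M v (Src M p) \<Longrightarrow> p \<cdot> h = p \<cdot> h' \<Longrightarrow> q \<cdot> h = q \<cdot> h' \<Longrightarrow> h = h'"
    using productE[OF zo zo] by blast
  obtain d where d: "d \<in> Hom M z (Src M p)" "p \<cdot> d = Ident M z" "q \<cdot> d = Ident M z"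
    using ex[OF ident_hom[OF zo] ident_hom[OF zo]] by blast
  obtain t l k where k: "l \<in> Hom M z t" "k \<in> Hom M t (Src M p)" "d = k \<cdot> l" "l \<in> Cof M" "l \<in> Weq M" "k \<in> Fib M"
    using factor_tcof_fib[OF d(1)] .
  have qf: "q \<in> Fib M" using fib_pullback[OF pb to_z0_fib[OF z f(1)]] .
  have t: "is_fibrant M t" using fib_fibrant[OF k(6,2) fib_fibrant[OF qf q z]] .
  obtain m where m: "m \<in> Hom M y' (Src M p)" "p \<cdot> m = a" "q \<cdot> m = b" using ex[OF a b] by blast
  note ai = comp_hom[OF i(1) a]
  have "d \<cdot> (a \<cdot> i) = m \<cdot> i"
  proof (rule un[OF comp_hom[OF ai d(1)] comp_hom[OF i(1) m(1)]])
    show "p \<cdot> d \<cdot> a \<cdot> i = p \<cdot> m \<cdot> i"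
      using comp_cancel1[OF d(2,1) p ai] comp_cancel1[OF m(2,1) p i(1)] ident_left[OF ai] by simp
    show "q \<cdot> d \<cdot> a \<cdot> i = q \<cdot> m \<cdot> i"
      using comp_cancel1[OF d(3,1) q ai] comp_cancel1[OF m(3,1) q i(1)] ident_left[OF ai] e by simp
  qed
  then have "k \<cdot> (l \<cdot> (a \<cdot> i)) = m \<cdot> i" using comp_assoc[OF ai k(1,2)] k(3) by simp
  then obtain K where K: "K \<in> Hom M y' t" "K \<cdot> i = l \<cdot> (a \<cdot> i)" "k \<cdot> K = m"
    using has_liftE[OF lift_fib[OF i(2,3) k(6)] i(1) k(2) comp_hom[OF ai k(1)] m(1)] by blast
  obtain u where u: "u \<in> Hom M x z" "homotopic x t (l \<cdot> u) (K \<cdot> h)"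
    using whitehead_surj[OF A z t k(1,5) comp_hom[OF h K(1)]] .
  have pr: "homotopic x z u (c \<cdot> h)" if r: "r \<in> Hom M (Src M p) z" "r \<cdot> d = Ident M z" "r \<cdot> m = c" for r c
  proof -
    have "homotopic x z ((r \<cdot> k) \<cdot> (l \<cdot> u)) ((r \<cdot> k) \<cdot> (K \<cdot> h))"
      using homotopic_comp[OF u(2) comp_hom[OF k(2) r(1)]] .
    moreover have "(r \<cdot> k) \<cdot> (l \<cdot> u) = u"
      using comp_assoc[OF comp_hom[OF u(1) k(1)] k(2) r(1)] comp_assoc[OF u(1) k(1,2)]
        comp_cancel1[OF r(2) d(1) r(1) u(1)] k(3) ident_left[OF u(1)] by simp
    moreover have "(r \<cdot> k) \<cdot> (K \<cdot> h) = c \<cdot> h"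
      using comp_assoc[OF comp_hom[OF h K(1)] k(2) r(1)] comp_cancel1[OF K(3,1) k(2) h]
        comp_cancel1[OF r(3) m(1) r(1) h] by simp
    ultimately show ?thesis by simp
  qed
  show ?thesis
    using homotopic_trans[OF A z homotopic_sym[OF pr[OF p d(2) m(2)]] pr[OF q d(3) m(3)]] .
qed

end

section \<open>The homotopy category\<close>

context category
begin

context
  fixes W :: "'a set"
begin

lemma zigzag_obj:
  assumes "zigzag C W x s y"
  shows "x \<in> Obj C" "y \<in> Obj C"
  using assms by (induction, auto simp: hom_obj)

lemma zigzag_append: "zigzag C W x s y \<Longrightarrow> zigzag C W y t z \<Longrightarrow> zigzag C W x (s @ t) z"
  by (induction rule: zigzag.induct) (auto intro: zigzag.intros)

lemma zz_eq_zigzag: "zz_eq C W x y s t \<Longrightarrow> zigzag C W x s y \<and> zigzag C W x t y"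
  by (induction rule: zz_eq.induct) auto

lemma zz_eq_append_right:
  "zz_eq C W x y s s' \<Longrightarrow> zigzag C W y t z \<Longrightarrow> zz_eq C W x z (s @ t) (s' @ t)"
proof (induction rule: zz_eq.induct)
  case (zze_rel r r' a b)
  then show ?case
    using zz_eq.zze_rel[of C W r r' x a "b @ t" z] zigzag_append by fastforce
qed (auto intro: zz_eq.intros zigzag_append)

lemma zz_eq_append_left:
  "zz_eq C W y z t t' \<Longrightarrow> zigzag C W x s y \<Longrightarrow> zz_eq C W x z (s @ t) (s @ t')"
proof (induction rule: zz_eq.induct)
  case (zze_rel r r' a b)
  then show ?case
    using zz_eq.zze_rel[of C W r r' x "s @ a" b z] zigzag_append by fastforce
qed (auto intro: zz_eq.intros zigzag_append)

lemma zz_eq_append: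
  assumes "zz_eq C W x y s s'" "zz_eq C W y z t t'"
  shows "zz_eq C W x z (s @ t) (s' @ t')"
  using zz_eq_append_right[OF assms(1)] zz_eq_append_left[OF assms(2)] zz_eq_zigzag assms zze_trans
  by metis

lemma fraction_eq_iff:
  assumes "zigzag C W x s y"
  shows "fraction C W x s y = fraction C W x t y \<longleftrightarrow> zz_eq C W x y s t"
proof
  assume "fraction C W x s y = fraction C W x t y"
  then have "{u. zz_eq C W x y s u} = {u. zz_eq C W x y t u}" by (simp add: fraction_def)
  then have "zz_eq C W x y t s" using zze_refl[OF assms] by (metis mem_Collect_eq)
  then show "zz_eq C W x y s t" by (rule zze_sym)
next
  assume "zz_eq C W x y s t"
  then show "fraction C W x s y = fraction C W x t y"
    unfolding fraction_def by (auto intro: zze_trans dest: zze_sym)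
qed

lemma localization_simps:
  "Obj (localization C W) = Obj C" "Ident (localization C W) x = fraction C W x [] x"
  by (simp_all add: localization_def)

lemma Hom_localization: "Hom (localization C W) x y = {fraction C W x s y | s. zigzag C W x s y}"
  by (auto simp: Hom_def localization_def fraction_def)

lemma comp_fraction:
  assumes "zigzag C W x s y" "zigzag C W y t z"
  shows "fraction C W y t z \<cdot>\<^bsub>localization C W\<^esub> fraction C W x s y = fraction C W x (s @ t) z"
proof -
  have "zz_eq C W x z (s' @ t') u \<longleftrightarrow> zz_eq C W x z (s @ t) u"
    if "zz_eq C W x y s s'" "zz_eq C W y z t t'" for s' t' u
    using zz_eq_append[OF that] zze_trans zze_sym by metis
  moreover have "zz_eq C W x y s s" "zz_eq C W y z t t" using assms by (auto intro: zze_refl)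
  ultimately show ?thesis
    unfolding localization_def fraction_def by auto
qed

lemma category_localization: "category (localization C W)"
proof
  fix f assume "f \<in> Arr (localization C W)"
  then show "Src (localization C W) f \<in> Obj (localization C W)" "Tgt (localization C W) f \<in> Obj
      (localization C W)"
    by (auto simp: localization_def fraction_def dest: zigzag_obj)
next
  fix x assume "x \<in> Obj (localization C W)"
  then show "Ident (localization C W) x \<in> Hom (localization C W) x x"
    unfolding Hom_localization localization_simps
    by - (rule CollectI, rule exI, rule conjI[OF refl], rule zz_nil)
next
  fix f g x y z assume "f \<in> Hom (localization C W) x y" "g \<in> Hom (localization C W) y z"
  then obtain s t where "zigzag C W x s y" "zigzag C W y t z" "f = fraction C W x s y" "g = fraction C W y t z"
    unfolding Hom_localization by blast
  then show "g \<cdot>\<^bsub>localization C W\<^esub> f \<in> Hom (localization C W) x z"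
    using comp_fraction[of x s y t z] zigzag_append[of x s y t z] unfolding Hom_localization by auto
next
  fix f x y assume "f \<in> Hom (localization C W) x y"
  then obtain s where s: "zigzag C W x s y" "f = fraction C W x s y" by (auto simp: Hom_localization)
  then show "Ident (localization C W) y \<cdot>\<^bsub>localization C W\<^esub> f = f" "f \<cdot>\<^bsub>localization C W\<^esub> Ident
      (localization C W) x = f"
    using comp_fraction[OF s(1) zz_nil] comp_fraction[OF zz_nil s(1)] zigzag_obj[OF s(1)]
    by (simp_all add: localization_simps)
next
  fix f g h w x y z
  assume "f \<in> Hom (localization C W) w x" "g \<in> Hom (localization C W) x y" "h \<in> Hom (localization C W) y z"
  then obtain r s t where "zigzag C W w r x" "zigzag C W x s y" "zigzag C W y t z"
    "f = fraction C W w r x" "g = fraction C W x s y" "h = fraction C W y t z"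
    unfolding Hom_localization by blast
  then show "(h \<cdot>\<^bsub>localization C W\<^esub> g) \<cdot>\<^bsub>localization C W\<^esub> f = h \<cdot>\<^bsub>localization C W\<^esub> (g \<cdot>\<^bsub>localization C W\<^esub> f)"
    using comp_fraction[of w _ x] comp_fraction[of x _ y] zigzag_append[of w _ x] zigzag_append[of x _ y]
    by (simp add: comp_fraction[of _ _ y])
qed

end

end

text \<open>A set-valued functor on \<open>C\<close> that sends \<open>W\<close> to bijections, with
  all values inside one type. \<open>zact\<close> extends it to zigzags, and by
  \<open>zz_eq_zact\<close> the extension respects the congruence. This half of the universal
  property of the localization is what allows arrows to be told apart.\<close>

locale inverting_action = category C for C :: "('o, 'a, 'z) category_scheme" (structure) +
  fixes W :: "'a set" and S :: "'o \<Rightarrow> 's set" and P :: "'a \<Rightarrow> 's \<Rightarrow> 's"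
  assumes W_arr: "W \<subseteq> Arr C"
    and act_in: "f \<in> Hom C x y \<Longrightarrow> e \<in> S x \<Longrightarrow> P f e \<in> S y"
    and act_ident: "x \<in> Obj C \<Longrightarrow> e \<in> S x \<Longrightarrow> P (Ident C x) e = e"
    and act_comp: "f \<in> Hom C x y \<Longrightarrow> g \<in> Hom C y z \<Longrightarrow> e \<in> S x \<Longrightarrow> P (g \<cdot> f) e = P g (P f e)"
    and act_inv: "w \<in> W \<Longrightarrow> w \<in> Hom C x y \<Longrightarrow> bij_betw (P w) (S x) (S y)"
begin

fun zact :: "'a step list \<Rightarrow> 's \<Rightarrow> 's" where
  "zact [] e = e"
| "zact (Fwd f # s) e = zact s (P f e)"
| "zact (Bwd w # s) e = zact s (inv_into (S (Src C w)) (P w) e)"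

lemma zact_append: "zact (s @ t) e = zact t (zact s e)"
  by (induction s e rule: zact.induct) auto

lemma inv_in: "w \<in> W \<Longrightarrow> w \<in> Hom C x y \<Longrightarrow> e \<in> S y \<Longrightarrow> inv_into (S x) (P w) e \<in> S x"
  using act_inv[of w x y] by (metis bij_betw_def inv_into_into)

lemma zact_in: "zigzag C W x s y \<Longrightarrow> e \<in> S x \<Longrightarrow> zact s e \<in> S y"
  by (induction arbitrary: e rule: zigzag.induct) (auto simp: act_in inv_in HomD)

lemma zz_fwdD: "zigzag C W x (Fwd f # s) y \<Longrightarrow> f \<in> Hom C x (Tgt C f) \<and> zigzag C W (Tgt C f) s y"
  by (cases rule: zigzag.cases) (auto simp: Hom_def)

lemma zz_bwdD: "zigzag C W x (Bwd w # s) y \<Longrightarrow> w \<in> W \<and> w \<in> Hom C (Src C w) x \<and> zigzag C W (Src C w) s y"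
  by (cases rule: zigzag.cases) (auto simp: Hom_def)

lemma zz_appendD: "zigzag C W x (s @ t) y \<Longrightarrow> \<exists>m. zigzag C W x s m \<and> zigzag C W m t y"
proof (induction s arbitrary: x)
  case Nil
  then show ?case using zz_nil zigzag_obj by fastforce
next
  case (Cons a s)
  show ?case
  proof (cases a)
    case (Fwd f)
    then have "f \<in> Hom C x (Tgt C f)" "zigzag C W (Tgt C f) (s @ t) y"
      using zz_fwdD[of x f "s @ t" y] Cons.prems by auto
    then show ?thesis using Cons.IH Fwd by (metis append_Cons zz_fwd)
  next
    case (Bwd w)
    then have "w \<in> W" "w \<in> Hom C (Src C w) x" "zigzag C W (Src C w) (s @ t) y"
      using zz_bwdD[of x w "s @ t" y] Cons.prems by auto
    then show ?thesis using Cons.IH Bwd by (metis append_Cons zz_bwd)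
  qed
qed

lemma zz_rel_zact:
  assumes "zz_rel C W r r'" "zigzag C W x r y" "e \<in> S x"
  shows "zact r e = zact r' e"
  using assms(1)
proof cases
  case (zzr_id a)
  then have "a = x" using zz_fwdD assms(2) by (force simp: Hom_def)
  then show ?thesis using zzr_id act_ident assms(3) by simp
next
  case (zzr_comp f a b g c)
  then have "a = x" using zz_fwdD assms(2) by (force simp: Hom_def)
  then show ?thesis using zzr_comp act_comp assms(3) by simp
next
  case (zzr_fb w)
  then have w: "w \<in> W" "w \<in> Hom C x (Tgt C w)" using zz_fwdD assms(2) by auto
  then have "inv_into (S x) (P w) (P w e) = e"
    using act_inv assms(3) by (meson bij_betw_def inv_into_f_f)
  then show ?thesis using zzr_fb w by (simp add: HomD)
next
  case (zzr_bf w)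
  then have w: "w \<in> W" "w \<in> Hom C (Src C w) x" using zz_bwdD assms(2) by auto
  then have "P w (inv_into (S (Src C w)) (P w) e) = e"
    using act_inv assms(3) by (meson bij_betw_inv_into_right)
  then show ?thesis using zzr_bf by simp
qed

lemma zz_eq_zact: "zz_eq C W x y s t \<Longrightarrow> e \<in> S x \<Longrightarrow> zact s e = zact t e"
proof (induction rule: zz_eq.induct)
  case (zze_rel r r' a b)
  obtain m n where "zigzag C W x a m" "zigzag C W m r n"
    using zz_appendD[OF zze_rel(2)] zz_appendD by blast
  then show ?case
    using zz_rel_zact[OF zze_rel(1)] zact_in zze_rel by (simp add: zact_append)
qed auto

end

sublocale model_category \<subseteq> ho: category "ho M"
  unfolding ho_def by (rule category_localization)

context model_category
begin

abbreviation ho_comp :: "('o, 'a) fraction \<Rightarrow> ('o, 'a) fraction \<Rightarrow> ('o, 'a) fraction" (infixr "\<odot>" 70) where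
  "g \<odot> f \<equiv> g \<cdot>\<^bsub>ho M\<^esub> f"

lemma ho_obj [simp]: "Obj (ho M) = Obj M"
  by (simp add: ho_def localization_simps)

lemma ho_arr_eq: "f \<in> Hom M x y \<Longrightarrow> ho_arr M f = fraction M (Weq M) x [Fwd f] y"
  by (simp add: ho_arr_def loc_arr_def HomD)

lemma zz_single: "f \<in> Hom M x y \<Longrightarrow> zigzag M (Weq M) x [Fwd f] y"
  by (rule zz_fwd) (auto intro: zz_nil hom_obj)

lemma ho_arr_hom: "f \<in> Hom M x y \<Longrightarrow> ho_arr M f \<in> Hom (ho M) x y"
  unfolding ho_def by (auto simp: Hom_localization ho_arr_eq intro: zz_single)

lemma ho_arr_comp:
  assumes "f \<in> Hom M x y" "g \<in> Hom M y z"
  shows "ho_arr M (g \<cdot> f) = ho_arr M g \<odot> ho_arr M f"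
proof -
  have "zz_eq M (Weq M) x z ([] @ [Fwd f, Fwd g] @ []) ([] @ [Fwd (g \<cdot> f)] @ [])"
    using assms by (intro zze_rel zzr_comp) (auto intro: zz_fwd zz_nil comp_hom hom_obj)
  then have "fraction M (Weq M) x [Fwd f, Fwd g] z = fraction M (Weq M) x [Fwd (g \<cdot> f)] z"
    using fraction_eq_iff zz_eq_zigzag by force
  then show ?thesis
    unfolding ho_arr_eq[OF assms(1)] ho_arr_eq[OF assms(2)] ho_arr_eq[OF comp_hom[OF assms]] ho_def
    using comp_fraction[OF zz_single[OF assms(1)] zz_single[OF assms(2)]] by simp
qed

lemma ho_arr_ident:
  assumes "x \<in> Obj M"
  shows "ho_arr M (Ident M x) = Ident (ho M) x"
proof -
  have "zz_eq M (Weq M) x x ([] @ [Fwd (Ident M x)] @ []) ([] @ [] @ [])"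
    using assms by (intro zze_rel zzr_id) (auto intro: zz_fwd zz_nil ident_hom)
  then show ?thesis
    using fraction_eq_iff zz_eq_zigzag assms
    by (fastforce simp: ho_arr_eq[OF ident_hom] ho_def localization_simps)
qed

definition ho_inv :: "'a \<Rightarrow> ('o, 'a) fraction" where
  "ho_inv w = fraction M (Weq M) (Tgt M w) [Bwd w] (Src M w)"

lemma ho_inv:
  assumes "w \<in> Weq M" "w \<in> Hom M x y"
  shows "ho_inv w \<in> Hom (ho M) y x" "ho_inv w \<odot> ho_arr M w = Ident (ho M) x"
    "ho_arr M w \<odot> ho_inv w = Ident (ho M) y"
proof -
  have e: "ho_inv w = fraction M (Weq M) y [Bwd w] x" using assms(2) by (simp add: ho_inv_def HomD)
  have z: "zigzag M (Weq M) y [Bwd w] x" using assms by (auto intro: zz_bwd zz_nil hom_obj)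
  show "ho_inv w \<in> Hom (ho M) y x" using z unfolding e ho_def by (auto simp: Hom_localization)
  have "zz_eq M (Weq M) x x ([] @ [Fwd w, Bwd w] @ []) ([] @ [] @ [])"
    "zz_eq M (Weq M) y y ([] @ [Bwd w, Fwd w] @ []) ([] @ [] @ [])"
    by (intro zze_rel zzr_fb zzr_bf; use assms in \<open>auto intro: zz_fwd zz_bwd zz_nil hom_obj\<close>)+
  then have "fraction M (Weq M) x [Fwd w, Bwd w] x = fraction M (Weq M) x [] x"
    "fraction M (Weq M) y [Bwd w, Fwd w] y = fraction M (Weq M) y [] y"
    using fraction_eq_iff zz_eq_zigzag by force+
  then show "ho_inv w \<odot> ho_arr M w = Ident (ho M) x" "ho_arr M w \<odot> ho_inv w = Ident (ho M) y"
    using comp_fraction[OF zz_single[OF assms(2)] z] comp_fraction[OF z zz_single[OF assms(2)]]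
    unfolding e ho_arr_eq[OF assms(2)] ho_def by (simp_all add: localization_simps)
qed

lemma ho_cancel_left:
  assumes "w \<in> Weq M" "w \<in> Hom M x y" "f \<in> Hom (ho M) v x" "g \<in> Hom (ho M) v x"
    "ho_arr M w \<odot> f = ho_arr M w \<odot> g"
  shows "f = g"
proof -
  note I = ho_inv[OF assms(1,2)]
  have "ho_inv w \<odot> (ho_arr M w \<odot> k) = k" if "k \<in> Hom (ho M) v x" for k
    using ho.comp_cancel1[OF I(2) ho_arr_hom[OF assms(2)] I(1) that] ho.ident_left[OF that] by simp
  then show ?thesis using assms by metis
qed

lemma ho_cancel_right:
  assumes "w \<in> Weq M" "w \<in> Hom M x y" "f \<in> Hom (ho M) y z" "g \<in> Hom (ho M) y z"
    "f \<odot> ho_arr M w = g \<odot> ho_arr M w"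
  shows "f = g"
proof -
  note I = ho_inv[OF assms(1,2)]
  have "(k \<odot> ho_arr M w) \<odot> ho_inv w = k" if "k \<in> Hom (ho M) y z" for k
    using ho.comp_assoc[OF I(1) ho_arr_hom[OF assms(2)] that] I(3) ho.ident_right[OF that] by simp
  then show ?thesis using assms by metis
qed

text \<open>Both ends of a cylinder are sections of the same weak equivalence, so they coincide once
  it is inverted.\<close>

lemma homotopic_ho_arr:
  assumes "homotopic x y f g"
  shows "ho_arr M f = ho_arr M g"
proof -
  obtain c i j s H where c: "cylinder x c i j s" and H: "H \<in> Hom M c y" "H \<cdot> i = f" "H \<cdot> j = g"
    using assms unfolding homotopic_def by blast
  note D = cylinderD[OF c]
  have "ho_arr M i = ho_arr M j"
    using ho_cancel_left[OF D(4,3) ho_arr_hom[OF D(1)] ho_arr_hom[OF D(2)]]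
      ho_arr_comp[OF D(1,3)] ho_arr_comp[OF D(2,3)] D(5,6) by simp
  then show ?thesis
    using ho_arr_comp[OF D(1) H(1)] ho_arr_comp[OF D(2) H(1)] H by simp
qed

end

section \<open>Homotopy classes of arrows into fibrant replacements\<close>

context pointed_model_category
begin

definition frep :: "'a \<Rightarrow> 'b" where
  "frep x = (SOME i. i \<in> Hom M x (Tgt M i) \<and> i \<in> Cof M \<and> i \<in> Weq M \<and> is_fibrant M (Tgt M i))"

abbreviation frob :: "'a \<Rightarrow> 'a" where "frob x \<equiv> Tgt M (frep x)"

lemma frep:
  assumes "x \<in> Obj M"
  shows "frep x \<in> Hom M x (frob x)" "frep x \<in> Cof M" "frep x \<in> Weq M" "is_fibrant M (frob x)"
proof -
  obtain r i where "i \<in> Hom M x r" "i \<in> Cof M" "i \<in> Weq M" "is_fibrant M r"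
    using fibrant_replacement[OF assms] .
  then have "\<exists>i. i \<in> Hom M x (Tgt M i) \<and> i \<in> Cof M \<and> i \<in> Weq M \<and> is_fibrant M (Tgt M i)"
    using HomD(3) by metis
  from someI_ex[OF this]
  show "frep x \<in> Hom M x (frob x)" "frep x \<in> Cof M" "frep x \<in> Weq M" "is_fibrant M (frob x)"
    unfolding frep_def by blast+
qed

text \<open>Factorizations need not be functorial, so this is merely one chosen extension along
  \<open>frep\<close>. After precomposition with an arrow from a cofibrant object it respects
  identities and composition up to homotopy, by \<open>eq_on_tcof\<close>.\<close>

definition fext :: "'b \<Rightarrow> 'b" where
  "fext f = (SOME f'. f' \<in> Hom M (frob (Src M f)) (frob (Tgt M f)) \<and>
     f' \<cdot> frep (Src M f) = frep (Tgt M f) \<cdot> f)"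

lemma fext:
  assumes "f \<in> Hom M x y"
  shows "fext f \<in> Hom M (frob x) (frob y)" "fext f \<cdot> frep x = frep y \<cdot> f"
proof -
  note x = frep[OF hom_obj(1)[OF assms]] and y = frep[OF hom_obj(2)[OF assms]]
  obtain h where "h \<in> Hom M (frob x) (frob y)" "h \<cdot> frep x = frep y \<cdot> f"
    using fibrantE[OF y(4) x(2,3,1) comp_hom[OF assms y(1)]] .
  then have "\<exists>f'. f' \<in> Hom M (frob (Src M f)) (frob (Tgt M f)) \<and>
     f' \<cdot> frep (Src M f) = frep (Tgt M f) \<cdot> f"
    using HomD[OF assms] by auto
  from someI_ex[OF this]
  show "fext f \<in> Hom M (frob x) (frob y)" "fext f \<cdot> frep x = frep y \<cdot> f"
    using HomD[OF assms] unfolding fext_def by auto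
qed

lemma fext_weq:
  assumes "w \<in> Weq M" "w \<in> Hom M x y"
  shows "fext w \<in> Weq M"
proof -
  note x = frep[OF hom_obj(1)[OF assms(2)]] and y = frep[OF hom_obj(2)[OF assms(2)]]
  have "frep y \<cdot> w \<in> Weq M" using weq_comp[OF assms(2) y(1) assms(1) y(3)] .
  then show ?thesis using weq_left[OF x(1) fext(1)[OF assms(2)] x(3)] fext(2)[OF assms(2)] by simp
qed

definition hclass :: "'a \<Rightarrow> 'a \<Rightarrow> 'b \<Rightarrow> 'b set" where
  "hclass x y g = {g'. homotopic x y g g'}"

lemma hclass_eq_iff:
  assumes "cofibrant x" "is_fibrant M y" "g \<in> Hom M x y"
  shows "hclass x y f = hclass x y g \<longleftrightarrow> homotopic x y f g"
proof
  assume "hclass x y f = hclass x y g"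
  then show "homotopic x y f g" using homotopic_refl[OF assms(3)] unfolding hclass_def by blast
next
  assume "homotopic x y f g"
  then show "hclass x y f = hclass x y g"
    unfolding hclass_def using homotopic_trans[OF assms(1,2)] homotopic_sym by blast
qed

text \<open>The union over all representatives avoids a choice; its members coincide when
  \<open>T\<close> is a homotopy class, which is the content of \<open>hact_hclass\<close>.\<close>

definition hact :: "'a \<Rightarrow> 'b \<Rightarrow> 'b set \<Rightarrow> 'b set" where
  "hact x f T = (\<Union>g\<in>T. hclass x (frob (Tgt M f)) (fext f \<cdot> g))"

lemma hact_hclass:
  assumes x: "cofibrant x" and f: "f \<in> Hom M y z" and g: "g \<in> Hom M x (frob y)"
  shows "hact x f (hclass x (frob y) g) = hclass x (frob z) (fext f \<cdot> g)"
proof -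
  note F = fext[OF f]
  have z: "is_fibrant M (frob z)" using frep(4) hom_obj[OF f] by blast
  have "hclass x (frob z) (fext f \<cdot> g') = hclass x (frob z) (fext f \<cdot> g)"
    if "g' \<in> hclass x (frob y) g" for g'
    using hclass_eq_iff[OF x z comp_hom[OF g F(1)]] homotopic_comp[OF homotopic_sym F(1)] that
    by (simp add: hclass_def)
  moreover have "hclass x (frob y) g \<noteq> {}" using homotopic_refl[OF g] by (auto simp: hclass_def)
  ultimately show ?thesis
    unfolding hact_def HomD(3)[OF f] by (rule SUP_eq_const[rotated])
qed

text \<open>This is the functor of homotopy classes from \<open>x\<close> into the fibrant
  replacement. Functoriality reduces to \<open>eq_on_tcof\<close>, and the two Whitehead lemmas give
  injectivity and surjectivity for weak equivalences.\<close>

lemma hact_inverting: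
  assumes x: "cofibrant x"
  shows "inverting_action M (Weq M) (\<lambda>y. hclass x (frob y) ` Hom M x (frob y)) (hact x)"
proof unfold_locales
  show "Weq M \<subseteq> Arr M" by (rule weq_arr)
next
  fix f y z e assume f: "f \<in> Hom M y z" and "e \<in> hclass x (frob y) ` Hom M x (frob y)"
  then show "hact x f e \<in> hclass x (frob z) ` Hom M x (frob z)"
    using hact_hclass[OF x f] comp_hom[OF _ fext(1)[OF f]] by auto
next
  fix y e assume y: "y \<in> Obj M" and "e \<in> hclass x (frob y) ` Hom M x (frob y)"
  then obtain g where g: "g \<in> Hom M x (frob y)" "e = hclass x (frob y) g" by blast
  note R = frep[OF y] and F = fext[OF ident_hom[OF y]]
  have "homotopic x (frob y) (fext (Ident M y) \<cdot> g) (Ident M (frob y) \<cdot> g)"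
    using eq_on_tcof[OF x R(4,1,2,3) F(1) ident_hom[OF fibrant_obj[OF R(4)]] _ g(1)] F(2)
      ident_left[OF R(1)] ident_right[OF R(1)] by simp
  then show "hact x (Ident M y) e = e"
    using hact_hclass[OF x ident_hom[OF y] g(1)] hclass_eq_iff[OF x R(4) g(1)] g ident_left[OF g(1)] by simp
next
  fix f h y z w e
  assume f: "f \<in> Hom M y z" and h: "h \<in> Hom M z w" and "e \<in> hclass x (frob y) ` Hom M x (frob y)"
  then obtain g where g: "g \<in> Hom M x (frob y)" "e = hclass x (frob y) g" by blast
  note F = fext[OF f] and H = fext[OF h] and FH = fext[OF comp_hom[OF f h]]
  note Y = frep[OF hom_obj(1)[OF f]] and Z = frep[OF hom_obj(2)[OF f]] and W = frep[OF hom_obj(2)[OF h]]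
  have "fext (h \<cdot> f) \<cdot> frep y = (fext h \<cdot> fext f) \<cdot> frep y"
    using FH(2) comp_assoc[OF Y(1) F(1) H(1)] F(2) comp_assoc[OF f Z(1) H(1)] H(2) comp_assoc[OF f h W(1)]
    by simp
  then have "homotopic x (frob w) (fext (h \<cdot> f) \<cdot> g) ((fext h \<cdot> fext f) \<cdot> g)"
    using eq_on_tcof[OF x W(4) Y(1,2,3) FH(1) comp_hom[OF F(1) H(1)] _ g(1)] by simp
  then have "hclass x (frob w) (fext (h \<cdot> f) \<cdot> g) = hclass x (frob w) (fext h \<cdot> (fext f \<cdot> g))"
    using hclass_eq_iff[OF x W(4) comp_hom[OF comp_hom[OF g(1) F(1)] H(1)]] comp_assoc[OF g(1) F(1) H(1)]
    by simp
  then show "hact x (h \<cdot> f) e = hact x h (hact x f e)"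
    using hact_hclass[OF x comp_hom[OF f h] g(1)] hact_hclass[OF x f g(1)]
      hact_hclass[OF x h comp_hom[OF g(1) F(1)]] g(2) by simp
next
  fix w y z assume w: "w \<in> Weq M" "w \<in> Hom M y z"
  note F = fext[OF w(2)] and Y = frep[OF hom_obj(1)[OF w(2)]] and Z = frep[OF hom_obj(2)[OF w(2)]]
  note V = fext_weq[OF w]
  let ?S = "hclass x (frob y) ` Hom M x (frob y)" and ?T = "hclass x (frob z) ` Hom M x (frob z)"
  have "inj_on (hact x w) ?S"
  proof (rule inj_onI)
    fix d e assume "d \<in> hclass x (frob y) ` Hom M x (frob y)" "e \<in> hclass x (frob y) ` Hom M x (frob y)"
      and eq: "hact x w d = hact x w e"
    then obtain g h where g: "g \<in> Hom M x (frob y)" "d = hclass x (frob y) g"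
      and h: "h \<in> Hom M x (frob y)" "e = hclass x (frob y) h" by blast
    have "homotopic x (frob z) (fext w \<cdot> g) (fext w \<cdot> h)"
      using eq hact_hclass[OF x w(2)] g h hclass_eq_iff[OF x Z(4) comp_hom[OF h(1) F(1)]] by simp
    then have "homotopic x (frob y) g h"
      using whitehead_inj[OF x Y(4) Z(4) F(1) V g(1) h(1)] by blast
    then show "d = e" using hclass_eq_iff[OF x Y(4) h(1)] g h by simp
  qed
  moreover have "hact x w ` ?S \<subseteq> ?T"
    using hact_hclass[OF x w(2)] comp_hom[OF _ F(1)] by auto
  moreover have "?T \<subseteq> hact x w ` ?S"
  proof
    fix e assume "e \<in> ?T"
    then obtain h where h: "h \<in> Hom M x (frob z)" "e = hclass x (frob z) h" by blast
    obtain g where g: "g \<in> Hom M x (frob y)" "homotopic x (frob z) (fext w \<cdot> g) h"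
      using whitehead_surj[OF x Y(4) Z(4) F(1) V h(1)] .
    then have "e = hact x w (hclass x (frob y) g)"
      using hact_hclass[OF x w(2) g(1)] iffD2[OF hclass_eq_iff[OF x Z(4) h(1)] g(2)] h by simp
    then show "e \<in> hact x w ` ?S" using g by blast
  qed
  ultimately show "bij_betw (hact x w) ?S ?T"
    unfolding bij_betw_def by blast
qed

text \<open>A Yoneda argument: equal arrows act equally on the class of \<open>frep x\<close>, which
  yields the composites of \<open>f\<close> and \<open>g\<close> with \<open>frep y\<close>. That
  weak equivalence between fibrant objects is then cancelled.\<close>

theorem ho_arr_eqD:
  assumes x: "cofibrant x" and y: "is_fibrant M y" and f: "f \<in> Hom M x y" and g: "g \<in> Hom M x y"
    and e: "ho_arr M f = ho_arr M g"
  shows "homotopic x y f g"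
proof -
  interpret A: inverting_action M "Weq M" "\<lambda>y. hclass x (frob y) ` Hom M x (frob y)" "hact x"
    using hact_inverting[OF x] .
  have xo: "x \<in> Obj M" using hom_obj f by blast
  note X = frep[OF xo] and Y = frep[OF fibrant_obj[OF y]]
  have "zz_eq M (Weq M) x y [Fwd f] [Fwd g]"
    using fraction_eq_iff[OF zz_single[OF f]] e ho_arr_eq[OF f] ho_arr_eq[OF g] by simp
  then have "hact x f (hclass x (frob x) (frep x)) = hact x g (hclass x (frob x) (frep x))"
    using A.zz_eq_zact X(1) by fastforce
  then have "hclass x (frob y) (frep y \<cdot> f) = hclass x (frob y) (frep y \<cdot> g)"
    using hact_hclass[OF x f X(1)] hact_hclass[OF x g X(1)] fext(2)[OF f] fext(2)[OF g] by simp
  then have "homotopic x (frob y) (frep y \<cdot> f) (frep y \<cdot> g)"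
    using hclass_eq_iff[OF x Y(4) comp_hom[OF g Y(1)]] by simp
  then show ?thesis
    using whitehead_inj[OF x y Y(4,1,3) f g] by simp
qed

theorem ho_arr_full:
  assumes x: "cofibrant x" and y: "is_fibrant M y" and \<phi>: "\<phi> \<in> Hom (ho M) x y"
  obtains f where "f \<in> Hom M x y" "\<phi> = ho_arr M f"
proof -
  \<comment> \<open>The invariant carried along the zigzag: the arrow reached so far, followed by
    fibrant replacement, is represented in \<open>M\<close>. Replacements are inserted because the
    intermediate objects of a zigzag need not be fibrant.\<close>
  have ex: "\<exists>g' \<in> Hom M x (frob z). ho_arr M (frep z) \<odot> (fraction M (Weq M) v s z \<odot> \<psi>) = ho_arr M g'"
    if "zigzag M (Weq M) v s z" "\<psi> \<in> Hom (ho M) x v" "g \<in> Hom M x (frob v)"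
      "ho_arr M (frep v) \<odot> \<psi> = ho_arr M g" for v s z \<psi> g
    using that
  proof (induction arbitrary: \<psi> g rule: zigzag.induct)
    case (zz_nil v)
    then have "fraction M (Weq M) v [] v \<odot> \<psi> = \<psi>"
      using ho.ident_left by (simp add: ho_def localization_simps)
    then show ?case using zz_nil by auto
  next
    case (zz_fwd f v u s z)
    note V = frep[OF hom_obj(1)[OF zz_fwd.hyps(1)]] and U = frep[OF hom_obj(2)[OF zz_fwd.hyps(1)]]
    note F = fext[OF zz_fwd.hyps(1)]
    note \<psi> = zz_fwd.prems(1) and g = zz_fwd.prems(2) and f = zz_fwd.hyps(1)
    have S: "fraction M (Weq M) u s z \<in> Hom (ho M) u z"
      using zz_fwd.hyps(2) unfolding ho_def by (auto simp: Hom_localization)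
    have e: "fraction M (Weq M) v (Fwd f # s) z = fraction M (Weq M) u s z \<odot> ho_arr M f"
      using comp_fraction[OF zz_single[OF f] zz_fwd.hyps(2)] ho_arr_eq[OF f] by (simp add: ho_def)
    have "ho_arr M (frep u) \<odot> (ho_arr M f \<odot> \<psi>) = ho_arr M (fext f \<cdot> g)"
      using ho.comp_cancel[OF _ ho_arr_hom[OF f] ho_arr_hom[OF U(1)] ho_arr_hom[OF V(1)] ho_arr_hom[OF F(1)] \<psi>]
        ho_arr_comp[OF f U(1)] ho_arr_comp[OF V(1) F(1)] F(2) zz_fwd.prems(3) ho_arr_comp[OF g F(1)] by simp
    then show ?case
      using zz_fwd.IH[OF ho.comp_hom[OF \<psi> ho_arr_hom[OF f]] comp_hom[OF g F(1)]]
        ho.comp_assoc[OF \<psi> ho_arr_hom[OF f] S] e by simp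
  next
    case (zz_bwd w u v s z)
    note V = frep[OF hom_obj(2)[OF zz_bwd.hyps(2)]] and U = frep[OF hom_obj(1)[OF zz_bwd.hyps(2)]]
    note F = fext[OF zz_bwd.hyps(2)]
    note \<psi> = zz_bwd.prems(1) and g = zz_bwd.prems(2) and w = zz_bwd.hyps(1,2)
    note I = ho_inv[OF w] and FW = fext_weq[OF w]
    have S: "fraction M (Weq M) u s z \<in> Hom (ho M) u z"
      using zz_bwd.hyps(3) unfolding ho_def by (auto simp: Hom_localization)
    have b: "zigzag M (Weq M) v [Bwd w] u"
      using w by (auto intro: zigzag.zz_bwd zigzag.zz_nil hom_obj)
    have e: "fraction M (Weq M) v (Bwd w # s) z = fraction M (Weq M) u s z \<odot> ho_inv w"
      using comp_fraction[OF b zz_bwd.hyps(3)] HomD[OF w(2)] by (simp add: ho_def ho_inv_def)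
    \<comment> \<open>A backward step is undone up to homotopy: \<open>g\<close> lifts through the
      weak equivalence \<open>fext w\<close> of fibrant objects.\<close>
    obtain g' where g': "g' \<in> Hom M x (frob u)" "homotopic x (frob v) (fext w \<cdot> g') g"
      using whitehead_surj[OF x U(4) V(4) F(1) FW g] .
    have I\<psi>: "ho_inv w \<odot> \<psi> \<in> Hom (ho M) x u" using ho.comp_hom[OF \<psi> I(1)] .
    have "ho_arr M (fext w) \<odot> (ho_arr M (frep u) \<odot> (ho_inv w \<odot> \<psi>))
        = ho_arr M (frep v) \<odot> (ho_arr M w \<odot> (ho_inv w \<odot> \<psi>))"
      using ho.comp_cancel[OF _ ho_arr_hom[OF U(1)] ho_arr_hom[OF F(1)] ho_arr_hom[OF w(2)] ho_arr_hom[OF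
          V(1)] I\<psi>]
        F(2) ho_arr_comp[OF U(1) F(1)] ho_arr_comp[OF w(2) V(1)] by simp
    also have "\<dots> = ho_arr M g"
      using ho.comp_cancel1[OF I(3) I(1) ho_arr_hom[OF w(2)] \<psi>] ho.ident_left[OF \<psi>] zz_bwd.prems(3) by simp
    also have "\<dots> = ho_arr M (fext w) \<odot> ho_arr M g'"
      using homotopic_ho_arr[OF g'(2)] ho_arr_comp[OF g'(1) F(1)] by simp
    finally have "ho_arr M (frep u) \<odot> (ho_inv w \<odot> \<psi>) = ho_arr M g'"
      using ho_cancel_left[OF FW F(1)] ho.comp_hom[OF I\<psi> ho_arr_hom[OF U(1)]] ho_arr_hom[OF g'(1)] by blast
    then show ?case
      using zz_bwd.IH[OF I\<psi> g'(1)] ho.comp_assoc[OF \<psi> I(1) S] e by simp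
  qed
  have xo: "x \<in> Obj M" using x by (simp add: cofibrant_def)
  note X = frep[OF xo] and Y = frep[OF fibrant_obj[OF y]]
  obtain s where s: "zigzag M (Weq M) x s y" "\<phi> = fraction M (Weq M) x s y"
    using \<phi> unfolding ho_def by (auto simp: Hom_localization)
  have "Ident (ho M) x \<in> Hom (ho M) x x" using ho.ident_hom xo by simp
  then obtain g where g: "g \<in> Hom M x (frob y)" "ho_arr M (frep y) \<odot> \<phi> = ho_arr M g"
    using ex[OF s(1) _ X(1)] ho.ident_right[OF ho_arr_hom[OF X(1)]] ho.ident_right[OF \<phi>]
    unfolding s(2)[symmetric] by metis
  obtain f where f: "f \<in> Hom M x y" "homotopic x (frob y) (frep y \<cdot> f) g"
    using whitehead_surj[OF x y Y(4,1,3) g(1)] .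
  have "ho_arr M (frep y) \<odot> \<phi> = ho_arr M (frep y) \<odot> ho_arr M f"
    using g(2) homotopic_ho_arr[OF f(2)] ho_arr_comp[OF f(1) Y(1)] by simp
  then show thesis
    using that[OF f(1)] ho_cancel_left[OF Y(3,1) \<phi> ho_arr_hom[OF f(1)]] by simp
qed

end

section \<open>Fibre products over contractible objects\<close>

context pointed_model_category
begin

lemma iso_weq:
  assumes f: "f \<in> Hom M x y" and g: "g \<in> Hom M y x" and gf: "g \<cdot> f = Ident M x" and fg: "f \<cdot> g = Ident M y"
  shows "f \<in> Weq M"
proof (rule tfibI)
  show "f \<in> Arr M" using HomD(1)[OF f] .
  fix i assume "i \<in> Cof M"
  note ih = cof_hom[OF this]
  show "has_lift M i f"
    unfolding has_lift_def HomD[OF f]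
  proof (intro ballI impI)
    fix u v assume u: "u \<in> Hom M (Src M i) x" and v: "v \<in> Hom M (Tgt M i) y" and e: "f \<cdot> u = v \<cdot> i"
    have "(g \<cdot> v) \<cdot> i = u"
      using comp_assoc[OF ih v g] comp_cancel1[OF gf f g u] ident_left[OF u] e by simp
    moreover have "f \<cdot> (g \<cdot> v) = v" using comp_cancel1[OF fg g f v] ident_left[OF v] by simp
    ultimately show "\<exists>h\<in>Hom M (Tgt M i) x. h \<cdot> i = u \<and> f \<cdot> h = v" using comp_hom[OF v g] by blast
  qed
qed

text \<open>Presentations of loop objects come with a weak equivalence from some zero object. Zero
  objects are isomorphic, so contractibility can be expressed by the arrow to the fixed
  \<open>z0\<close>.\<close>

lemma zero_weq_contractible:
  assumes z: "is_zero M z" and a: "a \<in> Hom M z x" "a \<in> Weq M" and t: "t \<in> Hom M x z0"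
  shows "t \<in> Weq M"
proof -
  obtain g where g: "g \<in> Hom M z0 z" using from_zero[OF zero_z0] hom_obj[OF a(1)] by blast
  have ta: "t \<cdot> a \<in> Hom M z z0" using comp_hom[OF a(1) t] .
  have "t \<cdot> a \<in> Weq M"
    using iso_weq[OF ta g] from_zero_unique[OF z comp_hom[OF ta g]] from_zero_unique[OF zero_z0
        comp_hom[OF g ta]]
      ident_hom hom_obj[OF ta] by blast
  then show ?thesis using weq_left[OF a(1) t a(2)] by blast
qed

text \<open>
  In the next two lemmas the base \<open>b\<close> is fibrant and weakly contractible, so that the fibre product
  over \<open>b\<close> is a product in the homotopy category.
\<close>

lemma contractible_pullback_ex:
  assumes b: "is_fibrant M b" and t: "t \<in> Hom M b z0" "t \<in> Weq M"
    and e: "e \<in> Hom M x b" "e \<in> Fib M" and e': "e' \<in> Hom M x' b" "e' \<in> Fib M"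
    and pb: "is_pullback M e e' q q'"
    and \<phi>: "\<phi> \<in> Hom (ho M) a x" "\<phi>' \<in> Hom (ho M) a x'"
  obtains \<psi> where "\<psi> \<in> Hom (ho M) a (Src M q)" "ho_arr M q \<odot> \<psi> = \<phi>" "ho_arr M q' \<odot> \<psi> = \<phi>'"
proof -
  have ao: "a \<in> Obj M" using ho.hom_obj[OF \<phi>(1)] by simp
  obtain d p where p: "p \<in> Hom M d a" "p \<in> Fib M" "p \<in> Weq M" and d: "cofibrant d"
    using cofibrant_replacement[OF ao] .
  note hp = ho_arr_hom[OF p(1)] and I = ho_inv[OF p(3,1)]
  have fib: "is_fibrant M x" "is_fibrant M x'" using fib_fibrant e e' b by blast+
  have q: "q \<in> Hom M (Src M q) x" "q' \<in> Hom M (Src M q) x'"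
    using is_pullbackD[OF pb] HomD[OF e(1)] HomD[OF e'(1)] by (auto simp: Hom_def)
  obtain f where f: "f \<in> Hom M d x" "\<phi> \<odot> ho_arr M p = ho_arr M f"
    using ho_arr_full[OF d fib(1) ho.comp_hom[OF hp \<phi>(1)]] .
  obtain g where g: "g \<in> Hom M d x'" "\<phi>' \<odot> ho_arr M p = ho_arr M g"
    using ho_arr_full[OF d fib(2) ho.comp_hom[OF hp \<phi>(2)]] .
  note eg = comp_hom[OF g(1) e'(1)] and ef = comp_hom[OF f(1) e(1)]
  have "t \<cdot> (e' \<cdot> g) = t \<cdot> (e \<cdot> f)"
    using to_z0_unique[OF comp_hom[OF eg t(1)] comp_hom[OF ef t(1)]] .
  \<comment> \<open>Because \<open>b\<close> is contractible, arrows into it from \<open>d\<close>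
    are homotopic.\<close>
  then have "homotopic d b (e' \<cdot> g) (e \<cdot> f)"
    using whitehead_inj[OF d b z0_fibrant t eg ef] homotopic_refl[OF comp_hom[OF ef t(1)]] by simp
  moreover obtain c i j s where gc: "good_cylinder d c i j s" using good_cylinder_exists[OF d] .
  ultimately obtain H where H: "H \<in> Hom M c b" "H \<cdot> i = e' \<cdot> g" "H \<cdot> j = e \<cdot> f"
    using homotopic_good[OF _ gc b] by metis
  have "cylinder d c i j s" and ic: "i \<in> Cof M" using gc by (simp_all add: good_cylinder_def)
  note D = cylinderD[OF this(1)]
  \<comment> \<open>Homotopy lifting along the fibration \<open>e'\<close> moves \<open>g\<close> to
    an arrow that matches \<open>f\<close> strictly over \<open>b\<close> and is still the same
    arrow in \<open>ho M\<close>.\<close>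
  obtain K where K: "K \<in> Hom M c x'" "K \<cdot> i = g" "e' \<cdot> K = H"
    using has_liftE[OF lift_fib[OF ic D(7) e'(2)] D(1) e'(1) g(1) H(1)] H(2) by metis
  note g' = comp_hom[OF D(2) K(1)]
  have "e \<cdot> f = e' \<cdot> (K \<cdot> j)" using comp_cancel1[OF K(3,1) e'(1) D(2)] H(3) by simp
  then obtain h where h: "h \<in> Hom M d (Src M q)" "q \<cdot> h = f" "q' \<cdot> h = K \<cdot> j"
    using is_pullback_lift[OF pb, of f d "K \<cdot> j"] f(1) g' HomD[OF e(1)] HomD[OF e'(1)] by metis
  let ?\<psi> = "ho_arr M h \<odot> ho_inv p"
  note hh = ho_arr_hom[OF h(1)]
  have fin: "ho_arr M r \<odot> ?\<psi> = \<chi>"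
    if r: "r \<in> Hom M (Src M q) y" "\<chi> \<in> Hom (ho M) a y" "ho_arr M (r \<cdot> h) = \<chi> \<odot> ho_arr M p" for r y \<chi>
  proof -
    have "ho_arr M r \<odot> ?\<psi> = (\<chi> \<odot> ho_arr M p) \<odot> ho_inv p"
      using ho.comp_assoc[OF I(1) hh ho_arr_hom[OF r(1)]] ho_arr_comp[OF h(1) r(1)] r(3) by simp
    then show ?thesis using ho.comp_assoc[OF I(1) hp r(2)] I(3) ho.ident_right[OF r(2)] by simp
  qed
  show thesis
  proof (rule that[OF ho.comp_hom[OF I(1) hh]])
    show "ho_arr M q \<odot> ?\<psi> = \<phi>" using fin[OF q(1) \<phi>(1)] h(2) f(2) by simp
    have "ho_arr M (K \<cdot> j) = ho_arr M g" using homotopic_ho_arr[OF homotopicI[OF gc K(1)]] K(2) by simp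
    then show "ho_arr M q' \<odot> ?\<psi> = \<phi>'" using fin[OF q(2) \<phi>(2)] h(3) g(2) by simp
  qed
qed

lemma contractible_pullback_unique:
  assumes b: "is_fibrant M b" and t: "t \<in> Hom M b z0" "t \<in> Weq M"
    and e: "e \<in> Hom M x b" "e \<in> Fib M" and e': "e' \<in> Hom M x' b" "e' \<in> Fib M"
    and pb: "is_pullback M e e' q q'"
    and \<phi>: "\<phi> \<in> Hom (ho M) a (Src M q)" "\<psi> \<in> Hom (ho M) a (Src M q)"
    and eq: "ho_arr M q \<odot> \<phi> = ho_arr M q \<odot> \<psi>" "ho_arr M q' \<odot> \<phi> = ho_arr M q' \<odot> \<psi>"
  shows "\<phi> = \<psi>"
proof -
  have ao: "a \<in> Obj M" using ho.hom_obj[OF \<phi>(1)] by simp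
  obtain d p where p: "p \<in> Hom M d a" "p \<in> Fib M" "p \<in> Weq M" and d: "cofibrant d"
    using cofibrant_replacement[OF ao] .
  note hp = ho_arr_hom[OF p(1)]
  have fib: "is_fibrant M x" "is_fibrant M x'" using fib_fibrant e e' b by blast+
  have q: "q \<in> Hom M (Src M q) x" "q' \<in> Hom M (Src M q) x'"
    using is_pullbackD[OF pb] HomD[OF e(1)] HomD[OF e'(1)] by (auto simp: Hom_def)
  have sq: "e \<cdot> q = e' \<cdot> q'" using is_pullbackD(1)[OF pb] .
  have qf: "q \<in> Fib M" using fib_pullback[OF is_pullback_sym[OF pb] e'(2)] .
  have ef: "is_fibrant M (Src M q)" using fib_fibrant[OF qf q(1) fib(1)] .
  obtain u where u: "u \<in> Hom M d (Src M q)" "\<phi> \<odot> ho_arr M p = ho_arr M u"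
    using ho_arr_full[OF d ef ho.comp_hom[OF hp \<phi>(1)]] .
  obtain v where v: "v \<in> Hom M d (Src M q)" "\<psi> \<odot> ho_arr M p = ho_arr M v"
    using ho_arr_full[OF d ef ho.comp_hom[OF hp \<phi>(2)]] .
  have hr: "ho_arr M (r \<cdot> u) = ho_arr M (r \<cdot> v)"
    if "r \<in> Hom M (Src M q) y" "ho_arr M r \<odot> \<phi> = ho_arr M r \<odot> \<psi>" for r y
    using ho_arr_comp[OF u(1) that(1)] ho_arr_comp[OF v(1) that(1)] u(2) v(2) that(2)
      ho.comp_assoc[OF hp \<phi>(1) ho_arr_hom[OF that(1)]] ho.comp_assoc[OF hp \<phi>(2) ho_arr_hom[OF that(1)]]
    by simp
  obtain c i j s where gc: "good_cylinder d c i j s" using good_cylinder_exists[OF d] .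
  have "cylinder d c i j s" and ic: "i \<in> Cof M" using gc by (simp_all add: good_cylinder_def)
  note D = cylinderD[OF this(1)]
  have "homotopic d x (q \<cdot> v) (q \<cdot> u)"
    using ho_arr_eqD[OF d fib(1) comp_hom[OF v(1) q(1)] comp_hom[OF u(1) q(1)]] hr[OF q(1) eq(1)] by simp
  then obtain H where H: "H \<in> Hom M c x" "H \<cdot> i = q \<cdot> v" "H \<cdot> j = q \<cdot> u"
    using homotopic_good[OF _ gc fib(1)] by metis
  \<comment> \<open>\<open>v\<close> is moved within its homotopy class until its first component
    agrees strictly with that of \<open>u\<close>.\<close>
  obtain K where K: "K \<in> Hom M c (Src M q)" "K \<cdot> i = v" "q \<cdot> K = H"
    using has_liftE[OF lift_fib[OF ic D(7) qf] D(1) q(1) v(1) H(1)] H(2) by metis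
  define v' where "v' = K \<cdot> j"
  have v': "v' \<in> Hom M d (Src M q)" "q \<cdot> v' = q \<cdot> u"
    using comp_hom[OF D(2) K(1)] comp_cancel1[OF K(3,1) q(1) D(2)] H(3) by (simp_all add: v'_def)
  have hv': "ho_arr M v' = ho_arr M v"
    using homotopic_ho_arr[OF homotopicI[OF gc K(1)]] K(2) by (simp add: v'_def)
  define y where "y = q' \<cdot> u"
  define y' where "y' = q' \<cdot> v'"
  define k where "k = e \<cdot> (q \<cdot> u)"
  have y: "y \<in> Hom M d x'" "y' \<in> Hom M d x'" "k \<in> Hom M d b"
    using comp_hom[OF u(1) q(2)] comp_hom[OF v'(1) q(2)] comp_hom[OF comp_hom[OF u(1) q(1)] e(1)]
    by (simp_all add: y_def y'_def k_def)
  have ey: "e' \<cdot> y = k" "e' \<cdot> y' = k"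
    using comp_cancel[OF sq q(1) e(1) q(2) e'(1) u(1)] comp_cancel[OF sq q(1) e(1) q(2) e'(1) v'(1)] v'(2)
    by (simp_all add: y_def y'_def k_def)
  have "ho_arr M y = ho_arr M y'"
    using hr[OF q(2) eq(2)] ho_arr_comp[OF v'(1) q(2)] ho_arr_comp[OF v(1) q(2)] hv'
    by (simp add: y_def y'_def)
  then obtain H2 where H2: "H2 \<in> Hom M c x'" "H2 \<cdot> i = y" "H2 \<cdot> j = y'"
    using homotopic_good[OF ho_arr_eqD[OF d fib(2) y(1,2)] gc fib(2)] by metis
  obtain f g p1 p2 where f: "f \<in> Hom M b z0" "g \<in> Hom M x' z0" and pp: "is_pullback M f g p1 p2"
    and p1: "p1 \<in> Hom M (Src M p1) b" and p2: "p2 \<in> Hom M (Src M p1) x'"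
    and ex: "\<And>v a b'. a \<in> Hom M v b \<Longrightarrow> b' \<in> Hom M v x' \<Longrightarrow> \<exists>h \<in> Hom M v (Src M p1). p1 \<cdot> h = a \<and> p2 \<cdot> h = b'"
    and un: "\<And>v h h'. h \<in> Hom M v (Src M p1) \<Longrightarrow> h' \<in> Hom M v (Src M p1) \<Longrightarrow> p1 \<cdot> h = p1 \<cdot> h' \<Longrightarrow> p2 \<cdot> h = p2 \<cdot>
        h' \<Longrightarrow> h = h'"
    by (rule productE[OF fibrant_obj[OF b] fibrant_obj[OF fib(2)]]) (rule that)
  have "f = t" using to_z0_unique[OF f(1) t(1)] .
  then have p2w: "p2 \<in> Weq M" using tfib_pullback(2)[OF pp] to_z0_fib[OF b f(1)] t(2) by simp
  have x'o: "x' \<in> Obj M" using fibrant_obj[OF fib(2)] .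
  \<comment> \<open>The homotopy \<open>H2\<close> between the second components need not lie over
    \<open>b\<close>. The graph \<open>w\<close> of \<open>e'\<close> is a weak equivalence because
    \<open>b\<close> is contractible, so \<open>H2\<close>, paired with the constant homotopy at
    \<open>k\<close>, can be replaced by a homotopy \<open>K2\<close> that is stationary over
    \<open>b\<close>.\<close>
  obtain w where w: "w \<in> Hom M x' (Src M p1)" "p1 \<cdot> w = e'" "p2 \<cdot> w = Ident M x'"
    using ex[OF e'(1) ident_hom[OF x'o]] by blast
  have ww: "w \<in> Weq M" using section_weq[OF w(1) p2 w(3)] p2w by simp
  note ks = comp_hom[OF D(3) y(3)]
  obtain G where G: "G \<in> Hom M c (Src M p1)" "p1 \<cdot> G = k \<cdot> s" "p2 \<cdot> G = H2"
    using ex[OF ks H2(1)] by blast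
  have Gend: "G \<cdot> l = w \<cdot> y0" if l: "l \<in> Hom M d c" "s \<cdot> l = Ident M d" and y0: "y0 \<in> Hom M d x'" "e' \<cdot>
      y0 = k" "H2 \<cdot> l = y0" for l y0
  proof (rule un[OF comp_hom[OF l(1) G(1)] comp_hom[OF y0(1) w(1)]])
    show "p1 \<cdot> G \<cdot> l = p1 \<cdot> w \<cdot> y0"
      using comp_cancel1[OF G(2,1) p1 l(1)] comp_cancel1[OF w(2,1) p1 y0(1)] comp_assoc[OF l(1) D(3) y(3)] l(2)
        ident_right[OF y(3)] y0(2) by simp
    show "p2 \<cdot> G \<cdot> l = p2 \<cdot> w \<cdot> y0"
      using comp_cancel1[OF G(3,1) p2 l(1)] comp_cancel1[OF w(3,1) p2 y0(1)] ident_left[OF y0(1)] y0(3) by simp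
  qed
  obtain K2 where K2: "K2 \<in> Hom M c x'" "K2 \<cdot> i = y" "K2 \<cdot> j = y'" "e' \<cdot> K2 = p1 \<cdot> G"
    using whitehead_inj_over[OF gc e' w(1) ww p1 w(2) y(1,2) G(1) Gend[OF D(1,5) y(1) ey(1) H2(2)]
        Gend[OF D(2,6) y(2) ey(2) H2(3)]] .
  note qu = comp_hom[OF u(1) q(1)]
  have "e \<cdot> ((q \<cdot> u) \<cdot> s) = e' \<cdot> K2" using comp_assoc[OF D(3) qu e(1)] K2(4) G(2) by (simp add: k_def)
  then obtain L where L: "L \<in> Hom M c (Src M q)" "q \<cdot> L = (q \<cdot> u) \<cdot> s" "q' \<cdot> L = K2"
    using is_pullback_lift[OF pb, of "(q \<cdot> u) \<cdot> s" c K2] comp_hom[OF D(3) qu] K2(1) HomD[OF e(1)] HomD[OF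
        e'(1)] by metis
  have Lend: "L \<cdot> l = v0" if l: "l \<in> Hom M d c" "s \<cdot> l = Ident M d" and v0: "v0 \<in> Hom M d (Src M q)" "q \<cdot>
      v0 = q \<cdot> u" "K2 \<cdot> l = q' \<cdot> v0" for l v0
  proof (rule is_pullback_unique[OF pb comp_hom[OF l(1) L(1)] v0(1)])
    show "q \<cdot> L \<cdot> l = q \<cdot> v0"
      using comp_cancel1[OF L(2,1) q(1) l(1)] comp_assoc[OF l(1) D(3) qu] l(2) ident_right[OF qu] v0(2) by simp
    show "q' \<cdot> L \<cdot> l = q' \<cdot> v0"
      using comp_cancel1[OF L(3,1) q(2) l(1)] v0(3) by simp
  qed
  have "L \<cdot> i = u" using Lend[OF D(1,5) u(1) refl] K2(2) by (simp add: y_def)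
  moreover have "L \<cdot> j = v'" using Lend[OF D(2,6) v'] K2(3) by (simp add: y'_def)
  ultimately have "ho_arr M u = ho_arr M v"
    using homotopic_ho_arr[OF homotopicI[OF gc L(1)]] hv' by simp
  then show ?thesis
    using ho_cancel_right[OF p(3,1) \<phi>] u(2) v(2) by simp
qed

section \<open>Presentations of the loop object\<close>

lemma loop_objectD:
  assumes "is_loop_object M y j p p r r'"
  shows "p \<in> Fib M" "p \<in> Hom M (Src M p) (Tgt M p)" "is_fibrant M (Tgt M p)" "j \<in> Weq M"
    "j \<in> Hom M y (Tgt M p)" "is_pullback M p p r r'"
    "r \<in> Hom M (Src M r) (Src M p)" "r' \<in> Hom M (Src M r) (Src M p)" "p \<cdot> r = p \<cdot> r'"
    "\<exists>z a. is_zero M z \<and> a \<in> Hom M z (Src M p) \<and> a \<in> Weq M"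
    "\<exists>t. t \<in> Hom M (Src M p) z0 \<and> t \<in> Weq M" "is_fibrant M (Src M p)"
    "r \<in> Fib M" "r' \<in> Fib M" "is_fibrant M (Src M r)"
proof -
  obtain z z' f g where z: "is_zero M z" "f \<in> Hom M z y" "g \<in> Hom M z' y"
    and hp: "is_homotopy_pullback M f g j p p r r'"
    using assms unfolding is_loop_object_def by blast
  show p: "p \<in> Fib M" "is_fibrant M (Tgt M p)" "j \<in> Weq M" "is_pullback M p p r r'" and j: "j \<in> Hom M y
      (Tgt M p)"
    using hp z HomD[OF z(2)] by (auto simp: is_homotopy_pullback_def)
  show ph: "p \<in> Hom M (Src M p) (Tgt M p)" using fib_hom[OF p(1)] .
  show r: "r \<in> Hom M (Src M r) (Src M p)" "r' \<in> Hom M (Src M r) (Src M p)" "p \<cdot> r = p \<cdot> r'"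
    using is_pullbackD[OF p(4)] by (auto simp: Hom_def)
  obtain a where a: "a \<in> Hom M z (Src M p)" "a \<in> Weq M"
    using hp HomD[OF z(2)] unfolding is_homotopy_pullback_def by auto
  then show "\<exists>z a. is_zero M z \<and> a \<in> Hom M z (Src M p) \<and> a \<in> Weq M" using z(1) by blast
  show pf: "is_fibrant M (Src M p)" using fib_fibrant[OF p(1) ph p(2)] .
  show "\<exists>t. t \<in> Hom M (Src M p) z0 \<and> t \<in> Weq M"
    using to_z0[OF fibrant_obj[OF pf]] zero_weq_contractible[OF z(1) a] by blast
  show rf: "r' \<in> Fib M" "r \<in> Fib M" using fib_pullback[OF p(4,1)] fib_pullback[OF is_pullback_sym[OF
      p(4)] p(1)] .
  show "is_fibrant M (Src M r)" using fib_fibrant[OF rf(2) r(1) pf] .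
qed

lemma loop_objectI:
  assumes z: "is_zero M z" and a: "a \<in> Hom M z e" "a \<in> Weq M" and p: "p \<in> Hom M e b" "p \<in> Fib M"
      "is_fibrant M b"
    and j: "j \<in> Hom M y b" "j \<in> Weq M" and pb: "is_pullback M p p r r'"
  shows "is_loop_object M y j p p r r'"
proof -
  obtain f where f: "f \<in> Hom M z y" using from_zero[OF z] hom_obj[OF j(1)] by blast
  have "p \<cdot> a = j \<cdot> f" using from_zero_unique[OF z comp_hom[OF a(1) p(1)] comp_hom[OF f j(1)]] .
  then have "is_homotopy_pullback M f f j p p r r'"
    unfolding is_homotopy_pullback_def using assms f HomD[OF f] HomD[OF p(1)] by auto
  then show ?thesis unfolding is_loop_object_def using z f by blast
qed

text \<open>Such a presentation admits a map to every presentation whose two legs are equal: the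
  cofibration \<open>j\<close> allows extension over the base, and the trivial cofibration from
  \<open>z0\<close> allows lifting to the path object. Comparisons pass through one of these, since
  strict maps between arbitrary presentations need not exist.\<close>

definition cofibrant_loop_object :: "'a \<Rightarrow> 'b \<Rightarrow> 'b \<Rightarrow> 'b \<Rightarrow> 'b \<Rightarrow> bool" where
  "cofibrant_loop_object y j p r r' \<longleftrightarrow> is_loop_object M y j p p r r' \<and> j \<in> Cof M \<and>
     (\<exists>a \<in> Hom M z0 (Src M p). a \<in> Cof M \<and> a \<in> Weq M)"

lemma cofibrant_loop_object_exists:
  assumes "y \<in> Obj M"
  obtains j p r r' where "cofibrant_loop_object y j p r r'"
proof -
  obtain b j where j: "j \<in> Hom M y b" "j \<in> Cof M" "j \<in> Weq M" and b: "is_fibrant M b"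
    using fibrant_replacement[OF assms] .
  obtain f where f: "f \<in> Hom M z0 b" using from_zero[OF zero_z0 fibrant_obj[OF b]] by blast
  obtain e a p where a: "a \<in> Hom M z0 e" "p \<in> Hom M e b" "a \<in> Cof M" "a \<in> Weq M" "p \<in> Fib M"
    using factor_tcof_fib[OF f] by metis
  obtain l r r' where "is_pullback M p p r r'" using pullbackE[OF finite_limits a(2,2)] by metis
  then show thesis
    using that loop_objectI[OF zero_z0 a(1,4,2,5) b j(1,3)] j(2) a HomD[OF a(2)]
    unfolding cofibrant_loop_object_def by metis
qed

lemma cofibrant_loop_object_map:
  assumes U: "cofibrant_loop_object y j p r r'" and f: "f \<in> Hom M y y'" and L: "is_loop_object M y' k s s m m'"
  obtains g u l where "g \<in> Hom M (Tgt M j) (Tgt M k)" "u \<in> Hom M (Src M p) (Src M s)" "l \<in> Hom M (Src M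
      r) (Src M m)"
    "g \<cdot> j = k \<cdot> f" "s \<cdot> u = g \<cdot> p" "m \<cdot> l = u \<cdot> r" "m' \<cdot> l = u \<cdot> r'"
proof -
  have L1: "is_loop_object M y j p p r r'" and jc: "j \<in> Cof M"
    using U by (simp_all add: cofibrant_loop_object_def)
  obtain a where a: "a \<in> Hom M z0 (Src M p)" "a \<in> Cof M" "a \<in> Weq M"
    using U by (auto simp: cofibrant_loop_object_def)
  note D = loop_objectD[OF L1] and E = loop_objectD[OF L]
  obtain g where g: "g \<in> Hom M (Tgt M p) (Tgt M s)" "g \<cdot> j = k \<cdot> f"
    using fibrantE[OF E(3) jc D(4,5) comp_hom[OF f E(5)]] .
  obtain v where v: "v \<in> Hom M z0 (Src M s)" using from_zero[OF zero_z0] fibrant_obj[OF E(12)] by blast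
  note gp = comp_hom[OF D(2) g(1)]
  have "s \<cdot> v = (g \<cdot> p) \<cdot> a" using from_zero_unique[OF zero_z0 comp_hom[OF v E(2)] comp_hom[OF a(1) gp]] .
  then obtain u where u: "u \<in> Hom M (Src M p) (Src M s)" "s \<cdot> u = g \<cdot> p"
    using has_liftE[OF lift_fib[OF a(2,3) E(1)] a(1) E(2) v gp] by metis
  have "s \<cdot> (u \<cdot> r) = s \<cdot> (u \<cdot> r')"
    using comp_cancel[OF u(2) u(1) E(2) D(2) g(1) D(7)] comp_cancel[OF u(2) u(1) E(2) D(2) g(1) D(8)]
        D(9) by simp
  then obtain l where l: "l \<in> Hom M (Src M r) (Src M m)" "m \<cdot> l = u \<cdot> r" "m' \<cdot> l = u \<cdot> r'"
    using is_pullback_lift[OF E(6) comp_hom[OF D(7) u(1)] comp_hom[OF D(8) u(1)]] by blast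
  show thesis
    using that[OF _ u(1) l(1) g(2) u(2) l(2,3)] g(1) HomD[OF D(5)] HomD[OF E(5)] by simp
qed

definition loop_triple :: "'b \<Rightarrow> 'b \<Rightarrow> 'b \<Rightarrow> 'b \<Rightarrow> 'b \<Rightarrow> bool" where
  "loop_triple r0 r1 q01 q12 q02 \<longleftrightarrow> is_pullback M r1 r0 q01 q12 \<and> q02 \<in> Hom M (Src M q01) (Src M r0) \<and>
     r0 \<cdot> q02 = r0 \<cdot> q01 \<and> r1 \<cdot> q02 = r1 \<cdot> q12"

text \<open>The condition under the definite description of \<open>loop_mult\<close>, for a fixed
  presentation and with \<open>a\<close>, \<open>b\<close>, \<open>c\<close> read as arrows into its
  pullback. As a relation it can be shown total and single-valued before the description is
  evaluated.\<close>

definition loop_rel :: "'a \<Rightarrow> 'b \<Rightarrow> 'b \<Rightarrow> ('a, 'b) fraction \<Rightarrow> ('a, 'b) fraction \<Rightarrow> ('a, 'b) fraction \<Rightarrow> bool" where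
  "loop_rel A r0 r1 a b c \<longleftrightarrow> (\<exists>q01 q12 q02 t. loop_triple r0 r1 q01 q12 q02 \<and> t \<in> Hom (ho M) A (Src M q01) \<and>
     a = ho_arr M q01 \<odot> t \<and> b = ho_arr M q12 \<odot> t \<and> c = ho_arr M q02 \<odot> t)"

lemma loop_tripleD:
  assumes L: "is_loop_object M y j p p r0 r1" and T: "loop_triple r0 r1 q01 q12 q02"
  shows "is_pullback M r1 r0 q01 q12" "q01 \<in> Hom M (Src M q01) (Src M r0)" "q12 \<in> Hom M (Src M q01) (Src M r0)"
    "q02 \<in> Hom M (Src M q01) (Src M r0)" "r0 \<cdot> q02 = r0 \<cdot> q01" "r1 \<cdot> q02 = r1 \<cdot> q12" "r1 \<cdot> q01 = r0 \<cdot> q12"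
proof -
  note D = loop_objectD[OF L]
  have pb: "is_pullback M r1 r0 q01 q12" using T by (simp add: loop_triple_def)
  then show "is_pullback M r1 r0 q01 q12" "r1 \<cdot> q01 = r0 \<cdot> q12" using is_pullbackD(1)[OF pb] by blast+
  show "q01 \<in> Hom M (Src M q01) (Src M r0)" "q12 \<in> Hom M (Src M q01) (Src M r0)"
    using is_pullbackD[OF pb] HomD[OF D(8)] by (auto simp: Hom_def)
  show "q02 \<in> Hom M (Src M q01) (Src M r0)" "r0 \<cdot> q02 = r0 \<cdot> q01" "r1 \<cdot> q02 = r1 \<cdot> q12"
    using T by (simp_all add: loop_triple_def)
qed

lemma loop_triple_exists:
  assumes L: "is_loop_object M y j p p r0 r1"
  obtains q01 q12 q02 where "loop_triple r0 r1 q01 q12 q02"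
proof -
  note D = loop_objectD[OF L]
  obtain d q01 q12 where pb: "is_pullback M r1 r0 q01 q12" and q: "q01 \<in> Hom M d (Src M r0)" "q12 \<in> Hom M
      d (Src M r0)"
    using pullbackE[OF finite_limits D(8,7)] .
  have "p \<cdot> (r0 \<cdot> q01) = p \<cdot> (r1 \<cdot> q12)"
    using comp_cancel[OF D(9,7,2,8,2) q(1)] comp_cancel[OF D(9,7,2,8,2) q(2)] is_pullbackD(1)[OF pb] by simp
  then obtain q02 where "q02 \<in> Hom M d (Src M r0)" "r0 \<cdot> q02 = r0 \<cdot> q01" "r1 \<cdot> q02 = r1 \<cdot> q12"
    using is_pullback_lift[OF D(6) comp_hom[OF q(1) D(7)] comp_hom[OF q(2) D(8)]] by metis
  then show thesis
    using that pb HomD[OF q(1)] unfolding loop_triple_def by metis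
qed

lemma loop_triple_map:
  assumes L: "is_loop_object M y j p p r0 r1" and T: "loop_triple r0 r1 q01 q12 q02"
    and L': "is_loop_object M y' j' p' p' r0' r1'" and T': "loop_triple r0' r1' q01' q12' q02'"
    and u: "u \<in> Hom M (Src M p) (Src M p')" and l: "l \<in> Hom M (Src M r0) (Src M r0')"
    and lu: "r0' \<cdot> l = u \<cdot> r0" "r1' \<cdot> l = u \<cdot> r1"
  obtains m where "m \<in> Hom M (Src M q01) (Src M q01')" "q01' \<cdot> m = l \<cdot> q01" "q12' \<cdot> m = l \<cdot> q12" "q02' \<cdot>
      m = l \<cdot> q02"
proof -
  note D = loop_objectD[OF L] and E = loop_objectD[OF L']
  note Q = loop_tripleD[OF L T] and R = loop_tripleD[OF L' T']
  note c0 = comp_cancel[OF lu(1) l E(7) D(7) u] and c1 = comp_cancel[OF lu(2) l E(8) D(8) u]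
  have S: "Src M r1' = Src M r0'" using HomD[OF E(8)] by simp
  have "r1' \<cdot> (l \<cdot> q01) = r0' \<cdot> (l \<cdot> q12)" using c0[OF Q(3)] c1[OF Q(2)] Q(7) by simp
  then obtain m where m: "m \<in> Hom M (Src M q01) (Src M q01')" "q01' \<cdot> m = l \<cdot> q01" "q12' \<cdot> m = l \<cdot> q12"
    using is_pullback_lift[OF R(1), of "l \<cdot> q01" "Src M q01" "l \<cdot> q12"] comp_hom[OF Q(2) l] comp_hom[OF
        Q(3) l] S by metis
  have "q02' \<cdot> m = l \<cdot> q02"
  proof (rule is_pullback_unique[OF E(6) comp_hom[OF m(1) R(4)] comp_hom[OF Q(4) l]])
    show "r0' \<cdot> (q02' \<cdot> m) = r0' \<cdot> (l \<cdot> q02)"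
      using comp_cancel[OF R(5,4) E(7) R(2) E(7) m(1)] m(2) c0[OF Q(2)] c0[OF Q(4)] Q(5) by simp
    show "r1' \<cdot> (q02' \<cdot> m) = r1' \<cdot> (l \<cdot> q02)"
      using comp_cancel[OF R(6,4) E(8) R(3) E(8) m(1)] m(3) c1[OF Q(3)] c1[OF Q(4)] Q(6) by simp
  qed
  then show thesis using that m by blast
qed

text \<open>The target triple is prescribed. With identity maps this moves a witness between two
  triples over the same presentation, which is how \<open>loop_rel_unique\<close> uses it.\<close>

lemma loop_rel_map:
  assumes L: "is_loop_object M y j p p r0 r1" and L': "is_loop_object M y' j' p' p' r0' r1'"
    and u: "u \<in> Hom M (Src M p) (Src M p')" and l: "l \<in> Hom M (Src M r0) (Src M r0')"
    and lu: "r0' \<cdot> l = u \<cdot> r0" "r1' \<cdot> l = u \<cdot> r1" and R: "loop_rel A r0 r1 a b c"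
    and T': "loop_triple r0' r1' q01' q12' q02'"
  obtains t where "t \<in> Hom (ho M) A (Src M q01')" "ho_arr M l \<odot> a = ho_arr M q01' \<odot> t"
    "ho_arr M l \<odot> b = ho_arr M q12' \<odot> t" "ho_arr M l \<odot> c = ho_arr M q02' \<odot> t"
proof -
  obtain q01 q12 q02 t where T: "loop_triple r0 r1 q01 q12 q02" and t: "t \<in> Hom (ho M) A (Src M q01)"
    and abc: "a = ho_arr M q01 \<odot> t" "b = ho_arr M q12 \<odot> t" "c = ho_arr M q02 \<odot> t"
    using R unfolding loop_rel_def by blast
  note Q = loop_tripleD[OF L T] and Q' = loop_tripleD[OF L' T']
  obtain m where m: "m \<in> Hom M (Src M q01) (Src M q01')" "q01' \<cdot> m = l \<cdot> q01" "q12' \<cdot> m = l \<cdot> q12" "q02'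
      \<cdot> m = l \<cdot> q02"
    using loop_triple_map[OF L T L' T' u l lu] .
  have c: "ho_arr M l \<odot> (ho_arr M q \<odot> t) = ho_arr M q' \<odot> (ho_arr M m \<odot> t)"
    if "q \<in> Hom M (Src M q01) (Src M r0)" "q' \<in> Hom M (Src M q01') (Src M r0')" "q' \<cdot> m = l \<cdot> q" for q q'
    using ho.comp_cancel[OF _ ho_arr_hom[OF that(1)] ho_arr_hom[OF l] ho_arr_hom[OF m(1)] ho_arr_hom[OF
        that(2)] t]
      ho_arr_comp[OF that(1) l] ho_arr_comp[OF m(1) that(2)] that(3) by simp
  show thesis
    using that[OF ho.comp_hom[OF t ho_arr_hom[OF m(1)]]] c[OF Q(2) Q'(2) m(2)] c[OF Q(3) Q'(3) m(3)]
      c[OF Q(4) Q'(4) m(4)] abc by simp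
qed

text \<open>The triple is a fibre product over the path object \<open>Src M p\<close>, which is
  fibrant and contractible, so a pair of arrows into the loop object lifts to it in
  \<open>ho M\<close>.\<close>

lemma loop_rel_exists:
  assumes L: "is_loop_object M y j p p r0 r1" and a: "a \<in> Hom (ho M) A (Src M r0)" and b: "b \<in> Hom (ho M)
      A (Src M r0)"
  obtains c where "c \<in> Hom (ho M) A (Src M r0)" "loop_rel A r0 r1 a b c"
proof -
  note D = loop_objectD[OF L]
  obtain t where t: "t \<in> Hom M (Src M p) z0" "t \<in> Weq M" using D(11) by blast
  obtain q01 q12 q02 where T: "loop_triple r0 r1 q01 q12 q02" using loop_triple_exists[OF L] .
  note Q = loop_tripleD[OF L T]
  obtain \<psi> where \<psi>: "\<psi> \<in> Hom (ho M) A (Src M q01)" "ho_arr M q01 \<odot> \<psi> = a" "ho_arr M q12 \<odot> \<psi> = b"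
    using contractible_pullback_ex[OF D(12) t D(8,14,7,13) Q(1) a b] .
  then show thesis
    using that[OF ho.comp_hom[OF \<psi>(1) ho_arr_hom[OF Q(4)]]] T unfolding loop_rel_def by blast
qed

lemma loop_rel_unique:
  assumes L: "is_loop_object M y j p p r0 r1" and R: "loop_rel A r0 r1 a b c" and R': "loop_rel A r0 r1 a b c'"
  shows "c = c'"
proof -
  note D = loop_objectD[OF L]
  obtain t where t: "t \<in> Hom M (Src M p) z0" "t \<in> Weq M" using D(11) by blast
  obtain q01 q12 q02 \<phi> where T: "loop_triple r0 r1 q01 q12 q02" and \<phi>: "\<phi> \<in> Hom (ho M) A (Src M q01)"
    and abc: "a = ho_arr M q01 \<odot> \<phi>" "b = ho_arr M q12 \<odot> \<phi>" "c = ho_arr M q02 \<odot> \<phi>"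
    using R unfolding loop_rel_def by blast
  note Q = loop_tripleD[OF L T]
  have o: "Src M p \<in> Obj M" "Src M r0 \<in> Obj M" using hom_obj[OF D(7)] by auto
  note i = ident_hom[OF o(1)] and i' = ident_hom[OF o(2)]
  \<comment> \<open>The second witness is moved to the triple of the first one, so that both are
    arrows into one fibre product and can be compared there.\<close>
  obtain \<psi> where \<psi>: "\<psi> \<in> Hom (ho M) A (Src M q01)" "ho_arr M (Ident M (Src M r0)) \<odot> a = ho_arr M q01 \<odot> \<psi>"
    "ho_arr M (Ident M (Src M r0)) \<odot> b = ho_arr M q12 \<odot> \<psi>" "ho_arr M (Ident M (Src M r0)) \<odot> c' = ho_arr M
        q02 \<odot> \<psi>"
    using loop_rel_map[OF L L i i' _ _ R' T] ident_left[OF D(7)] ident_right[OF D(7)] ident_left[OF D(8)]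
        ident_right[OF D(8)] by metis
  have hom: "a \<in> Hom (ho M) A (Src M r0)" "b \<in> Hom (ho M) A (Src M r0)"
    using abc ho.comp_hom[OF \<phi> ho_arr_hom] Q by simp_all
  have c': "c' \<in> Hom (ho M) A (Src M r0)"
  proof -
    obtain q01 q12 q02 \<phi> where "loop_triple r0 r1 q01 q12 q02" "\<phi> \<in> Hom (ho M) A (Src M q01)" "c' =
        ho_arr M q02 \<odot> \<phi>"
      using R' unfolding loop_rel_def by blast
    then show ?thesis using ho.comp_hom ho_arr_hom loop_tripleD(4)[OF L] by metis
  qed
  have e: "a = ho_arr M q01 \<odot> \<psi>" "b = ho_arr M q12 \<odot> \<psi>" "c' = ho_arr M q02 \<odot> \<psi>"
    using \<psi> ho.ident_left[OF hom(1)] ho.ident_left[OF hom(2)] ho.ident_left[OF c'] ho_arr_ident[OF o(2)]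
        by simp_all
  have "\<phi> = \<psi>"
    using contractible_pullback_unique[OF D(12) t D(8,14,7,13) Q(1) \<phi> \<psi>(1)] abc e by simp
  then show ?thesis using abc e by simp
qed

end

section \<open>Loops and their composition\<close>

lemma (in category) section_cancel:
  assumes "v \<cdot> w = Ident C x" "w \<in> Hom C x y" "v \<in> Hom C y x" "f \<in> Hom C a x" "g \<in> Hom C a x" "w \<cdot> f = w \<cdot> g"
  shows "f = g"
proof -
  have "v \<cdot> (w \<cdot> f) = f"
    using comp_cancel1[OF assms(1,2,3,4)] ident_left[OF assms(4)] by (rule trans)
  moreover have "v \<cdot> (w \<cdot> g) = g"
    using comp_cancel1[OF assms(1,2,3,5)] ident_left[OF assms(5)] by (rule trans)
  ultimately show ?thesis using assms(6) by argo
qed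

locale loop_functor = pointed_model_category M for M :: "('o, 'a, 'z) model_scheme" (structure) +
  fixes \<Omega> :: "('o, 'a) ho_endo"
    and \<theta> :: "'a \<Rightarrow> 'a \<Rightarrow> 'a \<Rightarrow> 'a \<Rightarrow> 'a \<Rightarrow> ('o, 'a) fraction"
  assumes loop_functor: "is_loop_functor M \<Omega> \<theta>"
begin

lemma loop_is_functor: "is_functor (ho M) (ho M) \<Omega>"
  using loop_functor by (simp add: is_loop_functor_def)

lemma loop_obj: "x \<in> Obj M \<Longrightarrow> onObj \<Omega> x \<in> Obj M"
  using loop_is_functor by (simp add: is_functor_def)

lemma loop_hom: "\<phi> \<in> Hom (ho M) x y \<Longrightarrow> onArr \<Omega> \<phi> \<in> Hom (ho M) (onObj \<Omega> x) (onObj \<Omega> y)"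
  using loop_is_functor by (simp add: is_functor_def)

lemma loop_ident: "x \<in> Obj M \<Longrightarrow> onArr \<Omega> (Ident (ho M) x) = Ident (ho M) (onObj \<Omega> x)"
  using loop_is_functor by (simp add: is_functor_def)

lemma loop_comp:
  "\<phi> \<in> Hom (ho M) x y \<Longrightarrow> \<psi> \<in> Hom (ho M) y z \<Longrightarrow>
     onArr \<Omega> (\<psi> \<odot> \<phi>) = onArr \<Omega> \<psi> \<odot> onArr \<Omega> \<phi>"
  using loop_is_functor unfolding is_functor_def by blast

lemma theta:
  assumes L: "is_loop_object M y j p p r r'"
  obtains \<theta>' where "\<theta> j p p r r' \<in> Hom (ho M) (onObj \<Omega> y) (Src M r)" "\<theta>' \<in> Hom (ho M) (Src M r) (onObj \<Omega> y)"
    "\<theta>' \<odot> \<theta> j p p r r' = Ident (ho M) (onObj \<Omega> y)" "\<theta> j p p r r' \<odot> \<theta>' = Ident (ho M) (Src M r)"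
proof -
  have "\<theta> j p p r r' \<in> Hom (ho M) (onObj \<Omega> y) (Src M r)" "is_iso (ho M) (\<theta> j p p r r')"
    using loop_functor L unfolding is_loop_functor_def by blast+
  then show thesis using that HomD unfolding is_iso_def by metis
qed

lemma theta_nat:
  assumes "is_loop_object M y j p p r r'" "is_loop_object M y' k s s m m'" "f \<in> Hom M y y'"
    "g \<in> Hom M (Tgt M j) (Tgt M k)" "u \<in> Hom M (Src M p) (Src M s)" "l \<in> Hom M (Src M r) (Src M m)"
    "g \<cdot> j = k \<cdot> f" "s \<cdot> u = g \<cdot> p" "m \<cdot> l = u \<cdot> r" "m' \<cdot> l = u \<cdot> r'"
  shows "\<theta> k s s m m' \<odot> onArr \<Omega> (ho_arr M f) = ho_arr M l \<odot> \<theta> j p p r r'"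
  using conjunct2[OF conjunct2[OF loop_functor[unfolded is_loop_functor_def]], rule_format,
      OF conjI[OF assms(1,2)] assms(3,4,5,5,6)] assms(7-10) by simp

lemma loop_mult_alt:
  "loop_mult M \<Omega> \<theta> A y a b = (THE c. c \<in> Hom (ho M) A (onObj \<Omega> y) \<and>
     (\<exists>j p r0 r1. is_loop_object M y j p p r0 r1 \<and>
        loop_rel A r0 r1 (\<theta> j p p r0 r1 \<odot> a) (\<theta> j p p r0 r1 \<odot> b) (\<theta> j p p r0 r1 \<odot> c)))"
  unfolding loop_mult_def loop_rel_def loop_triple_def
  by (rule arg_cong[where f = The], rule ext) blast

text \<open>Cofibrancy of the source presentation produces strict maps \<open>g\<close>,
  \<open>u\<close>, \<open>l\<close> over \<open>f\<close>; naturality of \<theta> then identifies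
  \<open>l\<close> with the loop of \<open>f\<close>.\<close>

lemma loop_rel_transport:
  assumes U: "cofibrant_loop_object y j p r0 r1" and f: "f \<in> Hom M y y'" and L': "is_loop_object M y' j'
      p' p' r0' r1'"
    and abc: "a \<in> Hom (ho M) A (onObj \<Omega> y)" "b \<in> Hom (ho M) A (onObj \<Omega> y)" "c \<in> Hom (ho M) A (onObj \<Omega> y)"
    and R: "loop_rel A r0 r1 (\<theta> j p p r0 r1 \<odot> a) (\<theta> j p p r0 r1 \<odot> b) (\<theta> j p p r0 r1 \<odot> c)"
  shows "loop_rel A r0' r1' (\<theta> j' p' p' r0' r1' \<odot> (onArr \<Omega> (ho_arr M f) \<odot> a))
     (\<theta> j' p' p' r0' r1' \<odot> (onArr \<Omega> (ho_arr M f) \<odot> b))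
     (\<theta> j' p' p' r0' r1' \<odot> (onArr \<Omega> (ho_arr M f) \<odot> c))"
proof -
  have L: "is_loop_object M y j p p r0 r1" using U by (simp add: cofibrant_loop_object_def)
  obtain g u l where m: "g \<in> Hom M (Tgt M j) (Tgt M j')" "u \<in> Hom M (Src M p) (Src M p')" "l \<in> Hom M (Src
      M r0) (Src M r0')"
    "g \<cdot> j = j' \<cdot> f" "p' \<cdot> u = g \<cdot> p" "r0' \<cdot> l = u \<cdot> r0" "r1' \<cdot> l = u \<cdot> r1"
    using cofibrant_loop_object_map[OF U f L'] .
  note N = theta_nat[OF L L' f m]
  have T: "\<theta> j p p r0 r1 \<in> Hom (ho M) (onObj \<Omega> y) (Src M r0)" using theta[OF L] .
  have T': "\<theta> j' p' p' r0' r1' \<in> Hom (ho M) (onObj \<Omega> y') (Src M r0')" using theta[OF L'] .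
  obtain q01 q12 q02 where tr: "loop_triple r0' r1' q01 q12 q02" using loop_triple_exists[OF L'] .
  obtain t where "t \<in> Hom (ho M) A (Src M q01)"
    "ho_arr M l \<odot> (\<theta> j p p r0 r1 \<odot> a) = ho_arr M q01 \<odot> t"
    "ho_arr M l \<odot> (\<theta> j p p r0 r1 \<odot> b) = ho_arr M q12 \<odot> t"
    "ho_arr M l \<odot> (\<theta> j p p r0 r1 \<odot> c) = ho_arr M q02 \<odot> t"
    using loop_rel_map[OF L L' m(2,3,6,7) R tr] .
  moreover have "\<theta> j' p' p' r0' r1' \<odot> (onArr \<Omega> (ho_arr M f) \<odot> d)
      = ho_arr M l \<odot> (\<theta> j p p r0 r1 \<odot> d)"
    if "d \<in> Hom (ho M) A (onObj \<Omega> y)" for d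
    using ho.comp_cancel[OF N loop_hom[OF ho_arr_hom[OF f]] T' T ho_arr_hom[OF m(3)] that] .
  ultimately show ?thesis unfolding loop_rel_def using tr abc by metis
qed

lemma loop_mult_cofibrant:
  assumes U: "cofibrant_loop_object y j p r0 r1"
    and ab: "a \<in> Hom (ho M) A (onObj \<Omega> y)" "b \<in> Hom (ho M) A (onObj \<Omega> y)"
  obtains c where "c \<in> Hom (ho M) A (onObj \<Omega> y)"
    "loop_rel A r0 r1 (\<theta> j p p r0 r1 \<odot> a) (\<theta> j p p r0 r1 \<odot> b) (\<theta> j p p r0 r1 \<odot> c)"
proof -
  have L: "is_loop_object M y j p p r0 r1" using U by (simp add: cofibrant_loop_object_def)
  obtain \<theta>' where T: "\<theta> j p p r0 r1 \<in> Hom (ho M) (onObj \<Omega> y) (Src M r0)" "\<theta>' \<in> Hom (ho M) (Src M r0)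
      (onObj \<Omega> y)"
    "\<theta> j p p r0 r1 \<odot> \<theta>' = Ident (ho M) (Src M r0)"
    using theta[OF L] by metis
  obtain c where c: "c \<in> Hom (ho M) A (Src M r0)" "loop_rel A r0 r1 (\<theta> j p p r0 r1 \<odot> a) (\<theta> j p p r0 r1 \<odot> b) c"
    using loop_rel_exists[OF L ho.comp_hom[OF ab(1) T(1)] ho.comp_hom[OF ab(2) T(1)]] .
  have "\<theta> j p p r0 r1 \<odot> (\<theta>' \<odot> c) = c"
    using ho.comp_cancel1[OF T(3,2,1) c(1)] ho.ident_left[OF c(1)] by simp
  then show thesis using that[OF ho.comp_hom[OF c(1) T(2)]] c(2) by simp
qed

text \<open>The definite description ranges over all presentations of the loop object of
  \<open>y\<close>. Each is compared, over the identity of \<open>y\<close>, with one cofibrant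
  presentation, so all of them yield the same product.\<close>

lemma loop_mult_eqI:
  assumes L: "is_loop_object M y j p p r0 r1"
    and abc: "a \<in> Hom (ho M) A (onObj \<Omega> y)" "b \<in> Hom (ho M) A (onObj \<Omega> y)" "c \<in> Hom (ho M) A (onObj \<Omega> y)"
    and R: "loop_rel A r0 r1 (\<theta> j p p r0 r1 \<odot> a) (\<theta> j p p r0 r1 \<odot> b) (\<theta> j p p r0 r1 \<odot> c)"
  shows "loop_mult M \<Omega> \<theta> A y a b = c"
proof -
  have y: "y \<in> Obj M" using hom_obj[OF loop_objectD(5)[OF L]] by blast
  obtain j0 p0 s0 s1 where U: "cofibrant_loop_object y j0 p0 s0 s1" using cofibrant_loop_object_exists[OF y] .
  obtain c0 where c0: "c0 \<in> Hom (ho M) A (onObj \<Omega> y)"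
    "loop_rel A s0 s1 (\<theta> j0 p0 p0 s0 s1 \<odot> a) (\<theta> j0 p0 p0 s0 s1 \<odot> b) (\<theta> j0 p0 p0 s0 s1 \<odot> c0)"
    using loop_mult_cofibrant[OF U abc(1,2)] .
  have id: "onArr \<Omega> (ho_arr M (Ident M y)) \<odot> d = d" if "d \<in> Hom (ho M) A (onObj \<Omega> y)" for d
    using loop_ident[OF y] ho_arr_ident[OF y] ho.ident_left[OF that] by simp
  have un: "d = c0" if d: "d \<in> Hom (ho M) A (onObj \<Omega> y)" and L: "is_loop_object M y j p p r0 r1"
    and R: "loop_rel A r0 r1 (\<theta> j p p r0 r1 \<odot> a) (\<theta> j p p r0 r1 \<odot> b) (\<theta> j p p r0 r1 \<odot> d)" for d j p r0 r1
  proof -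
    obtain \<theta>' where T: "\<theta> j p p r0 r1 \<in> Hom (ho M) (onObj \<Omega> y) (Src M r0)" "\<theta>' \<in> Hom (ho M) (Src M r0)
        (onObj \<Omega> y)"
      "\<theta>' \<odot> \<theta> j p p r0 r1 = Ident (ho M) (onObj \<Omega> y)"
      using theta[OF L] by metis
    have "loop_rel A r0 r1 (\<theta> j p p r0 r1 \<odot> a) (\<theta> j p p r0 r1 \<odot> b) (\<theta> j p p r0 r1 \<odot> c0)"
      using loop_rel_transport[OF U ident_hom[OF y] L abc(1,2) c0] id[OF abc(1)] id[OF abc(2)] id[OF
          c0(1)] by simp
    then have "\<theta> j p p r0 r1 \<odot> d = \<theta> j p p r0 r1 \<odot> c0"
      using loop_rel_unique[OF L R] by blast
    then show ?thesis using ho.section_cancel[OF T(3,1,2) d c0(1)] by blast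
  qed
  show ?thesis
    unfolding loop_mult_alt
  proof (rule the_equality)
    show "c \<in> Hom (ho M) A (onObj \<Omega> y) \<and> (\<exists>j p r0 r1. is_loop_object M y j p p r0 r1 \<and>
        loop_rel A r0 r1 (\<theta> j p p r0 r1 \<odot> a) (\<theta> j p p r0 r1 \<odot> b) (\<theta> j p p r0 r1 \<odot> c))"
      using abc(3) L R by blast
    fix d assume "d \<in> Hom (ho M) A (onObj \<Omega> y) \<and> (\<exists>j p r0 r1. is_loop_object M y j p p r0 r1 \<and>
        loop_rel A r0 r1 (\<theta> j p p r0 r1 \<odot> a) (\<theta> j p p r0 r1 \<odot> b) (\<theta> j p p r0 r1 \<odot> d))"
    then show "d = c" using un un[OF abc(3) L R] by blast
  qed
qed

text \<open>Closure under products is part of the notion because composing and inverting such arrows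
  requires it. The group laws are not at issue here; they come with \<open>pi_functor\<close> taking
  values in groups.\<close>

definition multiplicative :: "'o \<Rightarrow> 'o \<Rightarrow> 'o \<Rightarrow> ('o, 'a) fraction \<Rightarrow> bool" where
  "multiplicative A y y' \<phi> \<longleftrightarrow> \<phi> \<in> Hom (ho M) y y' \<and>
     (\<forall>a \<in> Hom (ho M) A (onObj \<Omega> y). \<forall>b \<in> Hom (ho M) A (onObj \<Omega> y).
        loop_mult M \<Omega> \<theta> A y a b \<in> Hom (ho M) A (onObj \<Omega> y) \<and>
        onArr \<Omega> \<phi> \<odot> loop_mult M \<Omega> \<theta> A y a b =
        loop_mult M \<Omega> \<theta> A y' (onArr \<Omega> \<phi> \<odot> a) (onArr \<Omega> \<phi> \<odot> b))"

lemma multiplicative_ho_arr: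
  assumes f: "f \<in> Hom M y y'"
  shows "multiplicative A y y' (ho_arr M f)"
  unfolding multiplicative_def
proof (intro conjI ballI ho_arr_hom[OF f])
  fix a b assume ab: "a \<in> Hom (ho M) A (onObj \<Omega> y)" "b \<in> Hom (ho M) A (onObj \<Omega> y)"
  obtain j p r0 r1 where U: "cofibrant_loop_object y j p r0 r1" using cofibrant_loop_object_exists
      hom_obj[OF f] by metis
  then have L: "is_loop_object M y j p p r0 r1" by (simp add: cofibrant_loop_object_def)
  obtain j' p' r0' r1' where "cofibrant_loop_object y' j' p' r0' r1'" using cofibrant_loop_object_exists
      hom_obj[OF f] by metis
  then have L': "is_loop_object M y' j' p' p' r0' r1'" by (simp add: cofibrant_loop_object_def)
  obtain c where c: "c \<in> Hom (ho M) A (onObj \<Omega> y)"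
    "loop_rel A r0 r1 (\<theta> j p p r0 r1 \<odot> a) (\<theta> j p p r0 r1 \<odot> b) (\<theta> j p p r0 r1 \<odot> c)"
    using loop_mult_cofibrant[OF U ab] .
  have mc: "loop_mult M \<Omega> \<theta> A y a b = c" using loop_mult_eqI[OF L ab c] .
  show "loop_mult M \<Omega> \<theta> A y a b \<in> Hom (ho M) A (onObj \<Omega> y)" using mc c by simp
  note F = loop_hom[OF ho_arr_hom[OF f]]
  show "onArr \<Omega> (ho_arr M f) \<odot> loop_mult M \<Omega> \<theta> A y a b =
      loop_mult M \<Omega> \<theta> A y' (onArr \<Omega> (ho_arr M f) \<odot> a) (onArr \<Omega> (ho_arr M f) \<odot> b)"
    using loop_mult_eqI[OF L' ho.comp_hom[OF ab(1) F] ho.comp_hom[OF ab(2) F] ho.comp_hom[OF c(1) F]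
        loop_rel_transport[OF U f L' ab c]] mc by simp
qed

lemma multiplicative_comp:
  assumes "multiplicative A x y \<phi>" "multiplicative A y z \<psi>"
  shows "multiplicative A x z (\<psi> \<odot> \<phi>)"
proof -
  have h: "\<phi> \<in> Hom (ho M) x y" "\<psi> \<in> Hom (ho M) y z" using assms by (simp_all add: multiplicative_def)
  note P = loop_hom[OF h(1)] and Q = loop_hom[OF h(2)]
  show ?thesis
    unfolding multiplicative_def
  proof (intro conjI ballI ho.comp_hom[OF h])
    fix a b assume ab: "a \<in> Hom (ho M) A (onObj \<Omega> x)" "b \<in> Hom (ho M) A (onObj \<Omega> x)"
    then show m: "loop_mult M \<Omega> \<theta> A x a b \<in> Hom (ho M) A (onObj \<Omega> x)"
      using assms(1) by (simp add: multiplicative_def)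
    have "onArr \<Omega> \<phi> \<odot> loop_mult M \<Omega> \<theta> A x a b =
        loop_mult M \<Omega> \<theta> A y (onArr \<Omega> \<phi> \<odot> a) (onArr \<Omega> \<phi> \<odot> b)"
      using assms(1) ab unfolding multiplicative_def by blast
    moreover have "onArr \<Omega> \<psi> \<odot> loop_mult M \<Omega> \<theta> A y (onArr \<Omega> \<phi> \<odot> a) (onArr \<Omega> \<phi> \<odot> b) =
        loop_mult M \<Omega> \<theta> A z (onArr \<Omega> \<psi> \<odot> (onArr \<Omega> \<phi> \<odot> a)) (onArr \<Omega> \<psi> \<odot> (onArr \<Omega> \<phi> \<odot> b))"
      using assms(2) ho.comp_hom[OF ab(1) P] ho.comp_hom[OF ab(2) P] unfolding multiplicative_def by blast
    ultimately show "onArr \<Omega> (\<psi> \<odot> \<phi>) \<odot> loop_mult M \<Omega> \<theta> A x a b =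
        loop_mult M \<Omega> \<theta> A z (onArr \<Omega> (\<psi> \<odot> \<phi>) \<odot> a) (onArr \<Omega> (\<psi> \<odot> \<phi>) \<odot> b)"
      using loop_comp[OF h] ho.comp_assoc[OF ab(1) P Q] ho.comp_assoc[OF ab(2) P Q] ho.comp_assoc[OF m P
          Q] by simp
  qed
qed

text \<open>The inverse of a bijective homomorphism is a homomorphism: both sides are compared after
  applying the loop of \<open>w\<close>, which can be cancelled.\<close>

lemma multiplicative_ho_inv:
  assumes w: "w \<in> Weq M" "w \<in> Hom M y y'"
  shows "multiplicative A y' y (ho_inv w)"
proof -
  note I = ho_inv[OF w] and H = ho_arr_hom[OF w(2)]
  note P = loop_hom[OF I(1)] and Q = loop_hom[OF H]
  have y: "y \<in> Obj M" "y' \<in> Obj M" using hom_obj[OF w(2)] by auto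
  have PQ: "onArr \<Omega> (ho_inv w) \<odot> onArr \<Omega> (ho_arr M w) = Ident (ho M) (onObj \<Omega> y)"
    using loop_comp[OF H I(1)] I(2) loop_ident[OF y(1)] by simp
  have QP: "onArr \<Omega> (ho_arr M w) \<odot> onArr \<Omega> (ho_inv w) = Ident (ho M) (onObj \<Omega> y')"
    using loop_comp[OF I(1) H] I(3) loop_ident[OF y(2)] by simp
  have qp: "onArr \<Omega> (ho_arr M w) \<odot> (onArr \<Omega> (ho_inv w) \<odot> c) = c"
    if "c \<in> Hom (ho M) A (onObj \<Omega> y')" for c
    using ho.comp_cancel1[OF QP P Q that] ho.ident_left[OF that] by simp
  have "multiplicative A y y' (ho_arr M w)" "multiplicative A y' y' (ho_arr M (Ident M y'))"
    using multiplicative_ho_arr[OF w(2)] multiplicative_ho_arr[OF ident_hom[OF y(2)]] .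
  note mw = this(1)[unfolded multiplicative_def] and mi = this(2)[unfolded multiplicative_def]
  show ?thesis
    unfolding multiplicative_def
  proof (intro conjI ballI I(1))
    fix a b assume ab: "a \<in> Hom (ho M) A (onObj \<Omega> y')" "b \<in> Hom (ho M) A (onObj \<Omega> y')"
    then show m: "loop_mult M \<Omega> \<theta> A y' a b \<in> Hom (ho M) A (onObj \<Omega> y')" using mi by blast
    let ?a = "onArr \<Omega> (ho_inv w) \<odot> a" and ?b = "onArr \<Omega> (ho_inv w) \<odot> b"
    have ab': "?a \<in> Hom (ho M) A (onObj \<Omega> y)" "?b \<in> Hom (ho M) A (onObj \<Omega> y)"
      using ho.comp_hom[OF ab(1) P] ho.comp_hom[OF ab(2) P] .
    have m': "loop_mult M \<Omega> \<theta> A y ?a ?b \<in> Hom (ho M) A (onObj \<Omega> y)" using mw ab' by blast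
    have "onArr \<Omega> (ho_arr M w) \<odot> loop_mult M \<Omega> \<theta> A y ?a ?b = loop_mult M \<Omega> \<theta> A y' a b"
      using mw ab' qp[OF ab(1)] qp[OF ab(2)] by simp
    then show "onArr \<Omega> (ho_inv w) \<odot> loop_mult M \<Omega> \<theta> A y' a b = loop_mult M \<Omega> \<theta> A y ?a ?b"
      using ho.section_cancel[OF PQ Q P ho.comp_hom[OF m P] m'] qp[OF m] by simp
  qed
qed

text \<open>Naturality of \<theta> is available only for arrows of \<open>M\<close>. Induction along
  a zigzag reaches all of \<open>ho M\<close>, in particular the iterated loops of a factor
  \<open>u\<close> that need not come from an arrow of \<open>M\<close>.\<close>

theorem loop_multiplicative:
  assumes "\<phi> \<in> Hom (ho M) y y'"
  shows "multiplicative A y y' \<phi>"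
proof -
  have "multiplicative A x z (fraction M (Weq M) x s z)" if "zigzag M (Weq M) x s z" for x s z
    using that
  proof (induction rule: zigzag.induct)
    case (zz_nil x)
    then show ?case
      using multiplicative_ho_arr[OF ident_hom[OF zz_nil], of A] ho_arr_ident[OF zz_nil]
      by (simp add: ho_def localization_simps)
  next
    case (zz_fwd f x y s z)
    have "fraction M (Weq M) x (Fwd f # s) z = fraction M (Weq M) y s z \<odot> ho_arr M f"
      using comp_fraction[OF zz_single[OF zz_fwd(1)] zz_fwd(2)] ho_arr_eq[OF zz_fwd(1)] by (simp add: ho_def)
    then show ?case using multiplicative_comp[OF multiplicative_ho_arr[OF zz_fwd(1)] zz_fwd.IH] by simp
  next
    case (zz_bwd w y x s z)
    have "zigzag M (Weq M) x [Bwd w] y"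
      using zz_bwd by (auto intro: zigzag.zz_bwd zigzag.zz_nil hom_obj)
    from comp_fraction[OF this zz_bwd(3)]
    have "fraction M (Weq M) x (Bwd w # s) z = fraction M (Weq M) y s z \<odot> ho_inv w"
      using HomD[OF zz_bwd(2)] by (simp add: ho_def ho_inv_def)
    then show ?case using multiplicative_comp[OF multiplicative_ho_inv[OF zz_bwd(1,2)] zz_bwd.IH] by simp
  qed
  then show ?thesis using assms unfolding ho_def by (auto simp: Hom_localization)
qed

end

section \<open>Factoring through a loop map\<close>

context pointed_model_category
begin

lemma contractible_ho_inv:
  assumes a: "a \<in> Hom M z0 x" "a \<in> Weq M" and t: "t \<in> Hom M x z0"
  shows "ho_arr M a \<odot> ho_arr M t = Ident (ho M) x"
proof -
  note I = ho_inv[OF a(2,1)] and A = ho_arr_hom[OF a(1)] and T = ho_arr_hom[OF t]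
  have "t \<cdot> a = Ident M z0" using to_z0_unique[OF comp_hom[OF a(1) t] ident_hom[OF z0_obj]] .
  then have "ho_arr M t \<odot> ho_arr M a = Ident (ho M) z0"
    using ho_arr_comp[OF a(1) t] ho_arr_ident[OF z0_obj] by simp
  then have "(ho_arr M t \<odot> ho_arr M a) \<odot> ho_inv a = ho_inv a"
    using ho.ident_left[OF I(1)] by simp
  then have "ho_arr M t = ho_inv a"
    using ho.comp_assoc[OF I(1) A T] I(3) ho.ident_right[OF T] by simp
  then show ?thesis using I(3) by simp
qed

text \<open>The fibre product of \<open>F\<close> and \<open>D\<close> over \<open>C\<close> is that
  of \<open>P\<close> and \<open>D\<close> over \<open>X\<close>. Hence \<open>\<rho>\<close> is a
  base change of \<open>\<pi>\<close> followed by a base change of \<open>k \<cdot> s\<close>. Both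
  are trivial fibrations, and the proof solves the two lifting problems together.\<close>

lemma fibre_map_weq:
  assumes e: "e \<in> Hom M C X" and p: "p \<in> Hom M P X" and pbF: "is_pullback M e p g k"
    and g: "g \<in> Hom M F C" and k: "k \<in> Hom M F P"
    and s: "s \<in> Hom M D F" and \<pi>: "\<pi> \<in> Hom M Q F" "\<pi> \<in> Fib M" "\<pi> \<in> Weq M"
    and \<kappa>: "k \<cdot> s \<in> Fib M" "k \<cdot> s \<in> Weq M"
    and pb: "is_pullback M p p r0 r1" and r: "r0 \<in> Hom M R P" "r1 \<in> Hom M R P"
    and pbL: "is_pullback M (g \<cdot> \<pi>) (g \<cdot> s) l0 l1" and l: "l0 \<in> Hom M L Q" "l1 \<in> Hom M L D"
    and \<rho>: "\<rho> \<in> Hom M L R" "r0 \<cdot> \<rho> = (k \<cdot> \<pi>) \<cdot> l0" "r1 \<cdot> \<rho> = (k \<cdot> s) \<cdot> l1"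
  shows "\<rho> \<in> Weq M"
proof (rule tfibI)
  show "\<rho> \<in> Arr M" using HomD(1)[OF \<rho>(1)] .
  fix i assume i: "i \<in> Cof M"
  note ih = cof_hom[OF i]
  note gp = comp_hom[OF \<pi>(1) g] and gs = comp_hom[OF s g] and kp = comp_hom[OF \<pi>(1) k] and ks = comp_hom[OF s k]
  have E: "e \<cdot> g = p \<cdot> k" using is_pullbackD(1)[OF pbF] .
  have Es: "p \<cdot> (k \<cdot> s) = e \<cdot> (g \<cdot> s)" using comp_cancel[OF E g e k p s] by simp
  have sF: "Src M g = F" "Src M l0 = L" "Src M r0 = R" using HomD[OF g] HomD[OF l(1)] HomD[OF r(1)] by auto
  show "has_lift M i \<rho>"
    unfolding has_lift_def HomD[OF \<rho>(1)]
  proof (intro ballI impI)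
    fix u v assume u: "u \<in> Hom M (Src M i) L" and v: "v \<in> Hom M (Tgt M i) R" and e0: "\<rho> \<cdot> u = v \<cdot> i"
    define x where "x = r0 \<cdot> v"
    define y where "y = r1 \<cdot> v"
    have x: "x \<in> Hom M (Tgt M i) P" and y: "y \<in> Hom M (Tgt M i) P"
      using comp_hom[OF v r(1)] comp_hom[OF v r(2)] by (simp_all add: x_def y_def)
    have pxy: "p \<cdot> x = p \<cdot> y"
      using comp_cancel[OF is_pullbackD(1)[OF pb] r(1) p r(2) p v] by (simp add: x_def y_def)
    note u0 = comp_hom[OF u l(1)] and u1 = comp_hom[OF u l(2)]
    have xi: "(k \<cdot> \<pi>) \<cdot> (l0 \<cdot> u) = x \<cdot> i"
      using comp_cancel[OF \<rho>(2,1) r(1) l(1) kp u] e0 comp_assoc[OF ih v r(1)] by (simp add: x_def)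
    have yi: "(k \<cdot> s) \<cdot> (l1 \<cdot> u) = y \<cdot> i"
      using comp_cancel[OF \<rho>(3,1) r(2) l(2) ks u] e0 comp_assoc[OF ih v r(2)] by (simp add: y_def)
    \<comment> \<open>The second coordinate is lifted to \<open>D\<close>; its image in
      \<open>C\<close> and the first coordinate then form a point of \<open>F\<close>, which is
      lifted to \<open>Q\<close>.\<close>
    obtain w where w: "w \<in> Hom M (Tgt M i) D" "w \<cdot> i = l1 \<cdot> u" "(k \<cdot> s) \<cdot> w = y"
      using has_liftE[OF lift_cof[OF i \<kappa>] ih ks u1 y yi] .
    note gw = comp_hom[OF w(1) gs]
    have "e \<cdot> ((g \<cdot> s) \<cdot> w) = p \<cdot> x" using comp_cancel[OF Es ks p gs e w(1)] w(3) pxy by simp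
    then obtain b where b: "b \<in> Hom M (Tgt M i) F" "g \<cdot> b = (g \<cdot> s) \<cdot> w" "k \<cdot> b = x"
      using is_pullback_lift[OF pbF, of "(g \<cdot> s) \<cdot> w" "Tgt M i" x] gw x sF HomD[OF e] HomD[OF p] by metis
    have "\<pi> \<cdot> (l0 \<cdot> u) = b \<cdot> i"
    proof (rule is_pullback_unique[OF pbF])
      show "\<pi> \<cdot> (l0 \<cdot> u) \<in> Hom M (Src M i) (Src M g)" "b \<cdot> i \<in> Hom M (Src M i) (Src M g)"
        using comp_hom[OF u0 \<pi>(1)] comp_hom[OF ih b(1)] sF by simp_all
      show "g \<cdot> (\<pi> \<cdot> (l0 \<cdot> u)) = g \<cdot> (b \<cdot> i)"
        using comp_assoc[OF u0 \<pi>(1) g] comp_cancel[OF is_pullbackD(1)[OF pbL] l(1) gp l(2) gs u]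
          comp_cancel[OF b(2,1) g w(1) gs ih] w(2) by simp
      show "k \<cdot> (\<pi> \<cdot> (l0 \<cdot> u)) = k \<cdot> (b \<cdot> i)"
        using comp_assoc[OF u0 \<pi>(1) k] comp_cancel1[OF b(3,1) k ih] xi by simp
    qed
    then obtain q where q: "q \<in> Hom M (Tgt M i) Q" "q \<cdot> i = l0 \<cdot> u" "\<pi> \<cdot> q = b"
      using has_liftE[OF lift_cof[OF i \<pi>(2,3)] ih \<pi>(1) u0 b(1)] by blast
    have "(g \<cdot> \<pi>) \<cdot> q = (g \<cdot> s) \<cdot> w" using comp_assoc[OF q(1) \<pi>(1) g] q(3) b(2) by simp
    then obtain h where h: "h \<in> Hom M (Tgt M i) L" "l0 \<cdot> h = q" "l1 \<cdot> h = w"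
      using is_pullback_lift[OF pbL, of q "Tgt M i" w] q(1) w(1) sF HomD[OF gp] HomD[OF gs] by metis
    have "h \<cdot> i = u"
    proof (rule is_pullback_unique[OF pbL])
      show "h \<cdot> i \<in> Hom M (Src M i) (Src M l0)" "u \<in> Hom M (Src M i) (Src M l0)"
        using comp_hom[OF ih h(1)] u sF by simp_all
      show "l0 \<cdot> (h \<cdot> i) = l0 \<cdot> u" using comp_cancel1[OF h(2,1) l(1) ih] q(2) by simp
      show "l1 \<cdot> (h \<cdot> i) = l1 \<cdot> u" using comp_cancel1[OF h(3,1) l(2) ih] w(2) by simp
    qed
    moreover have "\<rho> \<cdot> h = v"
    proof (rule is_pullback_unique[OF pb])
      show "\<rho> \<cdot> h \<in> Hom M (Tgt M i) (Src M r0)" "v \<in> Hom M (Tgt M i) (Src M r0)"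
        using comp_hom[OF h(1) \<rho>(1)] v sF by simp_all
      show "r0 \<cdot> (\<rho> \<cdot> h) = r0 \<cdot> v"
        using comp_cancel[OF \<rho>(2,1) r(1) l(1) kp h(1)] h(2) comp_assoc[OF q(1) \<pi>(1) k] q(3) b(3)
        by (simp add: x_def)
      show "r1 \<cdot> (\<rho> \<cdot> h) = r1 \<cdot> v"
        using comp_cancel[OF \<rho>(3,1) r(2) l(2) ks h(1)] h(3) w(3) by (simp add: y_def)
    qed
    ultimately show "\<exists>h\<in>Hom M (Tgt M i) L. h \<cdot> i = u \<and> \<rho> \<cdot> h = v" using h(1) by blast
  qed
qed

end

context loop_functor
begin

text \<open>
  The fibre of the homotopy fibre \<open>F \<rightarrow> C\<close> of \<open>e\<close> is \<open>\<Omega> X\<close>. The hypothesis makes \<open>F \<rightarrow> C \<rightarrow> Y\<close>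
  trivial, and a null homotopy maps that fibre to \<open>\<Omega> Y\<close>. The contractible object \<open>D\<close> over \<open>C\<close> is
  sent to the path object of \<open>Y\<close> through the null homotopy as well, which makes the triangle commute
  on the nose.
\<close>

lemma loop_factor_strict:
  assumes CXY: "is_fibrant M C" "is_fibrant M X" "is_fibrant M Y"
    and e: "e \<in> Hom M C X" "e \<in> Fib M" and d: "d \<in> Hom M C Y"
    and hyp: "\<And>V g h. g \<in> Hom (ho M) V C \<Longrightarrow> h \<in> Hom (ho M) V C \<Longrightarrow>
        ho_arr M e \<odot> g = ho_arr M e \<odot> h \<Longrightarrow> ho_arr M d \<odot> g = ho_arr M d \<odot> h"
  obtains u where "u \<in> Hom (ho M) (onObj \<Omega> X) (onObj \<Omega> Y)"
    "u \<odot> onArr \<Omega> (ho_arr M e) = onArr \<Omega> (ho_arr M d)"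
proof -
  have obj: "C \<in> Obj M" "X \<in> Obj M" "Y \<in> Obj M" using CXY fibrant_obj by auto
  obtain fX where fX: "fX \<in> Hom M z0 X" using from_zero[OF zero_z0 obj(2)] by blast
  obtain P a p where a: "a \<in> Hom M z0 P" "p \<in> Hom M P X" "fX = p \<cdot> a" "a \<in> Cof M" "a \<in> Weq M" "p \<in> Fib M"
    using factor_tcof_fib[OF fX] .
  obtain fY where fY: "fY \<in> Hom M z0 Y" using from_zero[OF zero_z0 obj(3)] by blast
  obtain P' a' p' where a': "a' \<in> Hom M z0 P'" "p' \<in> Hom M P' Y" "fY = p' \<cdot> a'" "a' \<in> Cof M" "a' \<in> Weq M"
      "p' \<in> Fib M"
    using factor_tcof_fib[OF fY] .
  obtain F g k where pbF: "is_pullback M e p g k" and g: "g \<in> Hom M F C" and k: "k \<in> Hom M F P"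
    using pullbackE[OF finite_limits e(1) a(2)] .
  have E: "e \<cdot> g = p \<cdot> k" using is_pullbackD(1)[OF pbF] .
  have kf: "k \<in> Fib M" using fib_pullback[OF pbF e(2)] .
  have gf: "g \<in> Fib M" using fib_pullback[OF is_pullback_sym[OF pbF] a(6)] .
  obtain fF where fF: "fF \<in> Hom M z0 F" using from_zero[OF zero_z0] hom_obj[OF g] by blast
  \<comment> \<open>\<open>D\<close> is contractible and fibred over \<open>F\<close>, so
    \<open>g \<cdot> s\<close> presents the loops of \<open>C\<close>, while
    \<open>k \<cdot> s\<close> becomes a trivial fibration onto \<open>P\<close>.\<close>
  obtain D c s where c: "c \<in> Hom M z0 D" "s \<in> Hom M D F" "fF = s \<cdot> c" "c \<in> Cof M" "c \<in> Weq M" "s \<in> Fib M"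
    using factor_tcof_fib[OF fF] .
  have Fo: "F \<in> Obj M" using hom_obj[OF g] by blast
  obtain Q \<pi> where \<pi>: "\<pi> \<in> Hom M Q F" "\<pi> \<in> Fib M" "\<pi> \<in> Weq M" and Q: "cofibrant Q"
    using cofibrant_replacement[OF Fo] .
  note gp = comp_hom[OF \<pi>(1) g] and gs = comp_hom[OF c(2) g] and kp = comp_hom[OF \<pi>(1) k] and ks =
      comp_hom[OF c(2) k]
  obtain s' where s': "s' \<in> Hom M D Q" "\<pi> \<cdot> s' = s"
    using cofibrantE[OF cofibrantI[OF zero_z0 c(1,4)] \<pi>(2,3,1) c(2)] .
  have ksf: "k \<cdot> s \<in> Fib M" using fib_comp[OF c(2) k c(6) kf] .
  have "(k \<cdot> s) \<cdot> c = a" using from_zero_unique[OF zero_z0 comp_hom[OF c(1) ks] a(1)] .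
  then have ksw: "k \<cdot> s \<in> Weq M" using weq_left[OF c(1) ks c(5)] a(5) by simp
  have gsf: "g \<cdot> s \<in> Fib M" using fib_comp[OF c(2) g c(6) gf] .
  note dgp = comp_hom[OF gp d]
  obtain tQ where tQ: "tQ \<in> Hom M Q z0" using to_z0 hom_obj[OF \<pi>(1)] by blast
  obtain tP where tP: "tP \<in> Hom M P z0" using to_z0 hom_obj[OF a(1)] by blast
  obtain zC where zC: "zC \<in> Hom M z0 C" using from_zero[OF zero_z0 obj(1)] by blast
  note zt = comp_hom[OF tQ zC]
  have Ep: "e \<cdot> (g \<cdot> \<pi>) = p \<cdot> (k \<cdot> \<pi>)" using comp_cancel[OF E g e(1) k a(2) \<pi>(1)] .
  \<comment> \<open>The hypothesis will be applied to \<open>g \<cdot> \<pi>\<close> and to the zero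
    arrow from \<open>Q\<close>. Both have the same composite with \<open>e\<close> in
    \<open>ho M\<close>, because that of the first passes through the contractible
    \<open>P\<close>.\<close>
  have ezt: "e \<cdot> (zC \<cdot> tQ) = (p \<cdot> a) \<cdot> (tP \<cdot> (k \<cdot> \<pi>))"
    using comp_cancel1[OF from_zero_unique[OF zero_z0 comp_hom[OF zC e(1)] comp_hom[OF a(1,2)]] zC e(1) tQ]
      to_z0_unique[OF tQ comp_hom[OF kp tP]] by simp
  note HKP = ho_arr_hom[OF kp] and HP = ho_arr_hom[OF a(2)] and HA = ho_arr_hom[OF a(1)] and HT =
      ho_arr_hom[OF tP]
  have "ho_arr M e \<odot> ho_arr M (zC \<cdot> tQ)
      = (ho_arr M p \<odot> ho_arr M a) \<odot> (ho_arr M tP \<odot> ho_arr M (k \<cdot> \<pi>))"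
    using ho_arr_comp[OF zt e(1)] ezt ho_arr_comp[OF comp_hom[OF kp tP] comp_hom[OF a(1,2)]]
      ho_arr_comp[OF a(1,2)] ho_arr_comp[OF kp tP] by simp
  also have "\<dots> = ho_arr M p \<odot> (ho_arr M a \<odot> (ho_arr M tP \<odot> ho_arr M (k \<cdot> \<pi>)))"
    using ho.comp_assoc[OF ho.comp_hom[OF HKP HT] HA HP] .
  also have "\<dots> = ho_arr M p \<odot> ho_arr M (k \<cdot> \<pi>)"
    using ho.comp_cancel1[OF contractible_ho_inv[OF a(1,5) tP] HT HA HKP] ho.ident_left[OF HKP] by simp
  also have "\<dots> = ho_arr M e \<odot> ho_arr M (g \<cdot> \<pi>)"
    using ho_arr_comp[OF kp a(2)] ho_arr_comp[OF gp e(1)] Ep by simp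
  finally have "ho_arr M d \<odot> ho_arr M (zC \<cdot> tQ) = ho_arr M d \<odot> ho_arr M (g \<cdot> \<pi>)"
    using hyp[OF ho_arr_hom[OF zt] ho_arr_hom[OF gp]] by blast
  then have "ho_arr M (d \<cdot> (zC \<cdot> tQ)) = ho_arr M (d \<cdot> (g \<cdot> \<pi>))"
    using ho_arr_comp[OF zt d] ho_arr_comp[OF gp d] by simp
  then have hm: "homotopic Q Y (d \<cdot> (zC \<cdot> tQ)) (d \<cdot> (g \<cdot> \<pi>))"
    using ho_arr_eqD[OF Q CXY(3) comp_hom[OF zt d] dgp] by blast
  have at: "p' \<cdot> (a' \<cdot> tQ) = d \<cdot> (zC \<cdot> tQ)"
    using comp_cancel[OF from_zero_unique[OF zero_z0 comp_hom[OF a'(1,2)] comp_hom[OF zC d]] a'(1,2) zC d tQ] .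
  obtain q i j t where gc: "good_cylinder Q q i j t" using good_cylinder_exists[OF Q] .
  have "cylinder Q q i j t" and ic: "i \<in> Cof M" using gc by (simp_all add: good_cylinder_def)
  note I = cylinderD[OF this(1)]
  obtain H where H: "H \<in> Hom M q Y" "H \<cdot> i = d \<cdot> (zC \<cdot> tQ)" "H \<cdot> j = d \<cdot> (g \<cdot> \<pi>)"
    using homotopic_good[OF hm gc CXY(3)] .
  have "p' \<cdot> (a' \<cdot> tQ) = H \<cdot> i" using at H(2) by simp
  then obtain K where K: "K \<in> Hom M q P'" "p' \<cdot> K = H"
    using has_liftE[OF lift_fib[OF ic I(7) a'(6)] I(1) a'(2) comp_hom[OF tQ a'(1)] H(1)] by metis
  \<comment> \<open>\<open>m\<close> is the end of the lifted null homotopy: it sends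
    \<open>Q\<close> to the path object of \<open>Y\<close>, over
    \<open>d \<cdot> (g \<cdot> \<pi>)\<close>.\<close>
  define m where "m = K \<cdot> j"
  have m: "m \<in> Hom M Q P'" "p' \<cdot> m = d \<cdot> (g \<cdot> \<pi>)"
    using comp_hom[OF I(2) K(1)] comp_cancel1[OF K(2,1) a'(2) I(2)] H(3) by (simp_all add: m_def)
  note ms = comp_hom[OF s'(1) m(1)]
  have gps: "(g \<cdot> \<pi>) \<cdot> s' = g \<cdot> s" using comp_assoc[OF s'(1) \<pi>(1) g] s'(2) by simp
  have kps: "(k \<cdot> \<pi>) \<cdot> s' = k \<cdot> s" using comp_assoc[OF s'(1) \<pi>(1) k] s'(2) by simp
  have pms: "p' \<cdot> (m \<cdot> s') = d \<cdot> (g \<cdot> s)" using comp_cancel[OF m(2,1) a'(2) gp d s'(1)] gps by simp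
  have pks: "p \<cdot> (k \<cdot> s) = e \<cdot> (g \<cdot> s)" using comp_cancel[OF E g e(1) k a(2) c(2)] by simp
  obtain R r0 r1 where pbR: "is_pullback M p p r0 r1" and r: "r0 \<in> Hom M R P" "r1 \<in> Hom M R P"
    using pullbackE[OF finite_limits a(2) a(2)] .
  obtain R' y0 y1 where pbR': "is_pullback M p' p' y0 y1" and y: "y0 \<in> Hom M R' P'" "y1 \<in> Hom M R' P'"
    using pullbackE[OF finite_limits a'(2) a'(2)] .
  obtain S c0 c1 where pbS: "is_pullback M (g \<cdot> s) (g \<cdot> s) c0 c1" and cc: "c0 \<in> Hom M S D" "c1 \<in> Hom M S D"
    using pullbackE[OF finite_limits gs gs] .
  obtain L l0 l1 where pbL: "is_pullback M (g \<cdot> \<pi>) (g \<cdot> s) l0 l1" and l: "l0 \<in> Hom M L Q" "l1 \<in> Hom M L D"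
    using pullbackE[OF finite_limits gp gs] .
  have src: "Src M r0 = R" "Src M y0 = R'" "Src M c0 = S" "Src M l0 = L"
    using HomD(2)[OF r(1)] HomD(2)[OF y(1)] HomD(2)[OF cc(1)] HomD(2)[OF l(1)] .
  have Lsq: "(g \<cdot> \<pi>) \<cdot> l0 = (g \<cdot> s) \<cdot> l1" using is_pullbackD(1)[OF pbL] .
  have "p \<cdot> ((k \<cdot> \<pi>) \<cdot> l0) = p \<cdot> ((k \<cdot> s) \<cdot> l1)"
    using comp_cancel[OF Ep gp e(1) kp a(2) l(1)] comp_cancel[OF pks ks a(2) gs e(1) l(2)] Lsq by simp
  then obtain \<rho> where \<rho>: "\<rho> \<in> Hom M L R" "r0 \<cdot> \<rho> = (k \<cdot> \<pi>) \<cdot> l0" "r1 \<cdot> \<rho> = (k \<cdot> s) \<cdot> l1"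
    using is_pullback_lift[OF pbR, of "(k \<cdot> \<pi>) \<cdot> l0" L "(k \<cdot> s) \<cdot> l1"] comp_hom[OF l(1) kp] comp_hom[OF l(2) ks]
      HomD[OF a(2)] src by metis
  have rw: "\<rho> \<in> Weq M"
    using fibre_map_weq[OF e(1) a(2) pbF g k c(2) \<pi> ksf ksw pbR r pbL l \<rho>] .
  have "p' \<cdot> (m \<cdot> l0) = p' \<cdot> ((m \<cdot> s') \<cdot> l1)"
    using comp_cancel[OF m(2,1) a'(2) gp d l(1)] comp_cancel[OF pms ms a'(2) gs d l(2)] Lsq by simp
  then obtain \<mu> where \<mu>: "\<mu> \<in> Hom M L R'" "y0 \<cdot> \<mu> = m \<cdot> l0" "y1 \<cdot> \<mu> = (m \<cdot> s') \<cdot> l1"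
    using is_pullback_lift[OF pbR', of "m \<cdot> l0" L "(m \<cdot> s') \<cdot> l1"] comp_hom[OF l(1) m(1)] comp_hom[OF l(2) ms]
      HomD[OF a'(2)] src by metis
  \<comment> \<open>Loops of \<open>C\<close> map to \<open>L\<close> by \<open>\<nu>\<close>. Then
    \<open>\<rho> \<cdot> \<nu>\<close> and \<open>\<mu> \<cdot> \<nu>\<close> present the loops of
    \<open>e\<close> and of \<open>d\<close>, so the required factor is \<open>\<mu>\<close> after
    the inverse of \<open>\<rho>\<close>, up to \<theta>.\<close>
  have "(g \<cdot> \<pi>) \<cdot> (s' \<cdot> c0) = (g \<cdot> s) \<cdot> c1"
    using comp_cancel1[OF gps s'(1) gp cc(1)] is_pullbackD(1)[OF pbS] by simp
  then obtain \<nu> where \<nu>: "\<nu> \<in> Hom M S L" "l0 \<cdot> \<nu> = s' \<cdot> c0" "l1 \<cdot> \<nu> = c1"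
    using is_pullback_lift[OF pbL, of "s' \<cdot> c0" S c1] comp_hom[OF cc(1) s'(1)] cc(2) HomD[OF gp] HomD[OF
        gs] src by metis
  note i\<nu> = comp_hom[OF \<nu>(1) \<rho>(1)] and i\<mu> = comp_hom[OF \<nu>(1) \<mu>(1)]
  note id = ident_hom[OF obj(1)] ident_hom[OF obj(2)] ident_hom[OF obj(3)]
  have LC: "is_loop_object M C (Ident M C) (g \<cdot> s) (g \<cdot> s) c0 c1"
    using loop_objectI[OF zero_z0 c(1,5) gs gsf CXY(1) id(1) ident_model(3)[OF obj(1)] pbS] .
  have LX: "is_loop_object M X (Ident M X) p p r0 r1"
    using loop_objectI[OF zero_z0 a(1,5,2,6) CXY(2) id(2) ident_model(3)[OF obj(2)] pbR] .
  have LY: "is_loop_object M Y (Ident M Y) p' p' y0 y1"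
    using loop_objectI[OF zero_z0 a'(1,5,2,6) CXY(3) id(3) ident_model(3)[OF obj(3)] pbR'] .
  have nX: "\<theta> (Ident M X) p p r0 r1 \<odot> onArr \<Omega> (ho_arr M e)
      = ho_arr M (\<rho> \<cdot> \<nu>) \<odot> \<theta> (Ident M C) (g \<cdot> s) (g \<cdot> s) c0 c1"
  proof (rule theta_nat[OF LC LX e(1), of e "k \<cdot> s"])
    show "e \<in> Hom M (Tgt M (Ident M C)) (Tgt M (Ident M X))" "k \<cdot> s \<in> Hom M (Src M (g \<cdot> s)) (Src M p)"
      "\<rho> \<cdot> \<nu> \<in> Hom M (Src M c0) (Src M r0)"
      using e(1) ks i\<nu> obj src HomD[OF gs] HomD[OF a(2)] by simp_all
    show "e \<cdot> Ident M C = Ident M X \<cdot> e" using ident_left[OF e(1)] ident_right[OF e(1)] by simp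
    show "p \<cdot> (k \<cdot> s) = e \<cdot> (g \<cdot> s)" by (rule pks)
    show "r0 \<cdot> (\<rho> \<cdot> \<nu>) = (k \<cdot> s) \<cdot> c0"
      using comp_cancel[OF \<rho>(2,1) r(1) l(1) kp \<nu>(1)] \<nu>(2) comp_cancel1[OF kps s'(1) kp cc(1)] by simp
    show "r1 \<cdot> (\<rho> \<cdot> \<nu>) = (k \<cdot> s) \<cdot> c1"
      using comp_cancel[OF \<rho>(3,1) r(2) l(2) ks \<nu>(1)] \<nu>(3) by simp
  qed
  have nY: "\<theta> (Ident M Y) p' p' y0 y1 \<odot> onArr \<Omega> (ho_arr M d)
      = ho_arr M (\<mu> \<cdot> \<nu>) \<odot> \<theta> (Ident M C) (g \<cdot> s) (g \<cdot> s) c0 c1"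
  proof (rule theta_nat[OF LC LY d, of d "m \<cdot> s'"])
    show "d \<in> Hom M (Tgt M (Ident M C)) (Tgt M (Ident M Y))" "m \<cdot> s' \<in> Hom M (Src M (g \<cdot> s)) (Src M p')"
      "\<mu> \<cdot> \<nu> \<in> Hom M (Src M c0) (Src M y0)"
      using d ms i\<mu> obj src HomD[OF gs] HomD[OF a'(2)] by simp_all
    show "d \<cdot> Ident M C = Ident M Y \<cdot> d" using ident_left[OF d] ident_right[OF d] by simp
    show "p' \<cdot> (m \<cdot> s') = d \<cdot> (g \<cdot> s)" by (rule pms)
    show "y0 \<cdot> (\<mu> \<cdot> \<nu>) = (m \<cdot> s') \<cdot> c0"
      using comp_cancel[OF \<mu>(2,1) y(1) l(1) m(1) \<nu>(1)] \<nu>(2) comp_assoc[OF cc(1) s'(1) m(1)] by simp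
    show "y1 \<cdot> (\<mu> \<cdot> \<nu>) = (m \<cdot> s') \<cdot> c1"
      using comp_cancel[OF \<mu>(3,1) y(2) l(2) ms \<nu>(1)] \<nu>(3) by simp
  qed
  let ?X = "\<theta> (Ident M X) p p r0 r1" and ?Y = "\<theta> (Ident M Y) p' p' y0 y1" and ?C = "\<theta> (Ident M C) (g \<cdot> s)
      (g \<cdot> s) c0 c1"
  have TC: "?C \<in> Hom (ho M) (onObj \<Omega> C) S" using theta[OF LC] src by metis
  have TX: "?X \<in> Hom (ho M) (onObj \<Omega> X) R" using theta[OF LX] src by metis
  obtain \<theta>' where TY: "?Y \<in> Hom (ho M) (onObj \<Omega> Y) R'" "\<theta>' \<in> Hom (ho M) R' (onObj \<Omega> Y)"
    "\<theta>' \<odot> ?Y = Ident (ho M) (onObj \<Omega> Y)"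
    using theta[OF LY] src by metis
  note J = ho_inv[OF rw \<rho>(1)]
  note OE = loop_hom[OF ho_arr_hom[OF e(1)]] and OD = loop_hom[OF ho_arr_hom[OF d]]
  note N = ho_arr_hom[OF \<nu>(1)] and MU = ho_arr_hom[OF \<mu>(1)]
  note NT = ho.comp_hom[OF TC N]
  have "ho_inv \<rho> \<odot> (?X \<odot> onArr \<Omega> (ho_arr M e)) = ho_arr M \<nu> \<odot> ?C"
    using nX ho_arr_comp[OF \<nu>(1) \<rho>(1)] ho.comp_assoc[OF TC N ho_arr_hom[OF \<rho>(1)]]
      ho.comp_cancel1[OF J(2) ho_arr_hom[OF \<rho>(1)] J(1) NT] ho.ident_left[OF NT] by simp
  then have "ho_arr M \<mu> \<odot> (ho_inv \<rho> \<odot> (?X \<odot> onArr \<Omega> (ho_arr M e))) = ?Y \<odot> onArr \<Omega> (ho_arr M d)"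
    using nY ho_arr_comp[OF \<nu>(1) \<mu>(1)] ho.comp_assoc[OF TC N MU] by simp
  then have "\<theta>' \<odot> (ho_arr M \<mu> \<odot> (ho_inv \<rho> \<odot> (?X \<odot> onArr \<Omega> (ho_arr M e)))) = onArr \<Omega> (ho_arr M d)"
    using ho.comp_cancel1[OF TY(3,1,2) OD] ho.ident_left[OF OD] by simp
  moreover note XE = ho.comp_hom[OF TX J(1)]
  note ME = ho.comp_hom[OF XE MU]
  have "(\<theta>' \<odot> (ho_arr M \<mu> \<odot> (ho_inv \<rho> \<odot> ?X))) \<odot> onArr \<Omega> (ho_arr M e)
      = \<theta>' \<odot> (ho_arr M \<mu> \<odot> (ho_inv \<rho> \<odot> (?X \<odot> onArr \<Omega> (ho_arr M e))))"
    using ho.comp_assoc[OF OE ME TY(2)] ho.comp_assoc[OF OE XE MU] ho.comp_assoc[OF OE TX J(1)] by simp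
  ultimately show thesis using that[OF ho.comp_hom[OF ME TY(2)]] by simp
qed

text \<open>Reduction to the strict case. In \<open>ho M\<close> the object \<open>C\<close> is
  isomorphic, via \<open>\<gamma>\<close>, to a fibrant \<open>C2\<close> on which \<epsilon> and
  \<delta>, followed by fibrant replacement, are represented by arrows of \<open>M\<close>, the
  first of them a fibration.\<close>

theorem loop_factor:
  assumes e: "\<epsilon> \<in> Hom (ho M) C X" and d: "\<delta> \<in> Hom (ho M) C Y"
    and hyp: "\<And>V g h. g \<in> Hom (ho M) V C \<Longrightarrow> h \<in> Hom (ho M) V C \<Longrightarrow>
        \<epsilon> \<odot> g = \<epsilon> \<odot> h \<Longrightarrow> \<delta> \<odot> g = \<delta> \<odot> h"
  obtains u where "u \<in> Hom (ho M) (onObj \<Omega> X) (onObj \<Omega> Y)" "u \<odot> onArr \<Omega> \<epsilon> = onArr \<Omega> \<delta>"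
proof -
  have obj: "C \<in> Obj M" "X \<in> Obj M" "Y \<in> Obj M" using ho.hom_obj[OF e] ho.hom_obj[OF d] by simp_all
  obtain Q q where q: "q \<in> Hom M Q C" "q \<in> Fib M" "q \<in> Weq M" and Q: "cofibrant Q"
    using cofibrant_replacement[OF obj(1)] .
  have Qo: "Q \<in> Obj M" using hom_obj[OF q(1)] by blast
  obtain C1 i where i: "i \<in> Hom M Q C1" "i \<in> Cof M" "i \<in> Weq M" and C1: "is_fibrant M C1"
    using fibrant_replacement[OF Qo] .
  note FX = frep[OF obj(2)] and FY = frep[OF obj(3)]
  note hq = ho_arr_hom[OF q(1)] and hX = ho_arr_hom[OF FX(1)] and hY = ho_arr_hom[OF FY(1)]
  obtain m where m: "m \<in> Hom M Q (frob X)" "(ho_arr M (frep X) \<odot> \<epsilon>) \<odot> ho_arr M q = ho_arr M m"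
    using ho_arr_full[OF Q FX(4) ho.comp_hom[OF hq ho.comp_hom[OF e hX]]] .
  obtain n where n: "n \<in> Hom M Q (frob Y)" "(ho_arr M (frep Y) \<odot> \<delta>) \<odot> ho_arr M q = ho_arr M n"
    using ho_arr_full[OF Q FY(4) ho.comp_hom[OF hq ho.comp_hom[OF d hY]]] .
  obtain m1 where m1: "m1 \<in> Hom M C1 (frob X)" "m1 \<cdot> i = m" using fibrantE[OF FX(4) i(2,3,1) m(1)] .
  obtain n1 where n1: "n1 \<in> Hom M C1 (frob Y)" "n1 \<cdot> i = n" using fibrantE[OF FY(4) i(2,3,1) n(1)] .
  obtain C2 k f where k: "k \<in> Hom M C1 C2" "f \<in> Hom M C2 (frob X)" "m1 = f \<cdot> k" "k \<in> Cof M" "k \<in> Weq M"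
      "f \<in> Fib M"
    using factor_tcof_fib[OF m1(1)] .
  have C2: "is_fibrant M C2" using fib_fibrant[OF k(6,2) FX(4)] .
  obtain h where h: "h \<in> Hom M C2 (frob Y)" "h \<cdot> k = n1" using fibrantE[OF FY(4) k(4,5,1) n1(1)] .
  let ?k = "k \<cdot> i"
  have kw: "?k \<in> Hom M Q C2" "?k \<in> Weq M" using comp_hom[OF i(1) k(1)] weq_comp[OF i(1) k(1) i(3) k(5)] .
  have fk: "f \<cdot> ?k = m" "h \<cdot> ?k = n"
    using comp_cancel1[OF k(3)[symmetric] k(1,2) i(1)] m1(2) comp_cancel1[OF h(2) k(1) h(1) i(1)] n1(2)
        by simp_all
  note hk = ho_arr_hom[OF kw(1)] and Iq = ho_inv[OF q(3,1)] and Ik = ho_inv[OF kw(2,1)]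
  define \<gamma> where "\<gamma> = ho_arr M ?k \<odot> ho_inv q"
  define \<gamma>' where "\<gamma>' = ho_arr M q \<odot> ho_inv ?k"
  have \<gamma>: "\<gamma> \<in> Hom (ho M) C C2" "\<gamma>' \<in> Hom (ho M) C2 C"
    using ho.comp_hom[OF Iq(1) hk] ho.comp_hom[OF Ik(1) hq] by (simp_all add: \<gamma>_def \<gamma>'_def)
  have "\<gamma> \<odot> \<gamma>' = ho_arr M ?k \<odot> (ho_inv q \<odot> (ho_arr M q \<odot> ho_inv ?k))"
    unfolding \<gamma>_def \<gamma>'_def using ho.comp_assoc[OF ho.comp_hom[OF Ik(1) hq] Iq(1) hk] .
  then have gg: "\<gamma> \<odot> \<gamma>' = Ident (ho M) C2"
    using ho.comp_cancel1[OF Iq(2) hq Iq(1) Ik(1)] ho.ident_left[OF Ik(1)] Ik(3) by simp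
  have key: "ho_arr M a \<odot> \<gamma> = ho_arr M b \<odot> \<phi>"
    if a: "a \<in> Hom M C2 Z" and b: "b \<in> Hom M W Z" and \<phi>: "\<phi> \<in> Hom (ho M) C W"
      and eq: "(ho_arr M b \<odot> \<phi>) \<odot> ho_arr M q = ho_arr M (a \<cdot> ?k)" for a b \<phi> Z W
  proof -
    note b\<phi> = ho.comp_hom[OF \<phi> ho_arr_hom[OF b]]
    have "ho_arr M a \<odot> \<gamma> = ho_arr M (a \<cdot> ?k) \<odot> ho_inv q"
      unfolding \<gamma>_def using ho.comp_assoc[OF Iq(1) hk ho_arr_hom[OF a]] ho_arr_comp[OF kw(1) a] by simp
    also have "\<dots> = (ho_arr M b \<odot> \<phi>) \<odot> (ho_arr M q \<odot> ho_inv q)"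
      using ho.comp_assoc[OF Iq(1) hq b\<phi>] eq by simp
    also have "\<dots> = ho_arr M b \<odot> \<phi>" using Iq(3) ho.ident_right[OF b\<phi>] by simp
    finally show ?thesis .
  qed
  have ke: "ho_arr M f \<odot> \<gamma> = ho_arr M (frep X) \<odot> \<epsilon>"
    using key[OF k(2) FX(1) e] m(2) fk(1) by simp
  have kd: "ho_arr M h \<odot> \<gamma> = ho_arr M (frep Y) \<odot> \<delta>"
    using key[OF h(1) FY(1) d] n(2) fk(2) by simp
  note hf = ho_arr_hom[OF k(2)] and hh = ho_arr_hom[OF h(1)]
  \<comment> \<open>Inserting \<open>\<gamma> \<odot> \<gamma>'\<close> turns tests on arrows into
    \<open>C2\<close> into tests on arrows into \<open>C\<close>, where the hypothesis
    applies.\<close>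
  have move: "ho_arr M f \<odot> a = ho_arr M (frep X) \<odot> (\<epsilon> \<odot> (\<gamma>' \<odot> a))"
    "ho_arr M h \<odot> a = ho_arr M (frep Y) \<odot> (\<delta> \<odot> (\<gamma>' \<odot> a))"
    if a: "a \<in> Hom (ho M) V C2" for a V
  proof -
    note ga = ho.comp_hom[OF a \<gamma>(2)]
    have "a = \<gamma> \<odot> (\<gamma>' \<odot> a)"
      using ho.comp_cancel1[OF gg \<gamma>(2,1) a] ho.ident_left[OF a] by simp
    then show "ho_arr M f \<odot> a = ho_arr M (frep X) \<odot> (\<epsilon> \<odot> (\<gamma>' \<odot> a))"
      "ho_arr M h \<odot> a = ho_arr M (frep Y) \<odot> (\<delta> \<odot> (\<gamma>' \<odot> a))"
      using ho.comp_cancel[OF ke \<gamma>(1) hf e hX ga] ho.comp_cancel[OF kd \<gamma>(1) hh d hY ga] by metis+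
  qed
  obtain u where u: "u \<in> Hom (ho M) (onObj \<Omega> (frob X)) (onObj \<Omega> (frob Y))"
    "u \<odot> onArr \<Omega> (ho_arr M f) = onArr \<Omega> (ho_arr M h)"
  proof (rule loop_factor_strict[OF C2 FX(4) FY(4) k(2,6) h(1)])
    fix V a b assume a: "a \<in> Hom (ho M) V C2" and b: "b \<in> Hom (ho M) V C2"
      and eq: "ho_arr M f \<odot> a = ho_arr M f \<odot> b"
    note ga = ho.comp_hom[OF a \<gamma>(2)] and gb = ho.comp_hom[OF b \<gamma>(2)]
    have "\<epsilon> \<odot> (\<gamma>' \<odot> a) = \<epsilon> \<odot> (\<gamma>' \<odot> b)"
      using ho_cancel_left[OF FX(3,1) ho.comp_hom[OF ga e] ho.comp_hom[OF gb e]] move(1)[OF a] move(1)[OF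
          b] eq by simp
    then have "\<delta> \<odot> (\<gamma>' \<odot> a) = \<delta> \<odot> (\<gamma>' \<odot> b)" by (rule hyp[OF ga gb])
    then show "ho_arr M h \<odot> a = ho_arr M h \<odot> b" using move(2)[OF a] move(2)[OF b] by simp
  qed (rule that)
  note IY = ho_inv[OF FY(3,1)]
  note LX = loop_hom[OF hX] and LY = loop_hom[OF hY] and LIY = loop_hom[OF IY(1)]
  note Le = loop_hom[OF e] and Ld = loop_hom[OF d] and L\<gamma> = loop_hom[OF \<gamma>(1)]
  have "u \<odot> (onArr \<Omega> (ho_arr M (frep X)) \<odot> onArr \<Omega> \<epsilon>) = onArr \<Omega> (ho_arr M (frep Y)) \<odot> onArr \<Omega> \<delta>"
    using ho.comp_cancel1[OF u(2) loop_hom[OF hf] u(1) L\<gamma>] ke kd loop_comp[OF e hX] loop_comp[OF d hY]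
      loop_comp[OF \<gamma>(1) hf] loop_comp[OF \<gamma>(1) hh] by simp
  then have "onArr \<Omega> (ho_inv (frep Y)) \<odot> (u \<odot> (onArr \<Omega> (ho_arr M (frep X)) \<odot> onArr \<Omega> \<epsilon>)) = onArr \<Omega> \<delta>"
    using ho.comp_cancel1[OF loop_comp[OF hY IY(1), symmetric] LY LIY Ld] IY(2) loop_ident[OF obj(3)]
        ho.ident_left[OF Ld]
    by simp
  moreover note uX = ho.comp_hom[OF LX u(1)]
  have "(onArr \<Omega> (ho_inv (frep Y)) \<odot> (u \<odot> onArr \<Omega> (ho_arr M (frep X)))) \<odot> onArr \<Omega> \<epsilon>
      = onArr \<Omega> (ho_inv (frep Y)) \<odot> (u \<odot> (onArr \<Omega> (ho_arr M (frep X)) \<odot> onArr \<Omega> \<epsilon>))"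
    using ho.comp_assoc[OF Le uX LIY] ho.comp_assoc[OF Le LX u(1)] by simp
  ultimately show thesis using that[OF ho.comp_hom[OF uX LIY]] by simp
qed

end

section \<open>Freyd's groups\<close>

lemma small_lepoll: "A \<lesssim> B \<Longrightarrow> small U B \<Longrightarrow> small U A"
  unfolding small_def by (rule lesspoll_trans1)

lemma small_imp_inj:
  assumes "small TYPE('u) (A :: 'x set)"
  obtains f :: "'x \<Rightarrow> 'u" where "inj_on f A" "small TYPE('u) (f ` A)"
proof -
  obtain f :: "'x \<Rightarrow> 'u" where f: "inj_on f A"
    using assms unfolding small_def lesspoll_def lepoll_def by blast
  then have "small TYPE('u) (f ` A)"
    using small_lepoll[OF image_lepoll assms] by blast
  then show thesis using that f by blast
qed

lemma small_Pow:
  assumes U: "universe TYPE('u)" and A: "small TYPE('u) (A :: 'x set)"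
  shows "small TYPE('u) (Pow A)"
proof -
  obtain f :: "'x \<Rightarrow> 'u" where f: "inj_on f A" "small TYPE('u) (f ` A)" using small_imp_inj[OF A] .
  then have "small TYPE('u) (Pow (f ` A))" using U unfolding universe_def by blast
  moreover have "Pow A \<lesssim> Pow (f ` A)"
    unfolding lepoll_def using inj_on_image_Pow[OF f(1)] by (intro exI[of _ "(`) f"]) auto
  ultimately show ?thesis using small_lepoll by blast
qed

text \<open>\<open>universe\<close> bounds small unions only inside \<open>'u\<close>. A pairing
  function, which exists as \<open>'u\<close> is infinite, places the rows of the product
  there.\<close>

lemma small_Times:
  assumes U: "universe TYPE('u)" and A: "small TYPE('u) (A :: 'x set)" and B: "small TYPE('u) (B :: 'y set)"
  shows "small TYPE('u) (A \<times> B)"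
proof -
  obtain f :: "'x \<Rightarrow> 'u" where f: "inj_on f A" "small TYPE('u) (f ` A)" using small_imp_inj[OF A] .
  obtain g :: "'y \<Rightarrow> 'u" where g: "inj_on g B" "small TYPE('u) (g ` B)" using small_imp_inj[OF B] .
  have "infinite (UNIV :: 'u set)"
    using U unfolding universe_def small_def lesspoll_def infinite_le_lepoll by blast
  then have "ordIso2 (card_of (UNIV \<times> UNIV :: ('u \<times> 'u) set)) (card_of (UNIV :: 'u set))"
    by (rule card_of_Times_same_infinite)
  then obtain h :: "'u \<times> 'u \<Rightarrow> 'u" where h: "inj h"
    unfolding card_of_ordIso[symmetric] bij_betw_def by auto
  have "small TYPE('u) (\<Union>i\<in>f ` A. h ` ({i} \<times> g ` B))"
  proof -
    have "small TYPE('u) (h ` ({i} \<times> g ` B))" for i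
    proof -
      have "h ` ({i} \<times> g ` B) = (\<lambda>b. h (i, b)) ` g ` B" by auto
      then show ?thesis using small_lepoll[OF image_lepoll g(2)] by simp
    qed
    then have "\<forall>i \<in> f ` A. small TYPE('u) (h ` ({i} \<times> g ` B))" by blast
    then show ?thesis
      by (rule U[unfolded universe_def, THEN conjunct2, THEN conjunct2, rule_format, OF conjI, OF f(2)])
  qed
  moreover have "A \<times> B \<lesssim> (\<Union>i\<in>f ` A. h ` ({i} \<times> g ` B))"
    unfolding lepoll_def
  proof (intro exI conjI)
    show "inj_on (\<lambda>p. h (f (fst p), g (snd p))) (A \<times> B)"
    proof (rule inj_onI)
      fix p q assume pq: "p \<in> A \<times> B" "q \<in> A \<times> B" "h (f (fst p), g (snd p)) = h (f (fst q), g (snd q))"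
      then have "f (fst p) = f (fst q)" "g (snd p) = g (snd q)" using injD[OF h] by blast+
      then show "p = q" using inj_onD[OF f(1)] inj_onD[OF g(1)] pq(1,2) by (auto simp: prod_eq_iff)
    qed
    show "(\<lambda>p. h (f (fst p), g (snd p))) ` (A \<times> B) \<subseteq> (\<Union>i\<in>f ` A. h ` ({i} \<times> g ` B))"
      by fastforce
  qed
  ultimately show ?thesis by (rule small_lepoll[rotated])
qed

lemma small_countable:
  assumes U: "universe TYPE('u)" and A: "countable A"
  shows "small TYPE('u) A"
proof -
  have "A \<lesssim> (UNIV :: nat set)" using A unfolding countable_def lepoll_def by blast
  then show ?thesis using U small_lepoll unfolding universe_def by blast
qed

text \<open>The cardinal well-order of \<open>UNIV\<close> has initial segments of strictly smaller
  cardinality. This makes \<open>'u\<close> a stand-in for the class of ordinals, while the group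
  built below any one index remains small.\<close>

lemma initial_segments_small:
  obtains R :: "'u rel" where "wf R" "trans R" "total R" "\<And>a. small TYPE('u) {b. (b, a) \<in> R}"
proof -
  let ?r = "card_of (UNIV :: 'u set)"
  have wo: "well_order_on UNIV ?r" by (rule card_of_well_order_on)
  have "small TYPE('u) {b. (b, a) \<in> ?r - Id}" for a
  proof -
    have "ordLess2 (card_of (underS ?r a)) ?r"
      using card_of_underS[OF card_of_Card_order[of UNIV]] by (simp add: Field_card_of)
    then have "\<not> underS ?r a \<approx> (UNIV :: 'u set)"
      unfolding eqpoll_iff_card_of_ordIso by (rule not_ordLess_ordIso)
    moreover have "underS ?r a = {b. (b, a) \<in> ?r - Id}" by (auto simp: underS_def)
    ultimately show ?thesis
      unfolding small_def lesspoll_def by (simp add: subset_imp_lepoll)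
  qed
  moreover have "wf (?r - Id)" "trans (?r - Id)" "total (?r - Id)"
    using wo unfolding well_order_on_def linear_order_on_def partial_order_on_def preorder_on_def
    by (auto simp: trans_diff_Id total_on_def)
  ultimately show thesis using that by blast
qed

section \<open>Transport of groups into the universe\<close>

lemma code_inj:
  assumes "small TYPE('u) (S :: 'x set)"
  shows "inj_on (code S :: 'x \<Rightarrow> 'u) S"
proof -
  obtain f :: "'x \<Rightarrow> 'u" where "inj_on f S" using small_imp_inj[OF assms] .
  then show ?thesis unfolding code_def by (metis someI_ex)
qed

lemma decode_code:
  assumes "small TYPE('u) (S :: 'x set)" "x \<in> S"
  shows "decode S (code S x :: 'u) = x"
  unfolding decode_def using inv_into_f_f[OF code_inj[OF assms(1)] assms(2)] .

lemma group_copy_simps: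
  "carrier (group_copy G) = code (carrier G) ` carrier G"
  "\<one>\<^bsub>group_copy G\<^esub> = code (carrier G) \<one>\<^bsub>G\<^esub>"
  by (simp_all add: group_copy_def)

lemma group_copy_mult:
  assumes "small TYPE('u) (carrier (G :: 'x monoid))" "x \<in> carrier G" "y \<in> carrier G"
  shows "(code (carrier G) x :: 'u) \<otimes>\<^bsub>group_copy G\<^esub> code (carrier G) y = code (carrier G) (x \<otimes>\<^bsub>G\<^esub> y)"
  by (simp add: group_copy_def decode_code[OF assms(1)] assms)

lemma comm_group_copy:
  assumes "comm_group G" and s: "small TYPE('u) (carrier (G :: 'x monoid))"
  shows "comm_group (group_copy G :: 'u monoid)"
proof -
  interpret comm_group G by fact
  show ?thesis
  proof (rule comm_groupI; unfold group_copy_simps)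
    fix x assume "x \<in> (code (carrier G) :: 'x \<Rightarrow> 'u) ` carrier G"
    then obtain a where a: "a \<in> carrier G" "x = code (carrier G) a" by blast
    then have "(code (carrier G) (inv\<^bsub>G\<^esub> a) :: 'u) \<otimes>\<^bsub>group_copy G\<^esub> x = code (carrier G) \<one>\<^bsub>G\<^esub>"
      using group_copy_mult[OF s, of "inv\<^bsub>G\<^esub> a" a] by simp
    then show "\<exists>y\<in>code (carrier G) ` carrier G. y \<otimes>\<^bsub>group_copy G\<^esub> x = code (carrier G) \<one>\<^bsub>G\<^esub>"
      using a by blast
  qed (auto simp: group_copy_mult[OF s] m_ac)
qed

section \<open>Trees of decreasing sequences\<close>

inductive node :: "'u rel \<Rightarrow> 'u \<Rightarrow> 'u list \<Rightarrow> bool" for R b where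
  node_root: "node R b [b]"
| node_Cons: "node R b t \<Longrightarrow> (d, hd t) \<in> R \<Longrightarrow> node R b (d # t)"

lemma node_not_Nil: "node R b t \<Longrightarrow> t \<noteq> []"
  by (induction rule: node.induct) auto

lemma node_ConsD: "node R b (d # t) \<Longrightarrow> t \<noteq> [] \<Longrightarrow> node R b t \<and> (d, hd t) \<in> R"
  by (cases rule: node.cases) auto

lemma node_suffix: "node R b (u @ t) \<Longrightarrow> t \<noteq> [] \<Longrightarrow> node R b t"
  by (induction u) (auto dest: node_ConsD)

lemma node_below:
  assumes "trans R"
  shows "node R b t \<Longrightarrow> x \<in> set (tl t) \<Longrightarrow> (hd t, x) \<in> R"
proof (induction arbitrary: x rule: node.induct)
  case (node_Cons t d)
  then show ?case
    using assms node_not_Nil[OF node_Cons(1)] by (cases t) (auto dest: transD)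
qed simp

lemma node_subset:
  assumes "trans R"
  shows "node R b t \<Longrightarrow> set t \<subseteq> insert b {x. (x, b) \<in> R}"
proof (induction rule: node.induct)
  case (node_Cons t d)
  have "hd t \<in> set t" using node_not_Nil[OF node_Cons(1)] by simp
  then have "(d, b) \<in> R" using node_Cons assms by (auto dest: transD)
  then show ?case using node_Cons by auto
qed simp

text \<open>The head is the least term, so a decreasing sequence can be recovered from its set of
  terms. This bounds the number of nodes by the number of subsets of an initial segment.\<close>

lemma node_inj:
  assumes R: "wf R" "trans R"
  shows "node R b t \<Longrightarrow> node R b t' \<Longrightarrow> set t = set t' \<Longrightarrow> t = t'"
proof (induction t arbitrary: t')
  case Nil
  then show ?case by simp
next
  case (Cons d t)
  obtain d' s where t': "t' = d' # s" using node_not_Nil[OF Cons.prems(2)] by (cases t') auto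
  have below: "(e, x) \<in> R" if "node R b (e # v)" "x \<in> set v" for e v x
    using node_below[OF R(2) that(1), of x] that(2) by simp
  have irr: "(e, e) \<notin> R" "\<not> ((e, e') \<in> R \<and> (e', e) \<in> R)" for e e'
    using R by (auto dest: wf_not_refl wf_asym)
  have dd: "d = d'"
  proof (rule ccontr)
    assume "d \<noteq> d'"
    then have "d \<in> set s" "d' \<in> set t" using Cons.prems(3) by (auto simp: t' set_eq_iff)
    then show False using below Cons.prems(1,2) irr(2)[of d d'] t' by blast
  qed
  have "d \<notin> set t" "d \<notin> set s"
    using below Cons.prems(1,2) irr(1)[of d] dd t' by blast+
  then have "set t = set s"
    using Cons.prems(3) dd t' by (simp add: insert_ident)
  moreover have "t = [] \<longleftrightarrow> s = []" using calculation by auto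
  ultimately show ?case
    using Cons.IH[of s] Cons.prems node_ConsD[of R b d t] node_ConsD[of R b d' s] dd t' by (cases "t = []") auto
qed

lemma small_nodes:
  assumes U: "universe TYPE('u)" and R: "wf R" "trans R" and s: "\<And>a :: 'u. small TYPE('u) {b. (b, a) \<in> R}"
  shows "small TYPE('u) {t. node R b t}"
proof -
  have root: "b \<in> set t" if "node R b t" for t
    using that by (induction rule: node.induct) auto
  have "{t. node R b t} \<lesssim> Pow {x. (x, b) \<in> R}"
    unfolding lepoll_def
  proof (intro exI conjI)
    show "inj_on (\<lambda>t. set t - {b}) {t. node R b t}"
    proof (rule inj_onI)
      fix t t' assume t: "t \<in> {t. node R b t}" "t' \<in> {t. node R b t}" "set t - {b} = set t' - {b}"
      then have "set t = set t'" using root[of t] root[of t'] by (metis insert_Diff mem_Collect_eq)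
      then show "t = t'" using node_inj[OF R] t(1,2) by blast
    qed
    show "(\<lambda>t. set t - {b}) ` {t. node R b t} \<subseteq> Pow {x. (x, b) \<in> R}"
      using node_subset[OF R(2)] by fastforce
  qed
  then show ?thesis by (rule small_lepoll) (rule small_Pow[OF U s])
qed

text \<open>Compatible generators of the finite subgroups of the Pruefer 2-group: each is the square
  of the next, and \<open>dyadic_root k\<close> has order \<open>2 ^ k\<close>.\<close>

definition dyadic_root :: "nat \<Rightarrow> complex" where
  "dyadic_root k = cis (2 * pi / 2 ^ k)"

lemma dyadic_root_simps: "dyadic_root 0 = 1" "dyadic_root (Suc 0) = -1" "dyadic_root (Suc k) ^ 2 =
    dyadic_root k"
  by (simp_all add: dyadic_root_def DeMoivre)

lemma dyadic_root_power: "dyadic_root k ^ 2 ^ k = 1"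
  by (induction k) (simp_all add: dyadic_root_simps power_mult)

text \<open>
  A group with an element of height exactly \<open>b\<close> (Freyd): finitely supported functions on the tree of
  decreasing sequences \<open>b > b\<^sub>1 > \<dots>\<close>, listed with the smallest term first, with values in the group
  of roots of unity of \<open>2\<close>-power order, such that squaring at a node gives the product over its children.
\<close>

definition height_group :: "'u rel \<Rightarrow> 'u \<Rightarrow> ('u list \<Rightarrow> complex) monoid" where
  "height_group R b = \<lparr>
     carrier = {y. finite {t. y t \<noteq> 1} \<and> (\<forall>t. y t \<noteq> 1 \<longrightarrow> node R b t) \<and> (\<forall>t. \<exists>k::nat. y t ^ 2 ^ k = 1) \<and>
       (\<forall>t. t \<noteq> [] \<longrightarrow> y t ^ 2 = (\<Prod>d. y (d # t)))},
     mult = (\<lambda>x y t. x t * y t), one = (\<lambda>t. 1)\<rparr>"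

lemma finite_children: "finite {t. y t \<noteq> (1::complex)} \<Longrightarrow> finite {d. y (d # t) \<noteq> 1}"
  using finite_vimageI[of "{t. y t \<noteq> 1}" "\<lambda>d. d # t"] by (simp add: vimage_def inj_def)

lemma height_groupD:
  assumes "y \<in> carrier (height_group R b)"
  shows "finite {t. y t \<noteq> 1}" "y t \<noteq> 1 \<Longrightarrow> node R b t" "\<exists>k::nat. y t ^ 2 ^ k = 1"
    "t \<noteq> [] \<Longrightarrow> y t ^ 2 = (\<Prod>d. y (d # t))"
  using assms by (auto simp: height_group_def)

lemma height_group_simps:
  "x \<otimes>\<^bsub>height_group R b\<^esub> y = (\<lambda>t. x t * y t)" "\<one>\<^bsub>height_group R b\<^esub> = (\<lambda>t. 1)"
  by (simp_all add: height_group_def)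

lemma comm_group_height_group: "comm_group (height_group R b)"
proof (rule comm_groupI; unfold height_group_simps)
  fix x y assume x: "x \<in> carrier (height_group R b)" and y: "y \<in> carrier (height_group R b)"
  note X = height_groupD[OF x] and Y = height_groupD[OF y]
  have "finite {t. x t * y t \<noteq> 1}"
    by (rule finite_subset[of _ "{t. x t \<noteq> 1} \<union> {t. y t \<noteq> 1}"]) (use X(1) Y(1) in auto)
  moreover have "node R b t" if "x t * y t \<noteq> 1" for t
    using X(2)[of t] Y(2)[of t] that by fastforce
  moreover have "\<exists>k::nat. (x t * y t) ^ 2 ^ k = 1" for t
  proof -
    obtain k l :: nat where "x t ^ 2 ^ k = 1" "y t ^ 2 ^ l = 1" using X(3) Y(3) by blast
    then have "(x t * y t) ^ 2 ^ (k + l) = 1"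
      by (simp add: power_mult_distrib power_add power_mult mult.commute[of "2 ^ k"] flip: power_mult)
        (metis mult.commute power_mult power_one mult_1)
    then show ?thesis by blast
  qed
  moreover have "(x t * y t) ^ 2 = (\<Prod>d. x (d # t) * y (d # t))" if "t \<noteq> []" for t
    using X(4)[OF that] Y(4)[OF that] Prod_any.distrib[OF finite_children[OF X(1)] finite_children[OF Y(1)]]
    by (simp add: power_mult_distrib)
  ultimately show "(\<lambda>t. x t * y t) \<in> carrier (height_group R b)"
    by (simp add: height_group_def)
next
  show "(\<lambda>t. 1) \<in> carrier (height_group R b)" by (simp add: height_group_def)
next
  fix x assume x: "x \<in> carrier (height_group R b)"
  note X = height_groupD[OF x]
  have ne: "x t \<noteq> 0" for t using X(3)[of t] by (auto simp: power_0_left)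
  have "(\<Prod>d. inverse (x (d # t))) = inverse (\<Prod>d. x (d # t))" for t
  proof -
    have "finite {d. inverse (x (d # t)) \<noteq> 1}" using finite_children[OF X(1)] by simp
    from Prod_any.distrib[OF this finite_children[OF X(1), of t]]
    have "(\<Prod>d. inverse (x (d # t))) * (\<Prod>d. x (d # t)) = 1" by (simp add: ne)
    then show ?thesis by (metis inverse_unique inverse_inverse_eq mult.commute)
  qed
  then have "(\<lambda>t. inverse (x t)) \<in> carrier (height_group R b)"
    using x by (auto simp: height_group_def power_inverse)
  then show "\<exists>y\<in>carrier (height_group R b). (\<lambda>t. y t * x t) = (\<lambda>t. 1)"
    using ne by (intro bexI[of _ "\<lambda>t. inverse (x t)"]) auto
qed (auto simp: mult_ac)

text \<open>An element is encoded by its graph away from the value 1, a set of pairs of a node and a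
  root of unity, and the possible values form a countable set.\<close>

lemma small_height_group:
  assumes U: "universe TYPE('u)" and N: "small TYPE('u) {t. node R (b :: 'u) t}"
  shows "small TYPE('u) (carrier (height_group R b))"
proof -
  define V where "V = {z :: complex. \<exists>k::nat. z ^ 2 ^ k = 1}"
  have "V = (\<Union>k::nat. {z. z ^ 2 ^ k = 1})" by (auto simp: V_def)
  moreover have "countable (\<Union>k::nat. {z::complex. z ^ 2 ^ k = 1})"
    by (rule countable_UN) (auto intro!: countable_finite finite_roots_unity)
  ultimately have "countable V" by simp
  then have V: "small TYPE('u) V" by (rule small_countable[OF U])
  have "carrier (height_group R b) \<lesssim> Pow ({t. node R b t} \<times> V)"
    unfolding lepoll_def
  proof (intro exI conjI)
    let ?g = "\<lambda>y. {(t, y t) |t. y t \<noteq> (1::complex)}"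
    show "inj_on ?g (carrier (height_group R b))"
    proof (rule inj_onI, rule ext)
      fix x y t assume e: "?g x = ?g y"
      have "x t \<noteq> 1 \<Longrightarrow> (t, x t) \<in> ?g y" unfolding e[symmetric] by simp
      then have 1: "x t \<noteq> 1 \<Longrightarrow> x t = y t" by force
      have "y t \<noteq> 1 \<Longrightarrow> (t, y t) \<in> ?g x" unfolding e by simp
      then have 2: "y t \<noteq> 1 \<Longrightarrow> x t = y t" by force
      show "x t = y t" by (metis 1 2)
    qed
    show "?g ` carrier (height_group R b) \<subseteq> Pow ({t. node R b t} \<times> V)"
      by (auto simp: V_def dest: height_groupD)
  qed
  then show ?thesis by (rule small_lepoll) (rule small_Pow[OF U small_Times[OF U N V]])
qed

text \<open>These correspond to the generators in a presentation of such a group: doubling the one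
  at a child gives the one at its parent. The value at \<open>s\<close> itself is -1, which is what
  \<open>Suc\<close> achieves; towards the root, along the nonempty suffixes of \<open>s\<close>,
  each value is a square root of the one before.\<close>

definition node_elt :: "'u list \<Rightarrow> 'u list \<Rightarrow> complex" where
  "node_elt s t = (if t \<noteq> [] \<and> (\<exists>u. s = u @ t) then dyadic_root (Suc (length s - length t)) else 1)"

lemma node_elt_carrier:
  assumes s: "node R b s"
  shows "node_elt s \<in> carrier (height_group R b)"
proof -
  have "{t. node_elt s t \<noteq> 1} \<subseteq> (\<lambda>n. drop n s) ` {..length s}"
  proof
    fix t assume "t \<in> {t. node_elt s t \<noteq> 1}"
    then obtain u where "s = u @ t" by (auto simp: node_elt_def split: if_splits)
    then have "t = drop (length u) s" "length u \<le> length s" by auto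
    then show "t \<in> (\<lambda>n. drop n s) ` {..length s}" by blast
  qed
  then have "finite {t. node_elt s t \<noteq> 1}" using finite_subset by blast
  moreover have "node R b t" if "node_elt s t \<noteq> 1" for t
    using that s node_suffix[of R b _ t] by (auto simp: node_elt_def split: if_splits)
  moreover have "\<exists>k::nat. node_elt s t ^ 2 ^ k = 1" for t
    using dyadic_root_power by (auto simp: node_elt_def)
  moreover have "node_elt s t ^ 2 = (\<Prod>d. node_elt s (d # t))" if t: "t \<noteq> []" for t
  proof (cases "\<exists>u. s = u @ t \<and> u \<noteq> []")
    case True
    then obtain u where u: "s = u @ t" "u \<noteq> []" by blast
    \<comment> \<open>Exactly one child of a proper ancestor \<open>t\<close> lies on the branch to
      \<open>s\<close>, namely the one reached by the last entry of \<open>u\<close>, so the product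
      over the children has a single nontrivial factor.\<close>
    have "node_elt s (d # t) = (if d = last u then dyadic_root (length s - length t) else 1)" for d
    proof (cases "d = last u")
      case True
      then have "\<exists>v. s = v @ d # t" using u by (intro exI[of _ "butlast u"]) simp
      then show ?thesis using True u by (simp add: node_elt_def Suc_diff_Suc)
    next
      case False
      have "s \<noteq> v @ d # t" for v
        using False u by (metis append.assoc append_Cons append_Nil append_same_eq last_snoc)
      then show ?thesis using False by (simp add: node_elt_def)
    qed
    then have "(\<Prod>d. node_elt s (d # t)) = dyadic_root (length s - length t)"
      by (simp only: Prod_any.delta)
    moreover have "node_elt s t = dyadic_root (Suc (length s - length t))"
      unfolding node_elt_def using t u(1) by (intro if_P) blast
    ultimately show ?thesis by (simp only: dyadic_root_simps)
  next
    case False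
    then have no: "s \<noteq> v @ d # t" for v d by (metis append.assoc append_Cons append_Nil snoc_eq_iff_butlast)
    have "node_elt s t ^ 2 = 1"
    proof (cases "s = t")
      case True
      then show ?thesis by (simp add: node_elt_def dyadic_root_simps)
    next
      case neq: False
      then have "\<nexists>u. s = u @ t" using False by (metis append_Nil)
      then show ?thesis by (simp add: node_elt_def)
    qed
    moreover have "node_elt s (d # t) = 1" for d using no by (simp add: node_elt_def)
    ultimately show ?thesis by simp
  qed
  ultimately show ?thesis by (simp add: height_group_def)
qed

lemma node_elt_double:
  assumes "s \<noteq> []"
  shows "node_elt (d # s) t ^ 2 = node_elt s t"
proof (cases "t \<noteq> [] \<and> (\<exists>u. s = u @ t)")
  case True
  then obtain u where "s = u @ t" by blast
  moreover have "d # u @ t = (d # u) @ t" by simp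
  ultimately show ?thesis
    using True by (auto simp: node_elt_def dyadic_root_simps Suc_diff_le simp del: append_Cons)
next
  case False
  then have "node_elt s t = 1" by (auto simp: node_elt_def)
  moreover have "node_elt (d # s) t ^ 2 = 1"
    using False by (auto simp: node_elt_def Cons_eq_append_conv dyadic_root_simps)
  ultimately show ?thesis by simp
qed

text \<open>Coordinates detect heights: the image of an element attached to head \<open>c\<close>
  must be trivial at every node whose head lies below \<open>c\<close>, by well-founded induction on
  \<open>c\<close>. For the two roots this contradicts the value -1 of \<open>node_elt [b]\<close>
  at \<open>[b]\<close>.\<close>

lemma no_height_decreasing_hom:
  assumes R: "wf R" and h: "h \<in> hom (height_group R a) (height_group R b)" and ba: "(b, a) \<in> R"
  shows "h (node_elt [a]) \<noteq> node_elt [b]"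
proof
  assume e: "h (node_elt [a]) = node_elt [b]"
  have "\<forall>s t. node R a s \<longrightarrow> hd s = c \<longrightarrow> t \<noteq> [] \<longrightarrow> (hd t, c) \<in> R \<longrightarrow> h (node_elt s) t = 1" for c
  proof (induction c rule: wf_induct_rule[OF R])
    case (1 c)
    show ?case
    proof (intro allI impI)
      fix s t assume s: "node R a s" "hd s = c" and t: "t \<noteq> []" "(hd t, c) \<in> R"
      \<comment> \<open>Since \<open>hd t\<close> lies below \<open>c\<close>,
        \<open>node_elt s\<close> is the square of the element at this child. In the target,
        squaring at \<open>t\<close> is a product over the children of \<open>t\<close>, whose heads
        are smaller still, so the induction hypothesis at \<open>hd t\<close> applies.\<close>
      let ?s = "hd t # s"
      have s': "node R a ?s" using node_Cons[OF s(1)] s(2) t(2) by simp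
      note C = node_elt_carrier[OF s']
      have "node_elt s = node_elt ?s \<otimes>\<^bsub>height_group R a\<^esub> node_elt ?s"
        using node_elt_double[OF node_not_Nil[OF s(1)], of "hd t"] by (auto simp: height_group_simps
            power2_eq_square)
      then have "h (node_elt s) = h (node_elt ?s) \<otimes>\<^bsub>height_group R b\<^esub> h (node_elt ?s)"
        using hom_mult[OF h C C] by simp
      then have "h (node_elt s) t = h (node_elt ?s) t ^ 2" by (simp add: height_group_simps power2_eq_square)
      also have "\<dots> = (\<Prod>d. h (node_elt ?s) (d # t))"
        using height_groupD(4)[OF hom_carrier[OF h, THEN subsetD] t(1)] C by blast
      also have "\<dots> = 1"
      proof -
        have "h (node_elt ?s) (d # t) = 1" for d
        proof (rule ccontr)
          assume ne: "h (node_elt ?s) (d # t) \<noteq> 1"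
          then have "node R b (d # t)"
            using height_groupD(2)[OF hom_carrier[OF h, THEN subsetD]] C by blast
          then have "(d, hd t) \<in> R" using node_ConsD t(1) by fast
          then show False using 1[OF t(2)] s' ne by simp
        qed
        then show ?thesis by simp
      qed
      finally show "h (node_elt s) t = 1" .
    qed
  qed
  then have "node_elt [b] [b] = 1" using node_root[of R a] ba e by (metis list.sel(1) not_Cons_self2)
  then show False by (simp add: node_elt_def dyadic_root_simps)
qed

text \<open>The group of order two, realized by complex signs so that \<open>sign_map\<close> can
  place a value directly at the root. A homomorphism out of it marks an element with trivial square,
  here the one whose height is the index.\<close>

definition sign_group :: "complex monoid" where
  "sign_group = \<lparr>carrier = {1, -1}, mult = (*), one = 1\<rparr>"

lemma comm_group_sign_group: "comm_group sign_group"
  by (rule comm_groupI) (auto simp: sign_group_def)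

definition sign_map :: "'u \<Rightarrow> complex \<Rightarrow> 'u list \<Rightarrow> complex" where
  "sign_map b z t = (if t = [b] then z else 1)"

lemma sign_map_minus: "sign_map b (-1) = node_elt [b]"
  by (auto simp: sign_map_def node_elt_def fun_eq_iff dyadic_root_simps Cons_eq_append_conv)

lemma sign_map_hom: "sign_map b \<in> hom sign_group (height_group R b)"
proof -
  have "sign_map b 1 = \<one>\<^bsub>height_group R b\<^esub>" by (auto simp: sign_map_def height_group_simps)
  moreover have "\<one>\<^bsub>height_group R b\<^esub> \<in> carrier (height_group R b)"
    using comm_group_height_group[of R b] by (simp add: comm_group_def comm_monoid_def group.is_monoid
        monoid.one_closed)
  ultimately have "sign_map b z \<in> carrier (height_group R b)" if "z \<in> carrier sign_group" for z
    using that node_elt_carrier[OF node_root] by (auto simp: sign_group_def sign_map_minus)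
  then show ?thesis
    by (auto simp: hom_def height_group_simps sign_group_def sign_map_def fun_eq_iff)
qed

text \<open>The conclusion names an unordered pair because the well-order on \<open>'u\<close> stays
  hidden: no map under \<open>C\<close> goes from the larger index to the smaller one, and either
  index may be the larger.\<close>

theorem many_groups:
  assumes U: "universe TYPE('u)"
  obtains C :: "'u monoid" and G :: "'u \<Rightarrow> 'u monoid" and f :: "'u \<Rightarrow> 'u \<Rightarrow> 'u" where
    "comm_group C" "small TYPE('u) (carrier C)" "\<And>i. comm_group (G i)" "\<And>i. small TYPE('u) (carrier (G i))"
    "\<And>i. f i \<in> hom C (G i)"
    "\<And>i j. i \<noteq> j \<Longrightarrow> \<exists>i' j'. {i', j'} = {i, j} \<and> \<not> (\<exists>h \<in> hom (G i') (G j'). \<forall>z \<in> carrier C. h (f i' z) = f j' z)"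
proof -
  obtain R :: "'u rel" where R: "wf R" "trans R" "total R" and seg: "\<And>a. small TYPE('u) {b. (b, a) \<in> R}"
    using initial_segments_small by metis
  let ?H = "\<lambda>i. height_group R i" and ?C = sign_group
  have sH: "small TYPE('u) (carrier (?H i))" for i
    using small_height_group[OF U small_nodes[OF U R(1,2) seg]] .
  have sC: "small TYPE('u) (carrier ?C)"
    by (rule small_countable[OF U]) (simp add: sign_group_def)
  define C :: "'u monoid" where "C = group_copy ?C"
  define G :: "'u \<Rightarrow> 'u monoid" where "G i = group_copy (?H i)" for i
  define f :: "'u \<Rightarrow> 'u \<Rightarrow> 'u" where "f i x = code (carrier (?H i)) (sign_map i (decode (carrier ?C) x))" for i x
  have fc: "f i (code (carrier ?C) z) = code (carrier (?H i)) (sign_map i z)" if "z \<in> carrier ?C" for i z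
    using decode_code[OF sC that] by (simp add: f_def)
  have sm: "sign_map i z \<in> carrier (?H i)" if "z \<in> carrier ?C" for i z
    using hom_carrier[OF sign_map_hom[of i R]] that by blast
  interpret C: comm_group ?C by (rule comm_group_sign_group)
  have sm': "small TYPE('u) (carrier C)" "small TYPE('u) (carrier (G i))" for i
    unfolding C_def G_def group_copy_simps by (rule small_lepoll[OF image_lepoll], rule sC sH)+
  have cg: "comm_group C" "comm_group (G i)" for i
    unfolding C_def G_def by (intro comm_group_copy comm_group_sign_group comm_group_height_group sC sH)+
  have fh: "f i \<in> hom C (G i)" for i
  proof (rule homI)
    fix x assume "x \<in> carrier C"
    then show "f i x \<in> carrier (G i)" by (auto simp: C_def G_def group_copy_simps fc sm)
  next
    fix x y assume "x \<in> carrier C" "y \<in> carrier C"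
    then obtain a b where ab: "a \<in> carrier ?C" "b \<in> carrier ?C" "x = code (carrier ?C) a" "y = code
        (carrier ?C) b"
      by (auto simp: C_def group_copy_simps)
    then show "f i (x \<otimes>\<^bsub>C\<^esub> y) = f i x \<otimes>\<^bsub>G i\<^esub> f i y"
      unfolding C_def G_def
      using group_copy_mult[OF sC ab(1,2)] fc C.m_closed[OF ab(1,2)] group_copy_mult[OF sH sm sm, OF ab(1,2)]
        hom_mult[OF sign_map_hom[of i R] ab(1,2)] by simp
  qed
  have no: "\<not> (\<exists>h \<in> hom (G i) (G j). \<forall>z \<in> carrier C. h (f i z) = f j z)" if "(j, i) \<in> R" for i j
  proof
    assume "\<exists>h \<in> hom (G i) (G j). \<forall>z \<in> carrier C. h (f i z) = f j z"
    then obtain h where h: "h \<in> hom (G i) (G j)" "\<forall>z \<in> carrier C. h (f i z) = f j z" by blast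
    \<comment> \<open>A homomorphism between the copies is read back as one between the original
      groups.\<close>
    define g where "g y = decode (carrier (?H j)) (h (code (carrier (?H i)) y))" for y
    have hc: "\<exists>w \<in> carrier (?H j). h (code (carrier (?H i)) y) = code (carrier (?H j)) w" if "y \<in> carrier
        (?H i)" for y
      using hom_carrier[OF h(1)] that unfolding G_def group_copy_simps by blast
    then have g: "g y \<in> carrier (?H j)" "h (code (carrier (?H i)) y) = code (carrier (?H j)) (g y)"
      if "y \<in> carrier (?H i)" for y
      using hc[OF that] decode_code[OF sH] unfolding g_def by auto
    have "g \<in> hom (?H i) (?H j)"
    proof (rule homI)
      fix x y assume xy: "x \<in> carrier (?H i)" "y \<in> carrier (?H i)"
      interpret Hi: comm_group "?H i" by (rule comm_group_height_group)
      interpret Hj: comm_group "?H j" by (rule comm_group_height_group)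
      have "h (code (carrier (?H i)) (x \<otimes>\<^bsub>?H i\<^esub> y)) = h (code (carrier (?H i)) x) \<otimes>\<^bsub>G j\<^esub> h (code (carrier
          (?H i)) y)"
        using hom_mult[OF h(1), of "code (carrier (?H i)) x" "code (carrier (?H i)) y"] xy
            group_copy_mult[OF sH xy]
        by (simp add: G_def group_copy_simps)
      also have "\<dots> = code (carrier (?H j)) (g x \<otimes>\<^bsub>?H j\<^esub> g y)"
        using g xy group_copy_mult[OF sH, of "g x" j "g y"] by (simp add: G_def)
      finally show "g (x \<otimes>\<^bsub>?H i\<^esub> y) = g x \<otimes>\<^bsub>?H j\<^esub> g y"
        using decode_code[OF sH Hj.m_closed] g(1) xy unfolding g_def by simp
    qed (rule g(1))
    moreover have "g (node_elt [i]) = node_elt [j]"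
    proof -
      have m: "-1 \<in> carrier ?C" by (simp add: sign_group_def)
      then have "h (f i (code (carrier ?C) (-1))) = f j (code (carrier ?C) (-1))"
        using h(2) by (simp add: C_def group_copy_simps)
      then have "h (code (carrier (?H i)) (node_elt [i])) = code (carrier (?H j)) (node_elt [j])"
        using fc[OF m] by (simp add: sign_map_minus)
      then show ?thesis
        unfolding g_def using decode_code[OF sH] node_elt_carrier[OF node_root] by metis
    qed
    ultimately show False using no_height_decreasing_hom[OF R(1) _ that] by blast
  qed
  have "\<exists>i' j'. {i', j'} = {i, j} \<and> \<not> (\<exists>h \<in> hom (G i') (G j'). \<forall>z \<in> carrier C. h (f i' z) = f j' z)"
    if "i \<noteq> j" for i j
  proof -
    have "(i, j) \<in> R \<or> (j, i) \<in> R" using R(3) that unfolding total_on_def by blast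
    then show ?thesis
    proof
      assume "(i, j) \<in> R"
      from no[OF this] show ?thesis by (intro exI[of _ j] exI[of _ i]) (simp add: insert_commute)
    next
      assume "(j, i) \<in> R"
      from no[OF this] show ?thesis by (intro exI[of _ i] exI[of _ j]) simp
    qed
  qed
  then show thesis by (rule that[OF cg(1) sm'(1) cg(2) sm'(2) fh])
qed

section \<open>Weak classifying objects\<close>

lemma group_cat_on_simps:
  "Obj (group_cat_on Gs) = Gs"
  "Hom (group_cat_on Gs) G H = {(G, f, H) | f. G \<in> Gs \<and> H \<in> Gs \<and> f \<in> hom G H \<and> f \<in> extensional (carrier G)}"
  "(H, g, K) \<cdot>\<^bsub>group_cat_on Gs\<^esub> (G, f, H') = (G, compose (carrier G) g f, K)"
 "Ident (group_cat_on Gs) G = (G, \<lambda>x\<in>carrier G. x, G)"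
  "Src (group_cat_on Gs) (G, f, H) = G" "Tgt (group_cat_on Gs) (G, f, H) = H"
  by (auto simp: group_cat_on_def Hom_def)

lemma category_group_cat_on:
  assumes "\<And>G. G \<in> Gs \<Longrightarrow> group G"
  shows "category (group_cat_on Gs)"
proof
  fix f assume "f \<in> Arr (group_cat_on Gs)"
  then show "Src (group_cat_on Gs) f \<in> Obj (group_cat_on Gs)" "Tgt (group_cat_on Gs) f \<in> Obj (group_cat_on Gs)"
    by (auto simp: group_cat_on_def)
next
  fix G assume "G \<in> Obj (group_cat_on Gs)"
  moreover from this have "group G" using assms by (simp add: group_cat_on_simps)
  ultimately show "Ident (group_cat_on Gs) G \<in> Hom (group_cat_on Gs) G G"
    by (auto simp: group_cat_on_def Hom_def hom_def group.is_monoid monoid.m_closed)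
next
  fix f g G H K assume fg: "f \<in> Hom (group_cat_on Gs) G H" "g \<in> Hom (group_cat_on Gs) H K"
  then have "group G" using assms by (auto simp: group_cat_on_simps)
  then show "g \<cdot>\<^bsub>group_cat_on Gs\<^esub> f \<in> Hom (group_cat_on Gs) G K"
    using fg by (auto simp: group_cat_on_simps hom_def compose_def Pi_def group.is_monoid monoid.m_closed)
next
  fix f G H assume "f \<in> Hom (group_cat_on Gs) G H"
  then show "Ident (group_cat_on Gs) H \<cdot>\<^bsub>group_cat_on Gs\<^esub> f = f" "f \<cdot>\<^bsub>group_cat_on Gs\<^esub> Ident
      (group_cat_on Gs) G = f"
    by (auto simp: group_cat_on_simps Id_compose compose_Id hom_def)
next
  fix f g h F G H K
  assume "f \<in> Hom (group_cat_on Gs) F G" "g \<in> Hom (group_cat_on Gs) G H" "h \<in> Hom (group_cat_on Gs) H K"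
  then show "(h \<cdot>\<^bsub>group_cat_on Gs\<^esub> g) \<cdot>\<^bsub>group_cat_on Gs\<^esub> f = h \<cdot>\<^bsub>group_cat_on Gs\<^esub> (g \<cdot>\<^bsub>group_cat_on Gs\<^esub> f)"
    by (auto simp: group_cat_on_simps hom_def intro: compose_assoc[symmetric])
qed

lemma functor_comp_simps [simp]:
  "onObj (functor_comp G F) x = onObj G (onObj F x)" "onArr (functor_comp G F) f = onArr G (onArr F f)"
  by (simp_all add: functor_comp_def)

lemma functor_id_simps [simp]: "onObj functor_id x = x" "onArr functor_id f = f"
  by (simp_all add: functor_id_def)

lemma is_functorD:
  assumes "is_functor C D F"
  shows "x \<in> Obj C \<Longrightarrow> onObj F x \<in> Obj D"
    "f \<in> Hom C x y \<Longrightarrow> onArr F f \<in> Hom D (onObj F x) (onObj F y)"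
    "f \<in> Hom C x y \<Longrightarrow> g \<in> Hom C y z \<Longrightarrow> onArr F (g \<cdot>\<^bsub>C\<^esub> f) = onArr F g \<cdot>\<^bsub>D\<^esub> onArr F f"
  using assms unfolding is_functor_def by blast+

text \<open>The composite of \<open>\<pi>\<close> and \<open>k\<close> is full by assumption and
  faithful as well: by naturality, arrows with equal images agree after precomposition with the
  epimorphism \<open>\<epsilon> c\<close> or after composition with the monomorphism
  \<open>\<eta> y\<close>. So a map under the image of \<open>c\<close> comes from a map under
  \<open>c\<close>.\<close>

lemma weak_classifying_reflects:
  assumes K: "category K" and wc: "weak_classifying H K \<pi> k"
    and f: "f \<in> Hom K c x" and g: "g \<in> Hom K c y"
    and \<phi>: "\<phi> \<in> Hom K (onObj \<pi> (onObj k x)) (onObj \<pi> (onObj k y))"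
      "\<phi> \<cdot>\<^bsub>K\<^esub> onArr \<pi> (onArr k f) = onArr \<pi> (onArr k g)"
  obtains v where "v \<in> Hom K x y" "v \<cdot>\<^bsub>K\<^esub> f = g"
proof -
  interpret category K by fact
  let ?T = "functor_comp \<pi> k"
  have fct: "is_functor H K \<pi>" "is_functor K H k" and full: "is_full K K ?T"
    using wc by (auto simp: weak_classifying_def right_weak_classifying_def left_weak_classifying_def)
  have T: "onArr ?T a \<in> Hom K (onObj ?T u) (onObj ?T v)" if "a \<in> Hom K u v" for a u v
    using is_functorD(2)[OF fct(1) is_functorD(2)[OF fct(2) that]] by simp
  have Tc: "onArr ?T (b \<cdot>\<^bsub>K\<^esub> a) = onArr ?T b \<cdot>\<^bsub>K\<^esub> onArr ?T a" if "a \<in> Hom K u v" "b \<in> Hom K v w" for a b u v w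
    using is_functorD(3)[OF fct(2) that] is_functorD(3)[OF fct(1) is_functorD(2)[OF fct(2) that(1)]
        is_functorD(2)[OF fct(2) that(2)]]
    by simp
  note obj = hom_obj[OF f] hom_obj[OF g]
  have "\<forall>p \<in> Hom K (onObj ?T x) (onObj ?T y). \<exists>v \<in> Hom K x y. onArr ?T v = p"
    using full obj unfolding is_full_def by blast
  then obtain v where v: "v \<in> Hom K x y" "onArr ?T v = \<phi>" using \<phi>(1) by auto
  note vf = comp_hom[OF f v(1)]
  have e: "onArr ?T (v \<cdot>\<^bsub>K\<^esub> f) = onArr ?T g" using Tc[OF f v(1)] v(2) \<phi>(2) by simp
  have "v \<cdot>\<^bsub>K\<^esub> f = g"
    using wc unfolding weak_classifying_def
  proof
    assume "right_weak_classifying H K \<pi> k"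
    then obtain \<epsilon> where nat: "is_nat_trans K K ?T functor_id \<epsilon>" and epi: "\<forall>x \<in> Obj K. is_epi K (\<epsilon> x)"
      by (auto simp: right_weak_classifying_def)
    have h: "\<epsilon> c \<in> Hom K (onObj ?T c) c" and n: "\<And>a b. a \<in> Hom K c b \<Longrightarrow> \<epsilon> b \<cdot>\<^bsub>K\<^esub> onArr ?T a = a \<cdot>\<^bsub>K\<^esub> \<epsilon> c"
      using nat obj(1) unfolding is_nat_trans_def by auto
    have "(v \<cdot>\<^bsub>K\<^esub> f) \<cdot>\<^bsub>K\<^esub> \<epsilon> c = g \<cdot>\<^bsub>K\<^esub> \<epsilon> c" using n[OF vf] n[OF g] e by simp
    moreover have "is_epi K (\<epsilon> c)" using epi obj(1) by blast
    ultimately show ?thesis using vf g unfolding is_epi_def HomD(3)[OF h] by blast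
  next
    assume "left_weak_classifying H K \<pi> k"
    then obtain \<eta> where nat: "is_nat_trans K K functor_id ?T \<eta>" and mono: "\<forall>x \<in> Obj K. is_mono K (\<eta> x)"
      by (auto simp: left_weak_classifying_def)
    have h: "\<eta> y \<in> Hom K y (onObj ?T y)" and n: "\<And>a. a \<in> Hom K c y \<Longrightarrow> \<eta> y \<cdot>\<^bsub>K\<^esub> a = onArr ?T a \<cdot>\<^bsub>K\<^esub> \<eta> c"
      using nat obj(4) unfolding is_nat_trans_def by auto
    have "\<eta> y \<cdot>\<^bsub>K\<^esub> (v \<cdot>\<^bsub>K\<^esub> f) = \<eta> y \<cdot>\<^bsub>K\<^esub> g" using n[OF vf] n[OF g] e by simp
    moreover have "is_mono K (\<eta> y)" using mono obj(4) by blast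
    ultimately show ?thesis using vf g unfolding is_mono_def HomD(2)[OF h] by blast
  qed
  then show thesis using that v(1) by blast
qed

section \<open>Homotopy groups and maps between loop objects\<close>

context loop_functor
begin

lemma loop_iter_hom:
  "\<phi> \<in> Hom (ho M) x y \<Longrightarrow> (onArr \<Omega> ^^ m) \<phi> \<in> Hom (ho M) ((onObj \<Omega> ^^ m) x) ((onObj \<Omega> ^^ m) y)"
  by (induction m) (auto intro: loop_hom)

lemma loop_iter_comp:
  assumes "\<phi> \<in> Hom (ho M) x y" "\<psi> \<in> Hom (ho M) y z"
  shows "(onArr \<Omega> ^^ m) (\<psi> \<odot> \<phi>) = (onArr \<Omega> ^^ m) \<psi> \<odot> (onArr \<Omega> ^^ m) \<phi>"
  by (induction m) (simp_all add: loop_comp[OF loop_iter_hom[OF assms(1)] loop_iter_hom[OF assms(2)]])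

text \<open>Smallness makes \<open>code\<close> injective on the homotopy groups; otherwise
  \<open>group_copy\<close> could identify elements. The bound comes from composing with
  replacements on both sides, which is injective and lands among arrows represented in
  \<open>M\<close>.\<close>

lemma ho_locally_small:
  assumes ls: "locally_small TYPE('u) M" and x: "x \<in> Obj M" and y: "y \<in> Obj M"
  shows "small TYPE('u) (Hom (ho M) x y)"
proof -
  obtain q p where p: "p \<in> Hom M q x" "p \<in> Fib M" "p \<in> Weq M" and q: "cofibrant q"
    using cofibrant_replacement[OF x] .
  obtain r i where i: "i \<in> Hom M y r" "i \<in> Cof M" "i \<in> Weq M" and r: "is_fibrant M r"
    using fibrant_replacement[OF y] .
  note hp = ho_arr_hom[OF p(1)] and hi = ho_arr_hom[OF i(1)]
  have "small TYPE('u) (Hom M q r)"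
    using ls q fibrant_obj[OF r] unfolding locally_small_def cofibrant_def by blast
  moreover have "Hom (ho M) x y \<lesssim> ho_arr M ` Hom M q r"
    unfolding lepoll_def
  proof (intro exI conjI)
    let ?F = "\<lambda>\<phi>. (ho_arr M i \<odot> \<phi>) \<odot> ho_arr M p"
    show "inj_on ?F (Hom (ho M) x y)"
    proof (rule inj_onI)
      fix \<phi> \<psi> assume h: "\<phi> \<in> Hom (ho M) x y" "\<psi> \<in> Hom (ho M) x y" and e: "?F \<phi> = ?F \<psi>"
      show "\<phi> = \<psi>"
        using ho_cancel_left[OF i(3,1) h] ho_cancel_right[OF p(3,1) ho.comp_hom[OF h(1) hi]
            ho.comp_hom[OF h(2) hi] e] by blast
    qed
    show "?F ` Hom (ho M) x y \<subseteq> ho_arr M ` Hom M q r"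
    proof
      fix \<chi> assume "\<chi> \<in> ?F ` Hom (ho M) x y"
      then have "\<chi> \<in> Hom (ho M) q r" using ho.comp_hom[OF hp ho.comp_hom[OF _ hi]] by blast
      then show "\<chi> \<in> ho_arr M ` Hom M q r" using ho_arr_full[OF q r] by blast
    qed
  qed
  ultimately show ?thesis by (meson small_lepoll image_lepoll)
qed

text \<open>
  Since \<open>n \<ge> 2\<close>, a map \<open>\<Omega> X \<rightarrow> \<Omega> Y\<close> which is not itself a loop map still induces a homomorphism
  \<open>\<pi>\<^sub>n X = \<pi>\<^sub>n\<^sub>-\<^sub>1 (\<Omega> X) \<rightarrow> \<pi>\<^sub>n\<^sub>-\<^sub>1 (\<Omega> Y) = \<pi>\<^sub>n Y\<close>.
\<close>

lemma pi_factor: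
  fixes Gs :: "'u monoid set"
  assumes ls: "locally_small TYPE('u) M" and n: "n \<ge> 2" and A: "A \<in> Obj M"
    and fct: "is_functor (ho M) (group_cat_on Gs) (pi_functor M \<Omega> \<theta> A n)"
    and \<epsilon>: "\<epsilon> \<in> Hom (ho M) C X" and \<delta>: "\<delta> \<in> Hom (ho M) C Y"
    and u: "u \<in> Hom (ho M) (onObj \<Omega> X) (onObj \<Omega> Y)" "u \<odot> onArr \<Omega> \<epsilon> = onArr \<Omega> \<delta>"
  defines "PF \<equiv> (pi_functor M \<Omega> \<theta> A n :: ('o, ('o, 'a) fraction, 'u monoid, 'u monoid \<times> ('u \<Rightarrow> 'u) \<times> 'u
      monoid) cat_functor)"
  shows "\<exists>\<phi> \<in> Hom (group_cat_on Gs) (onObj PF X) (onObj PF Y). \<phi> \<cdot>\<^bsub>group_cat_on Gs\<^esub> onArr PF \<epsilon> = onArr PF \<delta>"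
proof -
  obtain m where m: "n = Suc (Suc m)" using n by (metis add_2_eq_Suc le_Suc_ex)
  define Hg where "Hg = homotopy_group M \<Omega> \<theta> A n"
  \<comment> \<open>Two loops are split off from \<open>n\<close>: the one already absorbed in
    \<open>u\<close>, and the outermost one, which is applied to \<open>w\<close> and carries the
    multiplication. For \<open>n = 2\<close> the arrow \<open>w\<close> is \<open>u\<close>
    itself.\<close>
  define w where "w = (onArr \<Omega> ^^ m) u"
  have obj: "C \<in> Obj M" "X \<in> Obj M" "Y \<in> Obj M" using ho.hom_obj[OF \<epsilon>] ho.hom_obj[OF \<delta>] by simp_all
  have iter: "(onObj \<Omega> ^^ Suc m) x = (onObj \<Omega> ^^ m) (onObj \<Omega> x)" for x by (simp add: funpow_swap1)
  have itera: "(onArr \<Omega> ^^ Suc m) x = (onArr \<Omega> ^^ m) (onArr \<Omega> x)" for x by (simp add: funpow_swap1)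
  define S where "S x = onObj \<Omega> ((onObj \<Omega> ^^ Suc m) x)" for x
  have S: "S x \<in> Obj M" if "x \<in> Obj M" for x
  proof -
    have "(onObj \<Omega> ^^ k) x \<in> Obj M" for k by (induction k) (auto intro: loop_obj that)
    then show ?thesis unfolding S_def by (rule loop_obj)
  qed
  have car: "carrier (Hg x) = Hom (ho M) A (S x)" for x
    by (simp add: Hg_def homotopy_group_def loop_group_def S_def m)
  have mul: "a \<otimes>\<^bsub>Hg x\<^esub> b = loop_mult M \<Omega> \<theta> A ((onObj \<Omega> ^^ Suc m) x) a b" for a b x
    by (simp add: Hg_def homotopy_group_def loop_group_def m)
  have sm: "small TYPE('u) (carrier (Hg x))" if "x \<in> Obj M" for x
    unfolding car using ho_locally_small[OF ls A S[OF that]] .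
  have w: "w \<in> Hom (ho M) ((onObj \<Omega> ^^ Suc m) X) ((onObj \<Omega> ^^ Suc m) Y)"
    unfolding w_def iter using loop_iter_hom[OF u(1)] .
  have Ow: "onArr \<Omega> w \<in> Hom (ho M) (S X) (S Y)" using loop_hom[OF w] by (simp add: S_def)
  note mult = loop_multiplicative[OF w, of A, unfolded multiplicative_def, folded S_def]
  have oX: "onObj PF x = group_copy (Hg x)" for x by (simp add: PF_def pi_functor_def Hg_def)
  have aX: "onArr PF \<chi> = (group_copy (Hg C), \<lambda>x\<in>carrier (group_copy (Hg C)).
      code (carrier (Hg x')) ((onArr \<Omega> ^^ n) \<chi> \<odot> decode (carrier (Hg C)) x), group_copy (Hg x'))"
    if "\<chi> \<in> Hom (ho M) C x'" for \<chi> x'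
    using HomD[OF that] by (simp add: PF_def pi_functor_def Hg_def Let_def)
  have Gs: "group_copy (Hg X) \<in> Gs" "group_copy (Hg Y) \<in> Gs"
    using is_functorD(1)[OF fct] obj oX by (auto simp: PF_def group_cat_on_simps)
  define g where "g = (\<lambda>x\<in>carrier (group_copy (Hg X) :: 'u monoid).
      code (carrier (Hg Y)) (onArr \<Omega> w \<odot> decode (carrier (Hg X)) x) :: 'u)"
  have gc: "g (code (carrier (Hg X)) a) = code (carrier (Hg Y)) (onArr \<Omega> w \<odot> a)"
    if "a \<in> carrier (Hg X)" for a
    using that decode_code[OF sm[OF obj(2)] that] by (simp add: g_def group_copy_simps)
  have push: "onArr \<Omega> w \<odot> a \<in> carrier (Hg Y)" if "a \<in> carrier (Hg X)" for a
    using that ho.comp_hom[OF _ Ow] unfolding car by blast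
  have "g \<in> hom (group_copy (Hg X)) (group_copy (Hg Y))"
  proof (rule homI)
    fix x assume "x \<in> carrier (group_copy (Hg X) :: 'u monoid)"
    then show "g x \<in> carrier (group_copy (Hg Y))" using gc push by (auto simp: group_copy_simps)
  next
    fix x y assume "x \<in> carrier (group_copy (Hg X) :: 'u monoid)" "y \<in> carrier (group_copy (Hg X) :: 'u monoid)"
    then obtain a b where ab: "a \<in> carrier (Hg X)" "b \<in> carrier (Hg X)"
      "x = code (carrier (Hg X)) a" "y = code (carrier (Hg X)) b"
      by (auto simp: group_copy_simps)
    have "a \<otimes>\<^bsub>Hg X\<^esub> b \<in> carrier (Hg X)"
      "onArr \<Omega> w \<odot> (a \<otimes>\<^bsub>Hg X\<^esub> b) = (onArr \<Omega> w \<odot> a) \<otimes>\<^bsub>Hg Y\<^esub> (onArr \<Omega> w \<odot> b)"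
      using mult ab(1,2) unfolding car mul S_def by blast+
    then show "g (x \<otimes>\<^bsub>group_copy (Hg X)\<^esub> y) = g x \<otimes>\<^bsub>group_copy (Hg Y)\<^esub> g y"
      using group_copy_mult[OF sm[OF obj(2)] ab(1,2)] group_copy_mult[OF sm[OF obj(3)] push push, OF
          ab(1,2)] gc ab
      by simp
  qed
  then have \<phi>: "(group_copy (Hg X), g, group_copy (Hg Y)) \<in> Hom (group_cat_on Gs) (onObj PF X) (onObj PF Y)"
    using Gs by (simp add: group_cat_on_simps oX g_def)
  have fac: "onArr \<Omega> w \<odot> ((onArr \<Omega> ^^ n) \<epsilon> \<odot> a) = (onArr \<Omega> ^^ n) \<delta> \<odot> a"
    "(onArr \<Omega> ^^ n) \<epsilon> \<odot> a \<in> carrier (Hg X)"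
    if "a \<in> carrier (Hg C)" for a
  proof -
    have a: "a \<in> Hom (ho M) A (S C)" using that car by simp
    have E: "(onArr \<Omega> ^^ n) \<epsilon> \<in> Hom (ho M) (S C) (S X)"
      using loop_iter_hom[OF \<epsilon>, of n] by (simp add: S_def m)
    have "onArr \<Omega> w = (onArr \<Omega> ^^ Suc m) u" by (simp add: w_def)
    moreover have "(onArr \<Omega> ^^ n) \<chi> = (onArr \<Omega> ^^ Suc m) (onArr \<Omega> \<chi>)" for \<chi>
      unfolding m by (simp only: funpow_Suc_right o_apply)
    ultimately have "onArr \<Omega> w \<odot> (onArr \<Omega> ^^ n) \<epsilon> = (onArr \<Omega> ^^ n) \<delta>"
      using loop_iter_comp[OF loop_hom[OF \<epsilon>] u(1), of "Suc m"] u(2) by simp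
    then show "onArr \<Omega> w \<odot> ((onArr \<Omega> ^^ n) \<epsilon> \<odot> a) = (onArr \<Omega> ^^ n) \<delta> \<odot> a"
      by (rule ho.comp_cancel1[OF _ E Ow a])
    show "(onArr \<Omega> ^^ n) \<epsilon> \<odot> a \<in> carrier (Hg X)" unfolding car using ho.comp_hom[OF a E] .
  qed
  have "(group_copy (Hg X), g, group_copy (Hg Y)) \<cdot>\<^bsub>group_cat_on Gs\<^esub> onArr PF \<epsilon> = onArr PF \<delta>"
    unfolding aX[OF \<epsilon>] aX[OF \<delta>] group_cat_on_simps prod.inject
  proof (intro conjI refl ext)
    fix x :: 'u
    show "compose (carrier (group_copy (Hg C))) g (\<lambda>x\<in>carrier (group_copy (Hg C)).
        code (carrier (Hg X)) ((onArr \<Omega> ^^ n) \<epsilon> \<odot> decode (carrier (Hg C)) x)) x =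
      (\<lambda>x\<in>carrier (group_copy (Hg C)). code (carrier (Hg Y)) ((onArr \<Omega> ^^ n) \<delta> \<odot> decode (carrier (Hg C)) x)) x"
    proof (cases "x \<in> carrier (group_copy (Hg C) :: 'u monoid)")
      case True
      then obtain a where a: "a \<in> carrier (Hg C)" "x = code (carrier (Hg C)) a" by (auto simp: group_copy_simps)
      then have "decode (carrier (Hg C)) x = a" using decode_code[OF sm[OF obj(1)]] by simp
      then show ?thesis using True gc[OF fac(2)[OF a(1)]] fac(1)[OF a(1)] by (simp add: compose_def)
    qed (simp add: compose_def)
  qed
  then show ?thesis using \<phi> by blast
qed

end

text \<open>A functor preserves equality of the two composites, and a faithful one reflects it.
  Arrows of sets are extensional functions, so the comparison comes down to values on
  \<open>onObj F v\<close>.\<close>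

lemma Set_cat_kernel:
  assumes F: "is_functor C (Set_cat :: ('u set, 'u set \<times> ('u \<Rightarrow> 'u) \<times> 'u set) category) F"
    and faithful: "is_faithful C (Set_cat :: ('u set, 'u set \<times> ('u \<Rightarrow> 'u) \<times> 'u set) category) F"
    and C: "category C" and e: "e \<in> Hom C x y" and g: "g \<in> Hom C v x" and h: "h \<in> Hom C v x"
  defines "app \<equiv> \<lambda>e. fst (snd (onArr F e))"
  shows "e \<cdot>\<^bsub>C\<^esub> g = e \<cdot>\<^bsub>C\<^esub> h \<longleftrightarrow> (\<forall>a \<in> onObj F v. app e (app g a) = app e (app h a))"
    "a \<in> onObj F v \<Longrightarrow> app g a \<in> onObj F x"
proof -
  interpret category C by fact
  have tr: "onArr F f = (onObj F a, app f, onObj F b) \<and> app f \<in> onObj F a \<rightarrow>\<^sub>E onObj F b" if "f \<in> Hom C a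
      b" for f a b
    using is_functorD(2)[OF F that] unfolding app_def by (auto simp: Set_cat_def Hom_def)
  have cmp: "onArr F (e \<cdot>\<^bsub>C\<^esub> k) = (onObj F v, compose (onObj F v) (app e) (app k), onObj F y)" if "k \<in>
      Hom C v x" for k
    using is_functorD(3)[OF F that e] tr[OF that] tr[OF e] by (simp add: Set_cat_def)
  have inj: "inj_on (onArr F) (Hom C v y)"
    using faithful hom_obj[OF g] hom_obj[OF e] unfolding is_faithful_def by blast
  have "e \<cdot>\<^bsub>C\<^esub> g = e \<cdot>\<^bsub>C\<^esub> h \<longleftrightarrow> onArr F (e \<cdot>\<^bsub>C\<^esub> g) = onArr F (e \<cdot>\<^bsub>C\<^esub> h)"
    using inj_on_eq_iff[OF inj comp_hom[OF g e] comp_hom[OF h e]] by simp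
  also have "\<dots> \<longleftrightarrow> (\<forall>a \<in> onObj F v. app e (app g a) = app e (app h a))"
    unfolding cmp[OF g] cmp[OF h] by (auto simp: compose_def fun_eq_iff restrict_def)
  finally show "e \<cdot>\<^bsub>C\<^esub> g = e \<cdot>\<^bsub>C\<^esub> h \<longleftrightarrow> (\<forall>a \<in> onObj F v. app e (app g a) = app e (app h a))" .
  show "a \<in> onObj F v \<Longrightarrow> app g a \<in> onObj F x" using tr[OF g] by auto
qed

lemma (in category) faithful_kernels:
  fixes F :: "('o, 'a, 'u set, 'u set \<times> ('u \<Rightarrow> 'u) \<times> 'u set) cat_functor"
  assumes U: "universe TYPE('u)" and F: "is_functor C Set_cat F" "is_faithful C Set_cat F"
    and e: "\<And>i :: 'u. e i \<in> Hom C x (y i)"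
  obtains i j where "i \<noteq> j"
    "\<And>v g h. g \<in> Hom C v x \<Longrightarrow> h \<in> Hom C v x \<Longrightarrow> e i \<cdot> g = e i \<cdot> h \<longleftrightarrow> e j \<cdot> g = e j \<cdot> h"
proof -
  define app where "app = (\<lambda>e. fst (snd (onArr F e)))"
  define S where "S = onObj F x"
  define ker where "ker i = {(a, b) \<in> S \<times> S. app (e i) a = app (e i) b}" for i
  have "S \<in> Obj (Set_cat :: ('u set, 'u set \<times> ('u \<Rightarrow> 'u) \<times> 'u set) category)"
    unfolding S_def using is_functorD(1)[OF F(1)] hom_obj[OF e] by blast
  then have "small TYPE('u) S" by (simp add: Set_cat_def)
  then have sm: "small TYPE('u) (Pow (S \<times> S))" using small_Pow[OF U small_Times[OF U]] by blast
  \<comment> \<open>Pigeonhole: the indices range over all of \<open>'u\<close>, which is not small,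
    whereas the kernels lie in a small power set.\<close>
  have "\<not> inj ker"
  proof
    assume "inj ker"
    moreover have "range ker \<subseteq> Pow (S \<times> S)" by (auto simp: ker_def)
    ultimately have "(UNIV :: 'u set) \<lesssim> Pow (S \<times> S)" unfolding lepoll_def by blast
    then have "small TYPE('u) (UNIV :: 'u set)" using sm by (rule small_lepoll)
    then show False by (simp add: small_def)
  qed
  then obtain i j where ij: "i \<noteq> j" "ker i = ker j" unfolding inj_def by blast
  have kf: "e i \<cdot> g = e i \<cdot> h \<longleftrightarrow> (\<forall>a \<in> onObj F v. (app g a, app h a) \<in> ker i)"
    if g: "g \<in> Hom C v x" and h: "h \<in> Hom C v x" for i v g h
    using Set_cat_kernel[OF F category_axioms e g h] Set_cat_kernel(2)[OF F category_axioms e h g]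
    unfolding ker_def app_def S_def by auto
  show thesis by (rule that[OF ij(1)]) (simp add: kf ij(2))
qed

theorem theorem4p8:
  fixes M :: "('o, 'a) model"
    and \<Omega> :: "('o, 'a) ho_endo"
    and \<theta> :: "'a \<Rightarrow> 'a \<Rightarrow> 'a \<Rightarrow> 'a \<Rightarrow> 'a \<Rightarrow> ('o, 'a) fraction"
  assumes "universe TYPE('u)"
    and "pointed_model_category M"
    and "locally_small TYPE('u) M"
    and "is_loop_functor M \<Omega> \<theta>"
    and "\<exists>n \<ge> 2. \<exists>k :: ('u monoid, 'u monoid \<times> ('u \<Rightarrow> 'u) \<times> 'u monoid, 'o, ('o, 'a) fraction) cat_functor.
           weak_classifying_of_type M \<Omega> \<theta> n k"
  shows "\<not> concrete TYPE('u) (ho M)"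
proof
  interpret loop_functor M \<Omega> \<theta>
    using assms(2,4) by (simp add: loop_functor_def loop_functor_axioms_def)
  assume "concrete TYPE('u) (ho M)"
  then obtain F where F: "is_functor (ho M) (Set_cat :: ('u set, 'u set \<times> ('u \<Rightarrow> 'u) \<times> 'u set) category) F"
    "is_faithful (ho M) (Set_cat :: ('u set, 'u set \<times> ('u \<Rightarrow> 'u) \<times> 'u set) category) F"
    unfolding concrete_def by blast
  obtain n and k :: "('u monoid, 'u monoid \<times> ('u \<Rightarrow> 'u) \<times> 'u monoid, 'o, ('o, 'a) fraction) cat_functor" and A
    where n: "n \<ge> 2" and A: "A \<in> Obj M"
      and "weak_classifying (ho M) Grp_cat (pi_functor M \<Omega> \<theta> A n) k \<or>
           weak_classifying (ho M) Ab_cat (pi_functor M \<Omega> \<theta> A n) k"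
    using assms(5) unfolding weak_classifying_of_type_def by blast
  moreover have "{G :: 'u monoid. comm_group G \<and> small TYPE('u) (carrier G)} \<subseteq> {G. group G \<and> small
      TYPE('u) (carrier G)}"
    by (auto simp: comm_group_def)
  \<comment> \<open>Only two properties of the category are retained: its objects are groups, and
    all small abelian groups are among them. Both \<open>Grp_cat\<close> and \<open>Ab_cat\<close>
    qualify.\<close>
  ultimately obtain Gs :: "'u monoid set" where wc: "weak_classifying (ho M) (group_cat_on Gs)
      (pi_functor M \<Omega> \<theta> A n) k"
    and Gs: "\<And>G. G \<in> Gs \<Longrightarrow> group G" "\<And>G. comm_group G \<Longrightarrow> small TYPE('u) (carrier G) \<Longrightarrow> G \<in> Gs"
    unfolding Grp_cat_def Ab_cat_def by blast
  let ?K = "group_cat_on Gs" and ?\<pi> = "pi_functor M \<Omega> \<theta> A n :: ('o, ('o, 'a) fraction, 'u monoid, 'u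
      monoid \<times> ('u \<Rightarrow> 'u) \<times> 'u monoid) cat_functor"
  have fct: "is_functor (ho M) ?K ?\<pi>" "is_functor ?K (ho M) k"
    using wc by (auto simp: weak_classifying_def right_weak_classifying_def left_weak_classifying_def)
  obtain C :: "'u monoid" and G :: "'u \<Rightarrow> 'u monoid" and f :: "'u \<Rightarrow> 'u \<Rightarrow> 'u" where
    C: "comm_group C" "small TYPE('u) (carrier C)" and G: "\<And>i. comm_group (G i)" "\<And>i. small TYPE('u)
        (carrier (G i))"
    and f: "\<And>i. f i \<in> hom C (G i)"
    and no: "\<And>i j. i \<noteq> j \<Longrightarrow> \<exists>i' j'. {i', j'} = {i, j} \<and> \<not> (\<exists>h \<in> hom (G i') (G j'). \<forall>z \<in> carrier C. h (f i'
        z) = f j' z)"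
    by (rule many_groups[OF assms(1)]) (rule that)
  define a where "a i = (C, restrict (f i) (carrier C), G i)" for i
  have "restrict (f i) (carrier C) \<in> hom C (G i)" for i
    using f[of i] C(1) by (auto simp: hom_def comm_group_def group_def monoid.m_closed)
  then have a: "a i \<in> Hom ?K C (G i)" for i
    using Gs(2) C G by (simp add: group_cat_on_simps a_def)
  have ka: "onArr k (a i) \<in> Hom (ho M) (onObj k C) (onObj k (G i))" for i
    using is_functorD(2)[OF fct(2) a] .
  obtain i j where ij: "i \<noteq> j" and ker: "\<And>v g h. g \<in> Hom (ho M) v (onObj k C) \<Longrightarrow> h \<in> Hom (ho M) v (onObj k C) \<Longrightarrow>
      onArr k (a i) \<cdot>\<^bsub>ho M\<^esub> g = onArr k (a i) \<cdot>\<^bsub>ho M\<^esub> h \<longleftrightarrow> onArr k (a j) \<cdot>\<^bsub>ho M\<^esub> g = onArr k (a j) \<cdot>\<^bsub>ho M\<^esub> h"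
    by (rule ho.faithful_kernels[OF assms(1) F, of "\<lambda>i. onArr k (a i)", OF ka]) (rule that)
  obtain i' j' where ij': "{i', j'} = {i, j}" and no': "\<not> (\<exists>h \<in> hom (G i') (G j'). \<forall>z \<in> carrier C. h (f
      i' z) = f j' z)"
    using no[OF ij] by blast
  obtain u where u: "u \<in> Hom (ho M) (onObj \<Omega> (onObj k (G i'))) (onObj \<Omega> (onObj k (G j')))"
    "u \<cdot>\<^bsub>ho M\<^esub> onArr \<Omega> (onArr k (a i')) = onArr \<Omega> (onArr k (a j'))"
  proof (rule loop_factor[OF ka[of i'] ka[of j']])
    fix v g h assume gh: "g \<in> Hom (ho M) v (onObj k C)" "h \<in> Hom (ho M) v (onObj k C)"
      and eq: "onArr k (a i') \<cdot>\<^bsub>ho M\<^esub> g = onArr k (a i') \<cdot>\<^bsub>ho M\<^esub> h"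
    \<comment> \<open>Equality of kernels is symmetric, so the direction dictated by
      \<open>many_groups\<close> is available in either case.\<close>
    have "i' = i \<and> j' = j \<or> i' = j \<and> j' = i" using ij' by (auto simp: doubleton_eq_iff)
    then show "onArr k (a j') \<cdot>\<^bsub>ho M\<^esub> g = onArr k (a j') \<cdot>\<^bsub>ho M\<^esub> h" using ker[OF gh] eq by auto
  qed (rule that)
  obtain \<phi> where \<phi>: "\<phi> \<in> Hom ?K (onObj ?\<pi> (onObj k (G i'))) (onObj ?\<pi> (onObj k (G j')))"
    "\<phi> \<cdot>\<^bsub>?K\<^esub> onArr ?\<pi> (onArr k (a i')) = onArr ?\<pi> (onArr k (a j'))"
    using pi_factor[OF assms(3) n A fct(1) ka ka u] by blast
  obtain v where v: "v \<in> Hom ?K (G i') (G j')" "v \<cdot>\<^bsub>?K\<^esub> a i' = a j'"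
    using weak_classifying_reflects[OF category_group_cat_on wc a a \<phi>] Gs(1) by blast
  then obtain h where h: "h \<in> hom (G i') (G j')" "v = (G i', h, G j')" by (auto simp: group_cat_on_simps)
  have "h (f i' z) = f j' z" if "z \<in> carrier C" for z
  proof -
    have "compose (carrier C) h (restrict (f i') (carrier C)) = restrict (f j') (carrier C)"
      using v(2) unfolding h(2) a_def group_cat_on_simps by simp
    from fun_cong[OF this, of z] show ?thesis using that by (simp add: compose_def)
  qed
  then show False using no' h(1) by blast
qed

end
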